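(* Let $\{X_i:i\in[n]\}$, $[n]=\{1,\dots,n\}$, be real-valued random variables with $\mathbb{E}X_i=0$. Assume that for every $i\in[n]$ there is a set $A_i\subset[n]$ such that $X_i$ is independent of $\{X_j:j\notin A_i\}$, and that for every $i\in[n]$ and $j\in A_i$ there is a set $A_{ij}\supset A_i$, $A_{ij}\subset[n]$, such that $\{X_i,X_j\}$ is independent of $\{X_k:k\notin A_{ij}\}$. Let $\sigma^2=\mathrm{Var}(\sum_{i\in[n]}X_i)\in(0,\infty)$. Let $A\subset[n]$ and $B\subset[n]$ be two arbitrary nonempty index sets. Let $\xi_A=h(X_A)\ge0$ be a nonnegative measurable function of $X_A=\{X_i:i\in A\}$, $\eta_B=a-c\sum_{m\in B}|X_m|/\sigma$ and $\zeta_B=b+c\sum_{m\in B}|X_m|/\sigma$, where $a,b,c\in\mathbb{R}$ satisfy $a\le b$ and $c\ge1$. Let $S_A=\sum_{i\in N_A^c}X_i$. Then $$\mathbb{E}\{\xi_A\mathbf 1(\eta_B\le S_A/\sigma\le\zeta_B)\}\le156\,\|\xi_A\|_{4/3}\cdot\sum_{i=0}^7\delta_i,$$ where $\delta_i\ge0$ and $$\delta_0=\frac{b-a}{100},\quad \delta_1=\frac c\sigma\sum_{i\in N_A}\|X_i\|_4,\quad \delta_2=\frac c\sigma\sum_{m\in B}\|X_m\|_4,$$ $$\delta_3=\frac c{\sigma^2}\sum_{m\in B}\sum_{k\in N_m}\|X_k\|_4\|X_m\|_4,\quad \delta_4=\frac c{\sigma^2}\sum_{(i,j)\in D_A}\|X_i\|_4\|X_j\|_4,$$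 $$\delta_5=\frac c{\sigma^3}\sum_{i\in[n]}|A_i|^2\|X_i\|_4^3+\frac c{\sigma^3}\sum_{i\in[n]}\sum_{j\in A_i}|A_i|\|X_j\|_4^3,$$ $$\delta_6^2=\frac{c^2}{\sigma^4}\sum_{i\in[n]}\sum_{j\in A_i}\sum_{k\in A_{ij}}\sum_{l\in A_k\cup N_k}\|X_i\|_4\|X_j\|_4\|X_k\|_4\|X_l\|_4+\frac{c^2}{\sigma^4}\sum_{i\in[n]}\sum_{j\in A_i\cup N_i}|A_i|^2\|X_i\|_4^3\|X_j\|_4+\frac{c^2}{\sigma^4}\sum_{i\in[n]}\sum_{j\in A_i}\sum_{k\in A_i\cup N_j}|A_i|\|X_j\|_4^3\|X_k\|_4,$$ $$\delta_7^2=\frac{c^2}{\sigma^5}\sum_{i\in[n]}|A_i|^2\sum_{j\in A_i\cup N_i}\sum_{k\in N_j}\|X_i\|_4^3\|X_j\|_4\|X_k\|_4+\frac{c^2}{\sigma^5}\sum_{i\in[n]}\sum_{j\in A_i}\sum_{k\in A_i\cup N_j}\sum_{l\in N_k}|A_i|\|X_j\|_4^3\|X_k\|_4\|X_l\|_4$$ $$\qquad+\frac{c^2}{\sigma^5}\sum_{i\in[n]}\sum_{(j,k)\in D_i}|A_i|^2\|X_i\|_4^3\|X_j\|_4\|X_k\|_4+\frac{c^2}{\sigma^5}\sum_{i\in[n]}\sum_{j\in A_i}\sum_{(k,l)\in D_j}|A_i|\|X_j\|_4^3\|X_k\|_4\|X_l\|_4.$$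
   Context: $\|X\|_p=(\mathbb{E}|X|^p)^{1/p}$; $|A|$ is the cardinality of a set $A$. For $A\subset[n]$: $N_A=\{k\in[n]:A_k\cap A\ne\varnothing\}$, $N_A^c=[n]\setminus N_A$, $D_A=\{(i,j):i\in[n],\ j\in A_i,\ A\cap A_{ij}\ne\varnothing\}$. For $i\in[n]$: $N_i=N_{\{i\}}=\{k\in[n]:i\in A_k\}$ and $D_i=D_{\{i\}}=\{(k,l):l\in A_k,\ i\in A_{kl}\}$. *)

theory Defs
  imports "HOL-Probability.Probability"
begin

text \<open>
  No moment assumption is imposed on the variables, so the \<open>L\<^sup>p\<close>-norm
  \<open>(E \<bar>X\<bar> powr p) powr (1/p)\<close> (for \<open>p > 0\<close>) takes values in the extended
  nonnegative reals; it is \<open>\<infinity>\<close> iff the moment is.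
\<close>

definition lp_norm :: "'a measure \<Rightarrow> real \<Rightarrow> ('a \<Rightarrow> real) \<Rightarrow> ennreal" where
  "lp_norm M p X =
     (let m = (\<integral>\<^sup>+ \<omega>. ennreal (\<bar>X \<omega>\<bar> powr p) \<partial>M)
      in if m = \<infinity> then \<infinity> else ennreal (enn2real m powr (1 / p)))"

text \<open>The random vector \<open>X\<^sub>I = {X\<^sub>i : i \<in> I}\<close>, an element of the product space over \<open>I\<close>.\<close>

definition subfamily :: "('i \<Rightarrow> 'a \<Rightarrow> real) \<Rightarrow> 'i set \<Rightarrow> 'a \<Rightarrow> ('i \<Rightarrow> real)" where
  "subfamily X I \<omega> = (\<lambda>i\<in>I. X i \<omega>)"

text \<open>
  The two families are independent of each other as random vectors; nothing is said about
  independence within a family. A single variable is the family over a singleton.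
\<close>

definition indep_subfamilies ::
  "'a measure \<Rightarrow> ('i \<Rightarrow> 'a \<Rightarrow> real) \<Rightarrow> 'i set \<Rightarrow> 'i set \<Rightarrow> bool" where
  "indep_subfamilies M X I J \<longleftrightarrow>
     prob_space.indep_var M
       (Pi\<^sub>M I (\<lambda>_. borel)) (subfamily X I)
       (Pi\<^sub>M J (\<lambda>_. borel)) (subfamily X J)"

text \<open>
  \<open>N\<^sub>A\<close> and \<open>D\<^sub>A\<close>. The sets \<open>A\<^sub>i\<close>, \<open>A\<^sub>i\<^sub>j\<close> are passed as \<open>\<A> i\<close>, \<open>\<A>\<^sub>2 i j\<close>;
  \<open>N\<^sub>i\<close> and \<open>D\<^sub>i\<close> are the instances \<open>A = {i}\<close>.
\<close>

definition nbh :: "nat \<Rightarrow> (nat \<Rightarrow> nat set) \<Rightarrow> nat set \<Rightarrow> nat set" where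
  "nbh n \<A> A = {k \<in> {1..n}. \<A> k \<inter> A \<noteq> {}}"

definition pair_nbh ::
  "nat \<Rightarrow> (nat \<Rightarrow> nat set) \<Rightarrow> (nat \<Rightarrow> nat \<Rightarrow> nat set) \<Rightarrow> nat set \<Rightarrow> (nat \<times> nat) set" where
  "pair_nbh n \<A> \<A>\<^sub>2 A = {(i, j). i \<in> {1..n} \<and> j \<in> \<A> i \<and> A \<inter> \<A>\<^sub>2 i j \<noteq> {}}"

end

theory Submission
  imports Defs
begin

text \<open>
  Divide all variables by \<open>\<sigma>\<close>, so that the sum has variance one, and let \<open>W\<close> be the sum of the
  \<open>X\<^sub>i\<close> with \<open>i \<notin> N\<^sub>A\<close>; each of these \<open>X\<^sub>i\<close> is independent of \<open>\<xi>\<close>. The inequality is a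
  concentration inequality for \<open>W\<close> on an interval with random end points, weighted by \<open>\<xi>\<close>, and it
  is proved by Stein's method, applied to an inequality that feeds on itself.

  \<^bold>\<open>One Stein step.\<close> Let \<open>f'\<close> be the trapezoid that equals one on \<open>[\<eta>, \<zeta>]\<close> and falls to zero
  linearly over a length \<open>\<epsilon>\<close> on each side, and let \<open>f\<close> be its antiderivative that is odd about the
  midpoint \<open>(a + b) / 2\<close>. On the one hand, \<open>\<bar>f\<bar>\<close> is at most half the area of the trapezoid, so that
  \<open>E \<xi> W f(W)\<close> is bounded by \<open>b - a\<close>, \<open>\<epsilon>\<close> and the second term \<open>\<delta>\<^sub>2\<close>. On the other hand \<open>X\<^sub>i\<close> is
  centred and independent of \<open>\<xi>\<close> and of all \<open>X\<^sub>j\<close> with \<open>j \<notin> A\<^sub>i\<close>; so \<open>f(W)\<close> may be compared with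
  the value obtained by deleting the indices in \<open>A\<^sub>i\<close> both from \<open>W\<close> and from the random end points.
  Changing the end points costs \<open>\<delta>\<^sub>3\<close>. A Taylor expansion of the change in \<open>W\<close> produces
  \<open>E \<xi> f'(W) \<Sum> X\<^sub>i X\<^sub>j\<close>, the sum over neighbouring pairs, whose mean is \<open>E W\<^sup>2\<close>, close to one up to
  \<open>\<delta>\<^sub>1\<close>, and whose fluctuation is controlled by \<open>\<delta>\<^sub>4\<close> and the first part of \<open>\<delta>\<^sub>6\<close>. As \<open>f'\<close>
  dominates the indicator of the event in question, this bounds its probability, apart from the
  second order remainder of the Taylor expansion.

  \<^bold>\<open>The remainder is again a concentration probability.\<close> With \<open>Y\<^sub>i\<close> the sum of \<open>X\<^sub>j\<close> over
  the \<open>j \<in> A\<^sub>i\<close> outside \<open>N\<^sub>A\<close>, the remainder is at most \<open>\<xi> \<bar>X\<^sub>i\<bar> Y\<^sub>i\<^sup>2 / (2 \<epsilon>)\<close> on the event that \<open>W\<close> comes close to one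
  of the two sloping parts of \<open>f'\<close>, and zero elsewhere. Since
  \<open>\<bar>X\<^sub>i\<bar> Y\<^sub>i\<^sup>2 \<le> \<bar>A\<^sub>i\<bar>\<^sup>2 \<bar>X\<^sub>i\<bar>\<^sup>3 + \<bar>A\<^sub>i\<bar> \<Sum> \<bar>X\<^sub>j\<bar>\<^sup>3\<close>, it is a combination of terms of the same kind as
  the left-hand side, with \<open>\<xi> \<bar>X\<^sub>j\<bar>\<^sup>3\<close> in place of \<open>\<xi>\<close>, with \<open>A \<union> {j}\<close> in place of \<open>A\<close>, with blurred
  end points that also contain the indices in \<open>A\<^sub>i \<union> N\<^sub>j\<close>, and with an interval of length \<open>\<epsilon>\<close>.
  If the inequality holds with a constant \<open>\<kappa>\<close>, then the remainder is at most
  \<open>(\<kappa> / \<epsilon>) ((\<epsilon> / 100 + \<delta>\<^sub>1 + \<dots> + \<delta>\<^sub>7) \<delta>\<^sub>5 + 2 \<delta>\<^sub>6\<^sup>2 + \<delta>\<^sub>7\<^sup>2)\<close>: the terms of \<open>\<delta>\<^sub>6\<^sup>2\<close> and \<open>\<delta>\<^sub>7\<^sup>2\<close> that carry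
  a third power account for the increments of \<open>\<delta>\<^sub>1, \<dots>, \<delta>\<^sub>4\<close> under this replacement, weighted as in
  \<open>\<delta>\<^sub>5\<close>. With \<open>\<epsilon> = 20 (\<delta>\<^sub>5 + \<delta>\<^sub>6 + \<delta>\<^sub>7)\<close> this is a small multiple of \<open>\<kappa> (\<delta>\<^sub>1 + \<dots> + \<delta>\<^sub>7)\<close>.

  \<^bold>\<open>Self-improvement.\<close> Hence a constant \<open>\<kappa> \<ge> 156\<close> may be replaced by \<open>max 156 (3 \<kappa> / 5)\<close>
  (\<open>concentration_bound_improve\<close>). Some finite constant is valid from the start, since the
  left-hand side is at most \<open>\<parallel>\<xi>\<parallel>\<^bsub>4/3\<^esub>\<close> and \<open>\<delta>\<^sub>5 > 0\<close> (\<open>concentration_bound_trivial\<close>); iterating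
  leads to 156 (\<open>concentration_bound_156\<close>).

  \<^bold>\<open>Why the norms are those of \<open>L\<^sup>4\<^sup>/\<^sup>3\<close> and \<open>L\<^sup>4\<close>.\<close> Write \<open>\<xi> = \<theta>\<^sup>3\<close>, so that \<open>E \<xi>\<^sup>4\<^sup>/\<^sup>3 = E \<theta>\<^sup>4\<close>. An \<open>X\<^sub>i\<close>
  with \<open>i \<notin> N\<^sub>A\<close> has, relative to the density \<open>\<theta>\<^sup>4\<close>, the same distribution as before up to
  normalization, so that products of two such variables, although not jointly independent of \<open>\<theta>\<close>,
  are bounded by Cauchy--Schwarz; and \<open>\<theta>\<^sup>3 \<bar>Z\<bar> \<bar>X\<^sub>m\<bar>\<close> is integrable for an arbitrary \<open>X\<^sub>m\<close> once \<open>\<theta>\<^sup>4 Z\<^sup>2\<close> is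
  (\<open>Hoelder_cubed\<close>). The replacement of \<open>\<theta>\<close> by \<open>\<theta> \<bar>X\<^sub>i\<bar>\<close> stays within this class.

  For the induction the multiple \<open>c\<close> of the sum over \<open>B\<close> is replaced by a sum with arbitrary
  nonnegative weights \<open>w\<^sub>m\<close>. The case \<open>w = c 1\<^sub>B\<close> gives the result, because \<open>c \<ge> 1\<close> only increases the
  other terms.
\<close>

section \<open>A smoothed indicator and its antiderivative\<close>

text \<open>
  Written with positive parts, the ramp that rises from 0 to 1 on \<open>[0, \<epsilon>]\<close> and its antiderivative
  need no case distinction, and their measurability is immediate.
\<close>

definition ramp :: "real \<Rightarrow> real \<Rightarrow> real" where
  "ramp \<epsilon> z = max 0 (z / \<epsilon>) - max 0 (z / \<epsilon> - 1)"

definition ramp_integral :: "real \<Rightarrow> real \<Rightarrow> real" where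
  "ramp_integral \<epsilon> z = \<epsilon> * ((max 0 (z / \<epsilon>))\<^sup>2 / 2 - (max 0 (z / \<epsilon> - 1))\<^sup>2 / 2)"

text \<open>
  The remainder vanishes unless the segment between \<open>y\<close> and \<open>t\<close> meets \<open>[0, 1]\<close>, because outside
  this interval the antiderivative is affine. This localization makes the remainder of Stein's
  method a concentration probability.
\<close>

lemma unit_ramp_taylor:
  fixes t y :: real
  defines "p \<equiv> \<lambda>t::real. (max 0 t)\<^sup>2 / 2 - (max 0 (t - 1))\<^sup>2 / 2"
    and "r \<equiv> \<lambda>t::real. max 0 t - max 0 (t - 1)"
  shows "\<bar>p t - p y - (t - y) * r t\<bar> \<le> (t - y)\<^sup>2 / 2 * of_bool (min t y \<le> 1 \<and> 0 \<le> max t y)"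
proof -
  have pr: "p z = 0" "r z = 0" if "z \<le> 0" for z using that by (auto simp: p_def r_def)
  have pr1: "p z = z\<^sup>2 / 2" "r z = z" if "0 \<le> z" "z \<le> 1" for z
    using that by (auto simp: p_def r_def max_def)
  have pr2: "p z = z - 1/2" "r z = 1" if "1 \<le> z" for z
    using that by (auto simp: p_def r_def max_def power2_eq_square field_simps)
  consider "t \<le> 0" "y \<le> 0" | "t \<le> 0" "0 \<le> y" "y \<le> 1" | "t \<le> 0" "1 \<le> y"
    | "0 \<le> t" "t \<le> 1" "y \<le> 0" | "0 \<le> t" "t \<le> 1" "0 \<le> y" "y \<le> 1" | "0 \<le> t" "t \<le> 1" "1 \<le> y"
    | "1 \<le> t" "y \<le> 0" | "1 \<le> t" "0 \<le> y" "y \<le> 1" | "1 \<le> t" "1 \<le> y" by linarith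
  then show ?thesis
  proof cases
    case 1 then show ?thesis by (simp add: pr)
  next
    case 2
    have "y\<^sup>2 \<le> (y - t)\<^sup>2" by (rule power_mono) (use 2 in auto)
    with 2 show ?thesis by (simp add: pr pr1 power2_commute)
  next
    case 3
    have "0 \<le> (y - 1)\<^sup>2" by simp
    then have "y - 1/2 \<le> y\<^sup>2 / 2" by (simp add: power2_eq_square algebra_simps)
    moreover have "y\<^sup>2 \<le> (y - t)\<^sup>2" by (rule power_mono) (use 3 in auto)
    ultimately show ?thesis using 3 by (simp add: pr pr2 power2_commute)
  next
    case 4
    have e: "p t - p y - (t - y) * r t = - (t\<^sup>2/2) + y * t"
      using 4 by (simp add: pr pr1 power2_eq_square algebra_simps)
    have abs_est: "\<bar>- (a / 2) + b\<bar> \<le> (a + c - 2 * b) / 2" if "b \<le> 0" "0 \<le> c" "0 \<le> a" for a b c :: real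
      using that by (auto simp: abs_if field_simps)
    have e2: "(t - y)\<^sup>2 = t\<^sup>2 + y\<^sup>2 - 2 * (y * t)" by (simp add: power2_diff)
    have "y * t \<le> 0" using 4 by (simp add: mult_nonpos_nonneg)
    moreover have "0 \<le> y\<^sup>2" "0 \<le> t\<^sup>2" by auto
    ultimately have "\<bar>- (t\<^sup>2/2) + y * t\<bar> \<le> (t - y)\<^sup>2 / 2"
      unfolding e2 by (rule abs_est)
    with e 4 show ?thesis by simp
  next
    case 5
    then have "p t - p y - (t - y) * r t = - ((t - y)\<^sup>2 / 2)"
      by (simp add: pr1 power2_eq_square field_simps)
    with 5 show ?thesis by (simp add: min_le_iff_disj le_max_iff_disj)
  next
    case 6
    have e: "p t - p y - (t - y) * r t = - ((t - y)\<^sup>2 / 2) + (y - 1)\<^sup>2 / 2"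
      using 6 by (simp add: pr1 pr2 power2_eq_square field_simps)
    have "(y - 1)\<^sup>2 \<le> (y - t)\<^sup>2" by (rule power_mono) (use 6 in auto)
    with e 6 show ?thesis by (simp add: power2_commute[of t y])
  next
    case 7
    have e: "p t - p y - (t - y) * r t = y - 1/2"
      using 7 by (simp add: pr pr2 field_simps)
    have "(1 - y)\<^sup>2 \<le> (t - y)\<^sup>2" by (rule power_mono) (use 7 in auto)
    then have "(1 - y)\<^sup>2 / 2 \<le> (t - y)\<^sup>2 / 2" by simp
    moreover have "(1 - y)\<^sup>2 / 2 = (1/2 - y) + y\<^sup>2 / 2" by (simp add: power2_eq_square field_simps)
    then have "1/2 - y \<le> (1 - y)\<^sup>2 / 2" by simp
    moreover have "\<bar>y - 1/2\<bar> = 1/2 - y" using 7 by simp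
    ultimately have "\<bar>y - 1/2\<bar> \<le> (t - y)\<^sup>2 / 2" by (simp only: order_trans)
    with e 7 show ?thesis by simp
  next
    case 8
    have e: "p t - p y - (t - y) * r t = - ((1 - y)\<^sup>2 / 2)"
      using 8 by (simp add: pr1 pr2 power2_eq_square field_simps)
    have "(1 - y)\<^sup>2 \<le> (t - y)\<^sup>2" by (rule power_mono) (use 8 in auto)
    with e 8 show ?thesis by simp
  next
    case 9 then show ?thesis by (simp add: pr2)
  qed
qed

lemma ramp_integral_taylor:
  assumes "\<epsilon> > 0"
  shows "\<bar>ramp_integral \<epsilon> z - ramp_integral \<epsilon> (z - u) - u * ramp \<epsilon> z\<bar>
     \<le> u\<^sup>2 / (2 * \<epsilon>) * of_bool (min z (z - u) \<le> \<epsilon> \<and> 0 \<le> max z (z - u))"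
proof -
  have *: "min (z / \<epsilon>) ((z - u) / \<epsilon>) \<le> 1 \<and> 0 \<le> max (z / \<epsilon>) ((z - u) / \<epsilon>)
     \<longleftrightarrow> min z (z - u) \<le> \<epsilon> \<and> 0 \<le> max z (z - u)"
    using assms by (auto simp: min_le_iff_disj le_max_iff_disj field_simps)
  have d: "z / \<epsilon> - (z - u) / \<epsilon> = u / \<epsilon>" using assms by (simp add: field_simps)
  have "\<bar>ramp_integral \<epsilon> z - ramp_integral \<epsilon> (z - u) - u * ramp \<epsilon> z\<bar> = \<epsilon> *
    \<bar>((max 0 (z / \<epsilon>))\<^sup>2 / 2 - (max 0 (z / \<epsilon> - 1))\<^sup>2 / 2) - ((max 0 ((z-u) / \<epsilon>))\<^sup>2 / 2 - (max 0 ((z-u) / \<epsilon> - 1))\<^sup>2 / 2)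
      - (z / \<epsilon> - (z - u) / \<epsilon>) * ramp \<epsilon> z\<bar>"
  proof -
    have "\<epsilon> * \<bar>x\<bar> = \<bar>\<epsilon> * x\<bar>" for x using assms by (simp add: abs_mult)
    moreover have "u * ramp \<epsilon> z = \<epsilon> * (u / \<epsilon> * ramp \<epsilon> z)" using assms by simp
    ultimately show ?thesis
      unfolding d ramp_integral_def by (simp only: right_diff_distrib)
  qed
  also have "\<dots> \<le> \<epsilon> * ((u / \<epsilon>)\<^sup>2 / 2 * of_bool (min z (z - u) \<le> \<epsilon> \<and> 0 \<le> max z (z - u)))"
    using unit_ramp_taylor[of "z / \<epsilon>" "(z - u) / \<epsilon>"] assms
    by (intro mult_left_mono) (simp_all only: * d ramp_def less_imp_le)
  also have "\<dots> = u\<^sup>2 / (2 * \<epsilon>) * of_bool (min z (z - u) \<le> \<epsilon> \<and> 0 \<le> max z (z - u))"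
    using assms by (simp add: power2_eq_square)
  finally show ?thesis .
qed

lemma ramp_bounds:
  assumes "\<epsilon> > 0"
  shows "0 \<le> ramp \<epsilon> z" "ramp \<epsilon> z \<le> 1" "z \<le> 0 \<Longrightarrow> ramp \<epsilon> z = 0" "\<epsilon> \<le> z \<Longrightarrow> ramp \<epsilon> z = 1"
  using assms by (auto simp: ramp_def max_def field_simps)

lemma ramp_mono: "\<epsilon> > 0 \<Longrightarrow> y \<le> z \<Longrightarrow> ramp \<epsilon> y \<le> ramp \<epsilon> z"
  by (auto simp: ramp_def max_def divide_right_mono field_simps)

text \<open>
  The quadratic Taylor bound shows that the ramp is the derivative; monotonicity and the Lipschitz
  bound follow from its range \<open>[0, 1]\<close>.
\<close>

lemma ramp_integral_increment:
  assumes "\<epsilon> > 0" "y \<le> z"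
  shows "ramp_integral \<epsilon> y \<le> ramp_integral \<epsilon> z" "ramp_integral \<epsilon> z - ramp_integral \<epsilon> y \<le> z - y"
proof -
  \<comment> \<open>the quadratic error bound serves as the sandwiching function\<close>
  have der: "(ramp_integral \<epsilon> has_real_derivative ramp \<epsilon> t) (at t)" for t
    unfolding has_field_derivative_def
  proof (rule has_derivativeI_sandwich[where e = 1 and H = "\<lambda>s. \<bar>s - t\<bar> / (2 * \<epsilon>)"])
    show "bounded_linear ((*) (ramp \<epsilon> t))" by (rule bounded_linear_mult_right)
    show "((\<lambda>s. \<bar>s - t\<bar> / (2 * \<epsilon>)) \<longlongrightarrow> 0) (at t within UNIV)"
      using assms(1) by (auto intro!: tendsto_eq_intros)
    show "norm (ramp_integral \<epsilon> s - ramp_integral \<epsilon> t - ramp \<epsilon> t * (s - t)) / norm (s - t) \<le> \<bar>s - t\<bar> / (2 * \<epsilon>)"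
      if "s \<noteq> t" for s
    proof -
      have "\<bar>ramp_integral \<epsilon> t - ramp_integral \<epsilon> s - (t - s) * ramp \<epsilon> t\<bar> \<le> (t - s)\<^sup>2 / (2 * \<epsilon>)"
        using ramp_integral_taylor[OF assms(1), of t "t - s"] assms(1)
        by (auto simp: of_bool_def split: if_splits intro: order_trans)
      moreover have "ramp_integral \<epsilon> s - ramp_integral \<epsilon> t - ramp \<epsilon> t * (s - t)
        = - (ramp_integral \<epsilon> t - ramp_integral \<epsilon> s - (t - s) * ramp \<epsilon> t)" by (simp add: algebra_simps)
      ultimately have "\<bar>ramp_integral \<epsilon> s - ramp_integral \<epsilon> t - ramp \<epsilon> t * (s - t)\<bar> \<le> \<bar>s - t\<bar> * \<bar>s - t\<bar> / (2 * \<epsilon>)"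
        by (simp only: abs_minus_cancel power2_commute[of t s] abs_mult_self_eq flip: power2_eq_square)
          (simp add: power2_eq_square[of "\<bar>_\<bar>"] flip: power2_eq_square)
      then show ?thesis using that assms(1) by (simp add: field_simps)
    qed
  qed simp_all
  show "ramp_integral \<epsilon> y \<le> ramp_integral \<epsilon> z"
    by (rule DERIV_nonneg_imp_nondecreasing[OF assms(2)]) (use der ramp_bounds(1)[OF assms(1)] in blast)
  have "z - ramp_integral \<epsilon> z \<ge> y - ramp_integral \<epsilon> y"
  proof (rule DERIV_nonneg_imp_nondecreasing[OF assms(2)])
    fix t
    show "\<exists>d. ((\<lambda>z. z - ramp_integral \<epsilon> z) has_real_derivative d) (at t) \<and> 0 \<le> d"
      by (rule exI[of _ "1 - ramp \<epsilon> t"]) (auto intro!: derivative_intros der ramp_bounds assms)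
  qed
  then show "ramp_integral \<epsilon> z - ramp_integral \<epsilon> y \<le> z - y" by simp
qed

text \<open>
  The trapezoid equals 1 on \<open>[-h, h]\<close> and is supported in \<open>[-h - \<epsilon>, h + \<epsilon>]\<close>. The constant subtracted
  in its antiderivative, half the area, makes the latter odd; only with this normalization does
  the change of \<open>h\<close> to \<open>h'\<close> move it by at most \<open>\<bar>h - h'\<bar>\<close>.
\<close>

definition trapezoid :: "real \<Rightarrow> real \<Rightarrow> real \<Rightarrow> real" where
  "trapezoid \<epsilon> h y = ramp \<epsilon> (y + h + \<epsilon>) - ramp \<epsilon> (y - h)"

definition stein_fun :: "real \<Rightarrow> real \<Rightarrow> real \<Rightarrow> real" where
  "stein_fun \<epsilon> h y = ramp_integral \<epsilon> (y + h + \<epsilon>) - ramp_integral \<epsilon> (y - h) - (h + \<epsilon> / 2)"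

lemma trapezoid_bounds:
  assumes "\<epsilon> > 0" "h \<ge> 0"
  shows "0 \<le> trapezoid \<epsilon> h y" "trapezoid \<epsilon> h y \<le> 1"
  using ramp_mono[OF assms(1), of "y - h" "y + h + \<epsilon>"] ramp_bounds(1)[OF assms(1), of "y - h"]
    ramp_bounds(2)[OF assms(1), of "y + h + \<epsilon>"] assms
  by (auto simp: trapezoid_def)

lemma trapezoid_eq_1: "\<epsilon> > 0 \<Longrightarrow> \<bar>y\<bar> \<le> h \<Longrightarrow> trapezoid \<epsilon> h y = 1"
  by (simp add: trapezoid_def ramp_bounds(3,4) abs_le_iff)

lemma stein_fun_bound:
  assumes "\<epsilon> > 0" "h \<ge> 0"
  shows "\<bar>stein_fun \<epsilon> h y\<bar> \<le> h + \<epsilon> / 2"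
  using ramp_integral_increment[OF assms(1), of "y - h" "y + h + \<epsilon>"] assms
  by (auto simp: stein_fun_def abs_le_iff)

lemma stein_fun_width:
  assumes "\<epsilon> > 0" "h' \<le> h"
  shows "\<bar>stein_fun \<epsilon> h y - stein_fun \<epsilon> h' y\<bar> \<le> h - h'"
  using ramp_integral_increment[OF assms(1), of "y + h' + \<epsilon>" "y + h + \<epsilon>"]
    ramp_integral_increment[OF assms(1), of "y - h" "y - h'"] assms
  by (auto simp: stein_fun_def abs_le_iff)

lemma stein_fun_taylor:
  assumes "\<epsilon> > 0"
  shows "\<bar>stein_fun \<epsilon> h y - stein_fun \<epsilon> h (y - u) - u * trapezoid \<epsilon> h y\<bar> \<le> u\<^sup>2 / (2 * \<epsilon>) *
     (of_bool (min y (y - u) \<le> - h \<and> - h - \<epsilon> \<le> max y (y - u))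
      + of_bool (min y (y - u) \<le> h + \<epsilon> \<and> h \<le> max y (y - u)))"
proof -
  have 1: "min (y + h + \<epsilon>) (y + h + \<epsilon> - u) \<le> \<epsilon> \<and> 0 \<le> max (y + h + \<epsilon>) (y + h + \<epsilon> - u) \<longleftrightarrow>
     min y (y - u) \<le> - h \<and> - h - \<epsilon> \<le> max y (y - u)" by linarith
  have 2: "min (y - h) (y - h - u) \<le> \<epsilon> \<and> 0 \<le> max (y - h) (y - h - u) \<longleftrightarrow>
     min y (y - u) \<le> h + \<epsilon> \<and> h \<le> max y (y - u)" by linarith
  have 3: "y - u + h + \<epsilon> = y + h + \<epsilon> - u" "y - u - h = y - h - u" by auto
  show ?thesis
    using ramp_integral_taylor[OF assms, of "y + h + \<epsilon>" u] ramp_integral_taylor[OF assms, of "y - h" u]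
    unfolding 1 2 stein_fun_def trapezoid_def 3 distrib_left right_diff_distrib
    by linarith
qed

lemma ramp_measurable [measurable]:
  "f \<in> borel_measurable N \<Longrightarrow> (\<lambda>\<omega>. ramp \<epsilon> (f \<omega>)) \<in> borel_measurable N"
  "f \<in> borel_measurable N \<Longrightarrow> (\<lambda>\<omega>. ramp_integral \<epsilon> (f \<omega>)) \<in> borel_measurable N"
  unfolding ramp_def ramp_integral_def by simp_all

lemma stein_fun_measurable [measurable]:
  assumes [measurable]: "f \<in> borel_measurable N" "g \<in> borel_measurable N"
  shows "(\<lambda>\<omega>. stein_fun \<epsilon> (f \<omega>) (g \<omega>)) \<in> borel_measurable N"
    "(\<lambda>\<omega>. trapezoid \<epsilon> (f \<omega>) (g \<omega>)) \<in> borel_measurable N"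
  unfolding stein_fun_def trapezoid_def by measurable

section \<open>Inequalities of Hoelder type and independence\<close>

text \<open>
  Cauchy--Schwarz for the measure with density \<open>g\<close>, stated with upper bounds for the two norms,
  since in the applications only such bounds are known.
\<close>

lemma weighted_Cauchy_Schwarz:
  fixes g U V :: "'a \<Rightarrow> real"
  assumes [measurable]: "g \<in> borel_measurable M" "U \<in> borel_measurable M" "V \<in> borel_measurable M"
    and g: "\<And>\<omega>. 0 \<le> g \<omega>"
    and U: "integrable M (\<lambda>\<omega>. g \<omega> * (U \<omega>)\<^sup>2)" "(\<integral>\<omega>. g \<omega> * (U \<omega>)\<^sup>2 \<partial>M) \<le> u\<^sup>2"
    and V: "integrable M (\<lambda>\<omega>. g \<omega> * (V \<omega>)\<^sup>2)" "(\<integral>\<omega>. g \<omega> * (V \<omega>)\<^sup>2 \<partial>M) \<le> v\<^sup>2"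
    and "0 \<le> u" "0 \<le> v"
  shows "integrable M (\<lambda>\<omega>. g \<omega> * \<bar>U \<omega>\<bar> * \<bar>V \<omega>\<bar>)" "(\<integral>\<omega>. g \<omega> * \<bar>U \<omega>\<bar> * \<bar>V \<omega>\<bar> \<partial>M) \<le> u * v"
proof -
  let ?a = "\<integral>\<omega>. g \<omega> * (U \<omega>)\<^sup>2 \<partial>M" and ?b = "\<integral>\<omega>. g \<omega> * (V \<omega>)\<^sup>2 \<partial>M"
  let ?c = "\<integral>\<omega>. g \<omega> * \<bar>U \<omega>\<bar> * \<bar>V \<omega>\<bar> \<partial>M"
  show int: "integrable M (\<lambda>\<omega>. g \<omega> * \<bar>U \<omega>\<bar> * \<bar>V \<omega>\<bar>)"
  proof (rule Bochner_Integration.integrable_bound[OF Bochner_Integration.integrable_add[OF U(1) V(1)]])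
    show "AE \<omega> in M. norm (g \<omega> * \<bar>U \<omega>\<bar> * \<bar>V \<omega>\<bar>) \<le> norm (g \<omega> * (U \<omega>)\<^sup>2 + g \<omega> * (V \<omega>)\<^sup>2)"
    proof (rule AE_I2)
      fix \<omega>
      have "0 \<le> (\<bar>U \<omega>\<bar> - \<bar>V \<omega>\<bar>)\<^sup>2" "0 \<le> \<bar>U \<omega>\<bar> * \<bar>V \<omega>\<bar>" by auto
      then have "\<bar>U \<omega>\<bar> * \<bar>V \<omega>\<bar> \<le> (U \<omega>)\<^sup>2 + (V \<omega>)\<^sup>2" unfolding power2_diff power2_abs by linarith
      from mult_left_mono[OF this g[of \<omega>]]
      show "norm (g \<omega> * \<bar>U \<omega>\<bar> * \<bar>V \<omega>\<bar>) \<le> norm (g \<omega> * (U \<omega>)\<^sup>2 + g \<omega> * (V \<omega>)\<^sup>2)"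
        using g[of \<omega>] by (simp add: abs_mult distrib_left mult.assoc)
    qed
  qed measurable
  \<comment> \<open>the quadratic polynomial in the variable s is nonnegative, so its discriminant is not positive\<close>
  have quad: "0 \<le> s\<^sup>2 * ?a - 2 * s * ?c + ?b" for s
  proof -
    have "0 \<le> (\<integral>\<omega>. g \<omega> * (s * \<bar>U \<omega>\<bar> - \<bar>V \<omega>\<bar>)\<^sup>2 \<partial>M)"
      by (rule integral_nonneg_AE) (use g in auto)
    also have "(\<lambda>\<omega>. g \<omega> * (s * \<bar>U \<omega>\<bar> - \<bar>V \<omega>\<bar>)\<^sup>2) =
      (\<lambda>\<omega>. s\<^sup>2 * (g \<omega> * (U \<omega>)\<^sup>2) - 2 * s * (g \<omega> * \<bar>U \<omega>\<bar> * \<bar>V \<omega>\<bar>) + g \<omega> * (V \<omega>)\<^sup>2)"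
      by (rule ext) (simp add: power2_diff power_mult_distrib algebra_simps)
    also have "(\<integral>\<omega>. s\<^sup>2 * (g \<omega> * (U \<omega>)\<^sup>2) - 2 * s * (g \<omega> * \<bar>U \<omega>\<bar> * \<bar>V \<omega>\<bar>) + g \<omega> * (V \<omega>)\<^sup>2 \<partial>M)
      = s\<^sup>2 * ?a - 2 * s * ?c + ?b" using U(1) V(1) int by simp
    finally show ?thesis .
  qed
  have a0: "0 \<le> ?a" and b0: "0 \<le> ?b" and c0: "0 \<le> ?c" by (auto intro!: integral_nonneg_AE simp: g)
  have "?c\<^sup>2 \<le> ?a * ?b"
  proof (cases "?a = 0")
    case True
    have "?c = 0"
    proof (rule ccontr)
      assume "?c \<noteq> 0"
      with quad[of "(?b + 1) / (2 * ?c)"] True show False by (simp add: power2_eq_square)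
    qed
    then show ?thesis using True by simp
  next
    case False
    with quad[of "?c / ?a"] a0 show ?thesis by (simp add: power2_eq_square field_simps)
  qed
  also have "\<dots> \<le> u\<^sup>2 * v\<^sup>2" using U(2) V(2) a0 b0 by (intro mult_mono) auto
  finally have "?c\<^sup>2 \<le> (u * v)\<^sup>2" by (simp add: power_mult_distrib)
  then show "?c \<le> u * v" by (rule power2_le_imp_le) (use assms in auto)
qed

text \<open>
  With \<open>\<xi> = \<theta>\<^sup>3\<close> this is Hoelder's inequality with exponents \<open>4/3\<close> and \<open>4\<close> for \<open>\<xi> Z\<close> and \<open>Y\<close>, followed by
  \<open>L\<^sup>4\<^sup>/\<^sup>3 \<le> L\<^sup>2\<close> for \<open>Z\<close> relative to the density \<open>\<theta>\<^sup>4\<close>. Two applications of Cauchy--Schwarz give it: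
  \<open>\<theta>\<^sup>3 Z Y = (\<theta>\<^sup>2 Z) (\<theta> Y)\<close> and \<open>\<theta>\<^sup>2 Y\<^sup>2 = (\<theta>\<^sup>2) (Y\<^sup>2)\<close>.
\<close>

lemma Hoelder_cubed:
  fixes \<theta> Z Y :: "'a \<Rightarrow> real"
  assumes [measurable]: "\<theta> \<in> borel_measurable M" "Z \<in> borel_measurable M" "Y \<in> borel_measurable M"
    and \<theta>0: "\<And>\<omega>. 0 \<le> \<theta> \<omega>"
    and \<theta>: "integrable M (\<lambda>\<omega>. \<theta> \<omega> ^ 4)" "(\<integral>\<omega>. \<theta> \<omega> ^ 4 \<partial>M) \<le> 1"
    and Z: "integrable M (\<lambda>\<omega>. \<theta> \<omega> ^ 4 * (Z \<omega>)\<^sup>2)" "(\<integral>\<omega>. \<theta> \<omega> ^ 4 * (Z \<omega>)\<^sup>2 \<partial>M) \<le> z\<^sup>2"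
    and Y: "integrable M (\<lambda>\<omega>. Y \<omega> ^ 4)" "(\<integral>\<omega>. Y \<omega> ^ 4 \<partial>M) \<le> y ^ 4"
    and zy: "0 \<le> z" "0 \<le> y"
  shows "integrable M (\<lambda>\<omega>. \<theta> \<omega> ^ 3 * \<bar>Z \<omega>\<bar> * \<bar>Y \<omega>\<bar>)" "(\<integral>\<omega>. \<theta> \<omega> ^ 3 * \<bar>Z \<omega>\<bar> * \<bar>Y \<omega>\<bar> \<partial>M) \<le> z * y"
proof -
  note CS = weighted_Cauchy_Schwarz[where g = "\<lambda>_. 1" and M = M]
  have *: "integrable M (\<lambda>\<omega>. 1 * \<bar>(\<theta> \<omega>)\<^sup>2\<bar> * \<bar>(Y \<omega>)\<^sup>2\<bar>)" "(\<integral>\<omega>. 1 * \<bar>(\<theta> \<omega>)\<^sup>2\<bar> * \<bar>(Y \<omega>)\<^sup>2\<bar> \<partial>M) \<le> 1 * y\<^sup>2"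
    using \<theta> Y by (intro CS[where u = 1 and v = "y\<^sup>2"]; simp add: power_mult[symmetric])+
  have "integrable M (\<lambda>\<omega>. 1 * \<bar>(\<theta> \<omega>)\<^sup>2 * Z \<omega>\<bar> * \<bar>\<theta> \<omega> * Y \<omega>\<bar>)"
    "(\<integral>\<omega>. 1 * \<bar>(\<theta> \<omega>)\<^sup>2 * Z \<omega>\<bar> * \<bar>\<theta> \<omega> * Y \<omega>\<bar> \<partial>M) \<le> z * y"
    using * Z zy by (intro CS[where u = z and v = y]; simp add: power_mult[symmetric] power_mult_distrib)+
  moreover have "(\<lambda>\<omega>. 1 * \<bar>(\<theta> \<omega>)\<^sup>2 * Z \<omega>\<bar> * \<bar>\<theta> \<omega> * Y \<omega>\<bar>) = (\<lambda>\<omega>. \<theta> \<omega> ^ 3 * \<bar>Z \<omega>\<bar> * \<bar>Y \<omega>\<bar>)"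
    using \<theta>0 by (simp add: abs_mult power2_eq_square power3_eq_cube mult_ac)
  ultimately show "integrable M (\<lambda>\<omega>. \<theta> \<omega> ^ 3 * \<bar>Z \<omega>\<bar> * \<bar>Y \<omega>\<bar>)" "(\<integral>\<omega>. \<theta> \<omega> ^ 3 * \<bar>Z \<omega>\<bar> * \<bar>Y \<omega>\<bar> \<partial>M) \<le> z * y"
    by simp_all
qed

lemma (in prob_space) indep_set_mult:
  fixes U V :: "'a \<Rightarrow> real"
  assumes ind: "indep_set (sets G) (sets H)"
    and sub: "subalgebra M G" "subalgebra M H"
    and m: "U \<in> borel_measurable G" "V \<in> borel_measurable H"
    and int: "integrable M U" "integrable M V"
  shows "integrable M (\<lambda>\<omega>. U \<omega> * V \<omega>)" "expectation (\<lambda>\<omega>. U \<omega> * V \<omega>) = expectation U * expectation V"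
proof -
  have *: "sigma_sets (space M) {f -` A \<inter> space M |A. A \<in> sets borel} \<subseteq> sets N"
    if f: "f \<in> borel_measurable N" and N: "subalgebra M N" for f :: "'a \<Rightarrow> real" and N
  proof -
    have sp: "space M = space N" using N by (simp add: subalgebra_def)
    show ?thesis unfolding sp
      by (rule sets.sigma_sets_subset) (use measurable_sets[OF f] in auto)
  qed
  have "indep_var borel U borel V"
    unfolding indep_var_eq
  proof (intro conjI)
    show "random_variable borel U" "random_variable borel V"
      using m sub by (auto intro: measurable_from_subalg)
    show "indep_set (sigma_sets (space M) {U -` A \<inter> space M |A. A \<in> sets borel})
        (sigma_sets (space M) {V -` A \<inter> space M |A. A \<in> sets borel})"
      using ind *[OF m(1) sub(1)] *[OF m(2) sub(2)] unfolding indep_sets2_eq by blast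
  qed
  then show "integrable M (\<lambda>\<omega>. U \<omega> * V \<omega>)" "expectation (\<lambda>\<omega>. U \<omega> * V \<omega>) = expectation U * expectation V"
    using int by (auto intro: indep_var_integrable indep_var_lebesgue_integral)
qed

lemma integral_double_sum:
  fixes f :: "'i \<Rightarrow> 'j \<Rightarrow> 'a \<Rightarrow> real"
  assumes "\<And>i j. i \<in> P \<Longrightarrow> j \<in> Q \<Longrightarrow> integrable M (f i j)"
  shows "(\<integral>\<omega>. (\<Sum>i\<in>P. \<Sum>j\<in>Q. f i j \<omega>) \<partial>M) = (\<Sum>i\<in>P. \<Sum>j\<in>Q. \<integral>\<omega>. f i j \<omega> \<partial>M)"
proof -
  have "(\<integral>\<omega>. (\<Sum>i\<in>P. \<Sum>j\<in>Q. f i j \<omega>) \<partial>M) = (\<Sum>i\<in>P. \<integral>\<omega>. (\<Sum>j\<in>Q. f i j \<omega>) \<partial>M)"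
    by (rule Bochner_Integration.integral_sum) (rule Bochner_Integration.integrable_sum, rule assms)
  also have "\<dots> = (\<Sum>i\<in>P. \<Sum>j\<in>Q. \<integral>\<omega>. f i j \<omega> \<partial>M)"
    by (rule sum.cong[OF refl]) (rule Bochner_Integration.integral_sum, rule assms)
  finally show ?thesis .
qed

section \<open>Local dependence with normalized variance\<close>

text \<open>
  The information in the subfamily with index set \<open>S\<close> enters only through a sigma-algebra \<open>F S\<close>.
  Therefore the setting is unaffected by rescaling the variables, and independence statements apply
  to every \<open>F S\<close>-measurable function without naming it as a function of the subfamily.
\<close>

locale locally_dependent = prob_space M for M :: "'a measure" +
  fixes I :: "'i set"
    and X :: "'i \<Rightarrow> 'a \<Rightarrow> real"
    and F :: "'i set \<Rightarrow> 'a measure"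
    and \<A> :: "'i \<Rightarrow> 'i set"
    and \<A>\<^sub>2 :: "'i \<Rightarrow> 'i \<Rightarrow> 'i set"
  assumes finite_I: "finite I"
    and F_subalgebra: "\<And>S. S \<subseteq> I \<Longrightarrow> subalgebra M (F S)"
    and F_mono: "\<And>S T. S \<subseteq> T \<Longrightarrow> T \<subseteq> I \<Longrightarrow> sets (F S) \<subseteq> sets (F T)"
    and X_F: "\<And>i. i \<in> I \<Longrightarrow> X i \<in> borel_measurable (F {i})"
    and A_sub: "\<And>i. i \<in> I \<Longrightarrow> \<A> i \<subseteq> I"
    and A2_sub: "\<And>i j. i \<in> I \<Longrightarrow> j \<in> \<A> i \<Longrightarrow> \<A>\<^sub>2 i j \<subseteq> I"
    and indep1: "\<And>i. i \<in> I \<Longrightarrow> indep_set (sets (F {i})) (sets (F (I - \<A> i)))"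
    and indep2: "\<And>i j. i \<in> I \<Longrightarrow> j \<in> \<A> i \<Longrightarrow> indep_set (sets (F {i, j})) (sets (F (I - \<A>\<^sub>2 i j)))"
    and X4_integrable: "\<And>i. i \<in> I \<Longrightarrow> integrable M (\<lambda>\<omega>. X i \<omega> ^ 4)"
    and X_centred: "\<And>i. i \<in> I \<Longrightarrow> expectation (X i) = 0"
    and unit_variance: "expectation (\<lambda>\<omega>. (\<Sum>i\<in>I. X i \<omega>)\<^sup>2) = 1"
begin

definition "x i = root 4 (expectation (\<lambda>\<omega>. X i \<omega> ^ 4))"

definition "N S = {k \<in> I. \<A> k \<inter> S \<noteq> {}}"

definition "D S = {(i, j). i \<in> I \<and> j \<in> \<A> i \<and> S \<inter> \<A>\<^sub>2 i j \<noteq> {}}"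

text \<open>
  The quantities \<open>d1\<close>, \<dots>, \<open>d7\<close> are \<open>\<delta>\<^sub>1, \<dots>, \<delta>\<^sub>7\<close> for \<open>\<sigma> = 1\<close>, with weights \<open>w\<close> in \<open>d2\<close> and \<open>d3\<close> that
  replace \<open>c\<close> times the indicator of \<open>B\<close>, and with \<open>c = 1\<close> elsewhere. In \<open>d6\<close>, the part \<open>d6a\<close> is a
  variance; the part \<open>d6bc\<close> arises in the same way as \<open>d7\<close>, from third order terms.
\<close>

definition "d1 S = (\<Sum>i\<in>N S. x i)"

definition "d2 w = (\<Sum>m\<in>I. w m * x m)"

definition "d3 w = (\<Sum>m\<in>I. \<Sum>k\<in>N {m}. w m * (x k * x m))"

definition "d4 S = (\<Sum>(i, j)\<in>D S. x i * x j)"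

definition "d5 = (\<Sum>i\<in>I. (card (\<A> i))\<^sup>2 * x i ^ 3) + (\<Sum>i\<in>I. \<Sum>j\<in>\<A> i. card (\<A> i) * x j ^ 3)"

definition "d6a = (\<Sum>i\<in>I. \<Sum>j\<in>\<A> i. \<Sum>k\<in>\<A>\<^sub>2 i j. \<Sum>l\<in>\<A> k \<union> N {k}. x i * x j * x k * x l)"

definition "d6bc = (\<Sum>i\<in>I. \<Sum>j\<in>\<A> i \<union> N {i}. (card (\<A> i))\<^sup>2 * x i ^ 3 * x j)
   + (\<Sum>i\<in>I. \<Sum>j\<in>\<A> i. \<Sum>k\<in>\<A> i \<union> N {j}. card (\<A> i) * x j ^ 3 * x k)"

definition "d6 = sqrt (d6a + d6bc)"

definition "d7sq = (\<Sum>i\<in>I. (card (\<A> i))\<^sup>2 * (\<Sum>j\<in>\<A> i \<union> N {i}. \<Sum>k\<in>N {j}. x i ^ 3 * x j * x k))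
   + (\<Sum>i\<in>I. \<Sum>j\<in>\<A> i. \<Sum>k\<in>\<A> i \<union> N {j}. \<Sum>l\<in>N {k}. card (\<A> i) * x j ^ 3 * x k * x l)
   + (\<Sum>i\<in>I. \<Sum>(j, k)\<in>D {i}. (card (\<A> i))\<^sup>2 * x i ^ 3 * x j * x k)
   + (\<Sum>i\<in>I. \<Sum>j\<in>\<A> i. \<Sum>(k, l)\<in>D {j}. card (\<A> i) * x j ^ 3 * x k * x l)"

definition "d7 = sqrt d7sq"

definition "rest S w = d1 S + d2 w + d3 w + d4 S + (d5 + d6 + d7)"

text \<open>
  The cube root \<open>\<theta>\<close> of \<open>\<xi>\<close> keeps all integrands polynomial: \<open>\<xi> = \<theta>\<^sup>3\<close> and \<open>\<xi>\<^sup>4\<^sup>/\<^sup>3 = \<theta>\<^sup>4\<close>. The bound on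
  the fourth moment normalizes \<open>\<xi>\<close> in \<open>L\<^sup>4\<^sup>/\<^sup>3\<close>; an inequality instead of an equality includes \<open>\<theta> = 0\<close>.
\<close>

definition weight :: "'i set \<Rightarrow> ('a \<Rightarrow> real) \<Rightarrow> bool" where
  "weight S \<theta> \<longleftrightarrow> S \<subseteq> I \<and> \<theta> \<in> borel_measurable (F S) \<and> (\<forall>\<omega>. 0 \<le> \<theta> \<omega>) \<and>
   integrable M (\<lambda>\<omega>. \<theta> \<omega> ^ 4) \<and> expectation (\<lambda>\<omega>. \<theta> \<omega> ^ 4) \<le> 1"

definition "W S \<omega> = (\<Sum>i\<in>I - N S. X i \<omega>)"

lemma F_measurable_M: "S \<subseteq> I \<Longrightarrow> f \<in> borel_measurable (F S) \<Longrightarrow> f \<in> borel_measurable M"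
  using F_subalgebra measurable_from_subalg by blast

lemma F_mono_measurable:
  assumes "S \<subseteq> T" "T \<subseteq> I" "f \<in> borel_measurable (F S)"
  shows "f \<in> borel_measurable (F T)"
proof -
  have "subalgebra (F T) (F S)"
    using F_mono[OF assms(1,2)] F_subalgebra[OF assms(2)] F_subalgebra[of S] assms(1,2)
    by (auto simp: subalgebra_def)
  then show ?thesis using assms(3) by (rule measurable_from_subalg)
qed

lemma X_F_mono: "i \<in> S \<Longrightarrow> S \<subseteq> I \<Longrightarrow> X i \<in> borel_measurable (F S)"
  by (rule F_mono_measurable[of "{i}"]) (auto intro: X_F)

lemma X_M [measurable]: "i \<in> I \<Longrightarrow> X i \<in> borel_measurable M"
  by (rule F_measurable_M[of "{i}"]) (auto intro: X_F)

lemma indep1_mult: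
  fixes U V :: "'a \<Rightarrow> real"
  assumes "i \<in> I" "S \<subseteq> I - \<A> i" "U \<in> borel_measurable (F {i})" "V \<in> borel_measurable (F S)"
    "integrable M U" "integrable M V"
  shows "integrable M (\<lambda>\<omega>. U \<omega> * V \<omega>)" "expectation (\<lambda>\<omega>. U \<omega> * V \<omega>) = expectation U * expectation V"
proof -
  have s: "subalgebra M (F {i})" "subalgebra M (F (I - \<A> i))" using assms(1) by (auto intro: F_subalgebra)
  have V: "V \<in> borel_measurable (F (I - \<A> i))" by (rule F_mono_measurable[OF assms(2) _ assms(4)]) auto
  show "integrable M (\<lambda>\<omega>. U \<omega> * V \<omega>)" "expectation (\<lambda>\<omega>. U \<omega> * V \<omega>) = expectation U * expectation V"
    using indep_set_mult[OF indep1[OF assms(1)] s assms(3) V assms(5,6)] by auto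
qed

lemma indep2_mult:
  fixes U V :: "'a \<Rightarrow> real"
  assumes "i \<in> I" "j \<in> \<A> i" "S \<subseteq> I - \<A>\<^sub>2 i j" "U \<in> borel_measurable (F {i, j})"
    "V \<in> borel_measurable (F S)" "integrable M U" "integrable M V"
  shows "integrable M (\<lambda>\<omega>. U \<omega> * V \<omega>)" "expectation (\<lambda>\<omega>. U \<omega> * V \<omega>) = expectation U * expectation V"
proof -
  have s: "subalgebra M (F {i, j})" "subalgebra M (F (I - \<A>\<^sub>2 i j))"
    using assms(1,2) A_sub by (auto intro!: F_subalgebra)
  have V: "V \<in> borel_measurable (F (I - \<A>\<^sub>2 i j))" by (rule F_mono_measurable[OF assms(3) _ assms(5)]) auto
  show "integrable M (\<lambda>\<omega>. U \<omega> * V \<omega>)" "expectation (\<lambda>\<omega>. U \<omega> * V \<omega>) = expectation U * expectation V"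
    using indep_set_mult[OF indep2[OF assms(1,2)] s assms(4) V assms(6,7)] by auto
qed

lemma x_nonneg [simp]: "0 \<le> x i"
  by (simp add: x_def)

lemma x_power4: "x i ^ 4 = expectation (\<lambda>\<omega>. X i \<omega> ^ 4)"
  by (simp add: x_def)

lemma N_sub: "N S \<subseteq> I" by (auto simp: N_def)

lemma finite_A: "i \<in> I \<Longrightarrow> finite (\<A> i)" using A_sub finite_I finite_subset by metis

lemma finite_N: "finite (N S)" using N_sub finite_I finite_subset by metis

lemma finite_D: "finite (D S)"
proof (rule finite_subset)
  show "D S \<subseteq> Sigma I \<A>" by (auto simp: D_def)
qed (use finite_I finite_A in auto)

lemma X_square:
  assumes i: "i \<in> I"
  shows "integrable M (\<lambda>\<omega>. (X i \<omega>)\<^sup>2)" "expectation (\<lambda>\<omega>. (X i \<omega>)\<^sup>2) \<le> (x i)\<^sup>2"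
proof -
  have "integrable M (\<lambda>\<omega>. 1 * \<bar>(X i \<omega>)\<^sup>2\<bar> * \<bar>1\<bar>)" "(\<integral>\<omega>. 1 * \<bar>(X i \<omega>)\<^sup>2\<bar> * \<bar>1\<bar> \<partial>M) \<le> (x i)\<^sup>2 * 1"
    using i X4_integrable[OF i]
    by (intro weighted_Cauchy_Schwarz[where u = "(x i)\<^sup>2" and v = 1 and g = "\<lambda>_. 1"];
      simp add: x_power4 prob_space flip: power_mult)+
  then show "integrable M (\<lambda>\<omega>. (X i \<omega>)\<^sup>2)" "expectation (\<lambda>\<omega>. (X i \<omega>)\<^sup>2) \<le> (x i)\<^sup>2"
    by simp_all
qed

lemma X_integrable: "i \<in> I \<Longrightarrow> integrable M (X i)"
  by (rule square_integrable_imp_integrable) (auto intro: X_square)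

lemma XX_square:
  assumes i: "i \<in> I" and j: "j \<in> I"
  shows "integrable M (\<lambda>\<omega>. (X i \<omega> * X j \<omega>)\<^sup>2)" "expectation (\<lambda>\<omega>. (X i \<omega> * X j \<omega>)\<^sup>2) \<le> (x i * x j)\<^sup>2"
proof -
  have "integrable M (\<lambda>\<omega>. 1 * \<bar>(X i \<omega>)\<^sup>2\<bar> * \<bar>(X j \<omega>)\<^sup>2\<bar>)" "(\<integral>\<omega>. 1 * \<bar>(X i \<omega>)\<^sup>2\<bar> * \<bar>(X j \<omega>)\<^sup>2\<bar> \<partial>M) \<le> (x i)\<^sup>2 * (x j)\<^sup>2"
    using i j X4_integrable[OF i] X4_integrable[OF j]
    by (intro weighted_Cauchy_Schwarz[where u = "(x i)\<^sup>2" and v = "(x j)\<^sup>2" and g = "\<lambda>_. 1"];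
      simp add: x_power4 flip: power_mult)+
  then show "integrable M (\<lambda>\<omega>. (X i \<omega> * X j \<omega>)\<^sup>2)" "expectation (\<lambda>\<omega>. (X i \<omega> * X j \<omega>)\<^sup>2) \<le> (x i * x j)\<^sup>2"
    by (simp_all add: power_mult_distrib)
qed

lemma XX_abs:
  assumes i: "i \<in> I" and j: "j \<in> I"
  shows "integrable M (\<lambda>\<omega>. \<bar>X i \<omega>\<bar> * \<bar>X j \<omega>\<bar>)" "expectation (\<lambda>\<omega>. \<bar>X i \<omega>\<bar> * \<bar>X j \<omega>\<bar>) \<le> x i * x j"
    "integrable M (\<lambda>\<omega>. X i \<omega> * X j \<omega>)" "\<bar>expectation (\<lambda>\<omega>. X i \<omega> * X j \<omega>)\<bar> \<le> x i * x j"
proof -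
  have "integrable M (\<lambda>\<omega>. 1 * \<bar>X i \<omega>\<bar> * \<bar>X j \<omega>\<bar>)" "(\<integral>\<omega>. 1 * \<bar>X i \<omega>\<bar> * \<bar>X j \<omega>\<bar> \<partial>M) \<le> x i * x j"
    using i j X_square[OF i] X_square[OF j]
    by (intro weighted_Cauchy_Schwarz[where u = "x i" and v = "x j" and g = "\<lambda>_. 1"]; simp)+
  then show *: "integrable M (\<lambda>\<omega>. \<bar>X i \<omega>\<bar> * \<bar>X j \<omega>\<bar>)" "expectation (\<lambda>\<omega>. \<bar>X i \<omega>\<bar> * \<bar>X j \<omega>\<bar>) \<le> x i * x j"
    by simp_all
  show "integrable M (\<lambda>\<omega>. X i \<omega> * X j \<omega>)"
    by (rule Bochner_Integration.integrable_bound[OF *(1)]) (use i j in \<open>auto simp: abs_mult\<close>)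
  show "\<bar>expectation (\<lambda>\<omega>. X i \<omega> * X j \<omega>)\<bar> \<le> x i * x j"
    using integral_abs_bound[of M "\<lambda>\<omega>. X i \<omega> * X j \<omega>"] *(2) by (simp add: abs_mult)
qed

lemma weightD:
  assumes "weight S \<theta>"
  shows "S \<subseteq> I" "\<theta> \<in> borel_measurable (F S)" "\<And>\<omega>. 0 \<le> \<theta> \<omega>" "integrable M (\<lambda>\<omega>. \<theta> \<omega> ^ 4)"
    "expectation (\<lambda>\<omega>. \<theta> \<omega> ^ 4) \<le> 1" "\<theta> \<in> borel_measurable M" "0 \<le> expectation (\<lambda>\<omega>. \<theta> \<omega> ^ 4)"
proof -
  show "S \<subseteq> I" "\<theta> \<in> borel_measurable (F S)" "\<And>\<omega>. 0 \<le> \<theta> \<omega>" "integrable M (\<lambda>\<omega>. \<theta> \<omega> ^ 4)"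
    "expectation (\<lambda>\<omega>. \<theta> \<omega> ^ 4) \<le> 1" "\<theta> \<in> borel_measurable M"
    using assms F_measurable_M by (auto simp: weight_def)
  show "0 \<le> expectation (\<lambda>\<omega>. \<theta> \<omega> ^ 4)" by (rule integral_nonneg_AE) (rule AE_I2, simp)
qed

lemma away_sub: "i \<in> I - N S \<Longrightarrow> S \<subseteq> I \<Longrightarrow> S \<subseteq> I - \<A> i"
  by (auto simp: N_def)

text \<open>
  An index \<open>i\<close> outside \<open>N S\<close> satisfies \<open>S \<subseteq> I - \<A> i\<close>, so that \<open>X i\<close> and \<open>\<theta>\<close> are independent: the moments
  of \<open>X i\<close> relative to the density \<open>\<theta>\<^sup>4\<close> are those of \<open>X i\<close> itself, up to the factor \<open>E \<theta>\<^sup>4 \<le> 1\<close>.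
\<close>

lemma weight_X:
  assumes w: "weight S \<theta>" and i: "i \<in> I - N S"
  shows "integrable M (\<lambda>\<omega>. \<theta> \<omega> ^ 4 * (X i \<omega>)\<^sup>2)" "expectation (\<lambda>\<omega>. \<theta> \<omega> ^ 4 * (X i \<omega>)\<^sup>2) \<le> (x i)\<^sup>2"
    "integrable M (\<lambda>\<omega>. \<theta> \<omega> ^ 4 * X i \<omega> ^ 4)" "expectation (\<lambda>\<omega>. \<theta> \<omega> ^ 4 * X i \<omega> ^ 4) \<le> x i ^ 4"
proof -
  note wD = weightD[OF w]
  have iI: "i \<in> I" using i by simp
  have [measurable]: "X i \<in> borel_measurable (F {i})" "\<theta> \<in> borel_measurable (F S)"
    using X_F iI wD(2) by auto
  have 1: "integrable M (\<lambda>\<omega>. (X i \<omega>)\<^sup>2 * \<theta> \<omega> ^ 4)"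
      "expectation (\<lambda>\<omega>. (X i \<omega>)\<^sup>2 * \<theta> \<omega> ^ 4) = expectation (\<lambda>\<omega>. (X i \<omega>)\<^sup>2) * expectation (\<lambda>\<omega>. \<theta> \<omega> ^ 4)"
    by (rule indep1_mult[OF iI away_sub[OF i wD(1)]]; use X_square[OF iI] wD in simp)+
  have 2: "integrable M (\<lambda>\<omega>. X i \<omega> ^ 4 * \<theta> \<omega> ^ 4)"
      "expectation (\<lambda>\<omega>. X i \<omega> ^ 4 * \<theta> \<omega> ^ 4) = expectation (\<lambda>\<omega>. X i \<omega> ^ 4) * expectation (\<lambda>\<omega>. \<theta> \<omega> ^ 4)"
    by (rule indep1_mult[OF iI away_sub[OF i wD(1)]]; use X4_integrable[OF iI] wD in simp)+
  show "integrable M (\<lambda>\<omega>. \<theta> \<omega> ^ 4 * (X i \<omega>)\<^sup>2)" "integrable M (\<lambda>\<omega>. \<theta> \<omega> ^ 4 * X i \<omega> ^ 4)"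
    using 1(1) 2(1) by (simp_all add: mult.commute)
  have "expectation (\<lambda>\<omega>. (X i \<omega>)\<^sup>2) * expectation (\<lambda>\<omega>. \<theta> \<omega> ^ 4) \<le> (x i)\<^sup>2 * 1"
    by (rule mult_mono) (use X_square[OF iI] wD in auto)
  then show "expectation (\<lambda>\<omega>. \<theta> \<omega> ^ 4 * (X i \<omega>)\<^sup>2) \<le> (x i)\<^sup>2"
    using 1(2) by (simp add: mult.commute)
  have "expectation (\<lambda>\<omega>. X i \<omega> ^ 4) * expectation (\<lambda>\<omega>. \<theta> \<omega> ^ 4) \<le> x i ^ 4 * 1"
    by (rule mult_mono) (use x_power4[of i] wD in auto)
  then show "expectation (\<lambda>\<omega>. \<theta> \<omega> ^ 4 * X i \<omega> ^ 4) \<le> x i ^ 4"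
    using 2(2) by (simp add: mult.commute)
qed

text \<open>
  The pair need not be independent of \<open>\<theta>\<close>. Independence of \<open>\<theta>\<close> from each variable separately is
  enough for Cauchy--Schwarz under the density \<open>\<theta>\<^sup>4\<close>.
\<close>

lemma weight_XX:
  assumes w: "weight S \<theta>" and i: "i \<in> I - N S" and j: "j \<in> I - N S"
  shows "integrable M (\<lambda>\<omega>. \<theta> \<omega> ^ 4 * (X i \<omega> * X j \<omega>))"
    "\<bar>expectation (\<lambda>\<omega>. \<theta> \<omega> ^ 4 * (X i \<omega> * X j \<omega>))\<bar> \<le> x i * x j"
proof -
  note wD = weightD[OF w]
  note [measurable] = wD(6)
  have *: "integrable M (\<lambda>\<omega>. \<theta> \<omega> ^ 4 * \<bar>X i \<omega>\<bar> * \<bar>X j \<omega>\<bar>)" "(\<integral>\<omega>. \<theta> \<omega> ^ 4 * \<bar>X i \<omega>\<bar> * \<bar>X j \<omega>\<bar> \<partial>M) \<le> x i * x j"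
    using i j weight_X[OF w i] weight_X[OF w j]
    by (intro weighted_Cauchy_Schwarz[where u = "x i" and v = "x j" and g = "\<lambda>\<omega>. \<theta> \<omega> ^ 4"]; simp)+
  show "integrable M (\<lambda>\<omega>. \<theta> \<omega> ^ 4 * (X i \<omega> * X j \<omega>))"
    by (rule Bochner_Integration.integrable_bound[OF *(1)]) (use i j in \<open>auto simp: abs_mult\<close>)
  show "\<bar>expectation (\<lambda>\<omega>. \<theta> \<omega> ^ 4 * (X i \<omega> * X j \<omega>))\<bar> \<le> x i * x j"
    using integral_abs_bound[of M "\<lambda>\<omega>. \<theta> \<omega> ^ 4 * (X i \<omega> * X j \<omega>)"] *(2) by (simp add: abs_mult mult.assoc)
qed

lemma X_pair_F: "i \<in> I \<Longrightarrow> j \<in> I \<Longrightarrow> (\<lambda>\<omega>. X i \<omega> * X j \<omega>) \<in> borel_measurable (F {i, j})"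
  by (intro borel_measurable_times X_F_mono) auto

text \<open>
  For \<open>j \<notin> \<A> i\<close> both sides vanish, since \<open>X i\<close> is centred and independent of \<open>\<theta>\<close> and \<open>X j\<close> together.
  For \<open>j \<in> \<A> i\<close> and \<open>(i, j) \<notin> D S\<close> the pair is independent of \<open>\<theta>\<close>.
\<close>

lemma weight_XX_uncorrelated:
  assumes w: "weight S \<theta>" and i: "i \<in> I - N S" and j: "j \<in> I - N S" and "j \<notin> \<A> i \<or> (i, j) \<notin> D S"
  shows "expectation (\<lambda>\<omega>. \<theta> \<omega> ^ 4 * (X i \<omega> * X j \<omega>)) =
    expectation (\<lambda>\<omega>. \<theta> \<omega> ^ 4) * expectation (\<lambda>\<omega>. X i \<omega> * X j \<omega>)"
proof (cases "j \<in> \<A> i")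
  case False
  note wD = weightD[OF w]
  have iI: "i \<in> I" and jI: "j \<in> I" using i j by auto
  have 0: "expectation (\<lambda>\<omega>. X i \<omega> * X j \<omega>) = 0"
    using indep1_mult(2)[OF iI, of "{j}" "X i" "X j"] False i j X_F X_integrable X_centred by auto
  have [measurable]: "\<theta> \<in> borel_measurable (F (I - \<A> i))" "X j \<in> borel_measurable (F (I - \<A> i))"
    using F_mono_measurable[OF away_sub[OF i wD(1)] _ wD(2)] X_F_mono[of j "I - \<A> i"] False jI by auto
  have j2: "integrable M (\<lambda>\<omega>. \<theta> \<omega> ^ 4 * X j \<omega>)"
  proof -
    note [measurable] = wD(6)
    have "integrable M (\<lambda>\<omega>. \<theta> \<omega> ^ 4 * \<bar>1\<bar> * \<bar>X j \<omega>\<bar>)"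
      using j weight_X[OF w j] wD
      by (intro weighted_Cauchy_Schwarz[where u = "1" and v = "x j" and g = "\<lambda>\<omega>. \<theta> \<omega> ^ 4"]; simp)
    then show ?thesis
      by (rule Bochner_Integration.integrable_bound) (use i j in \<open>auto simp: abs_mult\<close>)
  qed
  have "expectation (\<lambda>\<omega>. X i \<omega> * (\<theta> \<omega> ^ 4 * X j \<omega>)) = expectation (X i) * expectation (\<lambda>\<omega>. \<theta> \<omega> ^ 4 * X j \<omega>)"
    by (rule indep1_mult(2)[OF iI order_refl X_F[OF iI] _ X_integrable[OF iI] j2]) measurable
  with 0 X_centred[OF iI] show ?thesis by (simp add: mult_ac)
next
  case True
  note wD = weightD[OF w]
  have iI: "i \<in> I" and jI: "j \<in> I" using i j by auto
  have S: "S \<subseteq> I - \<A>\<^sub>2 i j" using assms(4) True wD(1) iI by (auto simp: D_def)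
  have "expectation (\<lambda>\<omega>. (X i \<omega> * X j \<omega>) * \<theta> \<omega> ^ 4) = expectation (\<lambda>\<omega>. X i \<omega> * X j \<omega>) * expectation (\<lambda>\<omega>. \<theta> \<omega> ^ 4)"
    by (rule indep2_mult[OF iI True S X_pair_F[OF iI jI] _ XX_abs(3)[OF iI jI] wD(4)])
      (use wD(2) in measurable)
  then show ?thesis by (simp add: mult.commute)
qed

lemma W_M [measurable]: "W S \<in> borel_measurable M"
  unfolding W_def by (intro borel_measurable_sum X_M) auto

lemma d1_d4_d6a_nonneg: "0 \<le> d1 S" "0 \<le> d4 S" "0 \<le> d6a"
  by (auto simp: d1_def d4_def d6a_def intro!: sum_nonneg)

lemma W_square:
  shows "integrable M (\<lambda>\<omega>. (W S \<omega>)\<^sup>2)"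
   "expectation (\<lambda>\<omega>. (W S \<omega>)\<^sup>2) = (\<Sum>i\<in>I - N S. \<Sum>j\<in>I - N S. expectation (\<lambda>\<omega>. X i \<omega> * X j \<omega>))"
proof -
  show "integrable M (\<lambda>\<omega>. (W S \<omega>)\<^sup>2)"
    unfolding W_def power2_eq_square sum_product by (intro Bochner_Integration.integrable_sum XX_abs) auto
  show "expectation (\<lambda>\<omega>. (W S \<omega>)\<^sup>2) = (\<Sum>i\<in>I - N S. \<Sum>j\<in>I - N S. expectation (\<lambda>\<omega>. X i \<omega> * X j \<omega>))"
    unfolding W_def power2_eq_square sum_product
    by (rule integral_double_sum) (simp add: XX_abs)
qed

text \<open>
  Expanding the square, the density \<open>\<theta>\<^sup>4\<close> changes the covariances only for the pairs in \<open>D S\<close>, by at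
  most \<open>2 x i x j\<close> each.
\<close>

lemma weight_W_square:
  assumes w: "weight S \<theta>"
  shows "integrable M (\<lambda>\<omega>. \<theta> \<omega> ^ 4 * (W S \<omega>)\<^sup>2)"
    "expectation (\<lambda>\<omega>. \<theta> \<omega> ^ 4 * (W S \<omega>)\<^sup>2) \<le> expectation (\<lambda>\<omega>. (W S \<omega>)\<^sup>2) + 2 * d4 S"
proof -
  note wD = weightD[OF w]
  let ?T = "I - N S" and ?e = "expectation (\<lambda>\<omega>. \<theta> \<omega> ^ 4)"
  have fin: "finite ?T" using finite_I by simp
  have eq: "\<theta> \<omega> ^ 4 * (W S \<omega>)\<^sup>2 = (\<Sum>i\<in>?T. \<Sum>j\<in>?T. \<theta> \<omega> ^ 4 * (X i \<omega> * X j \<omega>))" for \<omega>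
    unfolding W_def power2_eq_square sum_product by (simp only: sum_distrib_left)
  show "integrable M (\<lambda>\<omega>. \<theta> \<omega> ^ 4 * (W S \<omega>)\<^sup>2)"
    unfolding eq by (intro Bochner_Integration.integrable_sum weight_XX(1)[OF w])
  have "expectation (\<lambda>\<omega>. \<theta> \<omega> ^ 4 * (W S \<omega>)\<^sup>2) = (\<Sum>i\<in>?T. \<Sum>j\<in>?T. expectation (\<lambda>\<omega>. \<theta> \<omega> ^ 4 * (X i \<omega> * X j \<omega>)))"
    unfolding eq by (rule integral_double_sum) (rule weight_XX(1)[OF w])
  also have "\<dots> \<le> (\<Sum>i\<in>?T. \<Sum>j\<in>?T. ?e * expectation (\<lambda>\<omega>. X i \<omega> * X j \<omega>)
      + (if (i, j) \<in> D S then 2 * (x i * x j) else 0))"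
  proof (intro sum_mono)
    fix i j assume i: "i \<in> ?T" and j: "j \<in> ?T"
    show "expectation (\<lambda>\<omega>. \<theta> \<omega> ^ 4 * (X i \<omega> * X j \<omega>)) \<le> ?e * expectation (\<lambda>\<omega>. X i \<omega> * X j \<omega>)
      + (if (i, j) \<in> D S then 2 * (x i * x j) else 0)"
    proof (cases "(i, j) \<in> D S")
      case True
      have "\<bar>?e * expectation (\<lambda>\<omega>. X i \<omega> * X j \<omega>)\<bar> \<le> 1 * (x i * x j)"
        unfolding abs_mult by (rule mult_mono) (use wD XX_abs(4)[of i j] i j in auto)
      with weight_XX(2)[OF w i j] True show ?thesis by auto
    next
      case False
      with weight_XX_uncorrelated[OF w i j] show ?thesis by simp
    qed
  qed
  also have "\<dots> = ?e * (\<Sum>i\<in>?T. \<Sum>j\<in>?T. expectation (\<lambda>\<omega>. X i \<omega> * X j \<omega>))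
     + (\<Sum>(i, j)\<in>(?T \<times> ?T) \<inter> D S. 2 * (x i * x j))"
    using fin by (simp add: sum.distrib sum_distrib_left sum.cartesian_product sum.inter_restrict split_beta)
  also have "\<dots> \<le> 1 * expectation (\<lambda>\<omega>. (W S \<omega>)\<^sup>2) + 2 * d4 S"
  proof (rule add_mono)
    show "?e * (\<Sum>i\<in>?T. \<Sum>j\<in>?T. expectation (\<lambda>\<omega>. X i \<omega> * X j \<omega>)) \<le> 1 * expectation (\<lambda>\<omega>. (W S \<omega>)\<^sup>2)"
      unfolding W_square(2)[symmetric] by (rule mult_right_mono) (use wD in auto)
    show "(\<Sum>(i, j)\<in>(?T \<times> ?T) \<inter> D S. 2 * (x i * x j)) \<le> 2 * d4 S"
    proof -
      have "(\<Sum>(i, j)\<in>(?T \<times> ?T) \<inter> D S. 2 * (x i * x j)) \<le> (\<Sum>(i, j)\<in>D S. 2 * (x i * x j))"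
        by (rule sum_mono2[OF finite_D]) auto
      then show ?thesis by (simp add: d4_def sum_distrib_left split_beta)
    qed
  qed
  finally show "expectation (\<lambda>\<omega>. \<theta> \<omega> ^ 4 * (W S \<omega>)\<^sup>2) \<le> expectation (\<lambda>\<omega>. (W S \<omega>)\<^sup>2) + 2 * d4 S" by simp
qed

text \<open>
  \<open>W S\<close> is the full sum, of variance one, minus the sum over \<open>N S\<close>, whose \<open>L\<^sup>2\<close>-norm is at most \<open>d1 S\<close>.
\<close>

lemma W_variance:
  shows "1 - 2 * d1 S \<le> expectation (\<lambda>\<omega>. (W S \<omega>)\<^sup>2)"
    "expectation (\<lambda>\<omega>. (W S \<omega>)\<^sup>2) \<le> (1 + d1 S)\<^sup>2"
proof -
  define V where "V \<omega> = (\<Sum>i\<in>N S. X i \<omega>)" for \<omega>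
  define Z where "Z \<omega> = (\<Sum>i\<in>I. X i \<omega>)" for \<omega>
  have [measurable]: "V \<in> borel_measurable M" "Z \<in> borel_measurable M"
    using N_sub unfolding V_def[abs_def] Z_def[abs_def] by (auto intro!: borel_measurable_sum X_M)
  have NI: "i \<in> I" if "i \<in> N S" for i using N_sub that by auto
  have WZ: "W S \<omega> = Z \<omega> - V \<omega>" for \<omega>
    unfolding W_def Z_def V_def using sum_diff[OF finite_I N_sub] by blast
  have iV: "integrable M (\<lambda>\<omega>. (V \<omega>)\<^sup>2)" and iZ: "integrable M (\<lambda>\<omega>. (Z \<omega>)\<^sup>2)"
    using NI by (auto simp: V_def Z_def power2_eq_square sum_product XX_abs intro!: Bochner_Integration.integrable_sum)
  have "expectation (\<lambda>\<omega>. (V \<omega>)\<^sup>2) = (\<Sum>i\<in>N S. \<Sum>j\<in>N S. expectation (\<lambda>\<omega>. X i \<omega> * X j \<omega>))"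
    unfolding V_def power2_eq_square sum_product using NI
    by (intro integral_double_sum) (simp add: XX_abs)
  also have "\<dots> \<le> (\<Sum>i\<in>N S. \<Sum>j\<in>N S. x i * x j)"
    by (intro sum_mono) (rule order_trans[OF abs_ge_self XX_abs(4)], auto intro: NI)
  also have "\<dots> = (d1 S)\<^sup>2" by (simp add: d1_def power2_eq_square sum_product)
  finally have V2: "expectation (\<lambda>\<omega>. (V \<omega>)\<^sup>2) \<le> (d1 S)\<^sup>2" .
  have Z2: "expectation (\<lambda>\<omega>. (Z \<omega>)\<^sup>2) = 1" using unit_variance by (simp add: Z_def)
  have "integrable M (\<lambda>\<omega>. 1 * \<bar>Z \<omega>\<bar> * \<bar>V \<omega>\<bar>)" "(\<integral>\<omega>. 1 * \<bar>Z \<omega>\<bar> * \<bar>V \<omega>\<bar> \<partial>M) \<le> 1 * d1 S"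
    using iV iZ V2 Z2 d1_d4_d6a_nonneg
    by (intro weighted_Cauchy_Schwarz[where u = 1 and v = "d1 S" and g = "\<lambda>_. 1"]; simp)+
  then have ZV: "integrable M (\<lambda>\<omega>. \<bar>Z \<omega> * V \<omega>\<bar>)" "expectation (\<lambda>\<omega>. \<bar>Z \<omega> * V \<omega>\<bar>) \<le> d1 S"
    by (simp_all add: abs_mult)
  then have iZV: "integrable M (\<lambda>\<omega>. Z \<omega> * V \<omega>)"
    by (subst (asm) integrable_abs_iff) auto
  have e: "expectation (\<lambda>\<omega>. (W S \<omega>)\<^sup>2) = 1 - 2 * expectation (\<lambda>\<omega>. Z \<omega> * V \<omega>) + expectation (\<lambda>\<omega>. (V \<omega>)\<^sup>2)"
  proof -
    have "expectation (\<lambda>\<omega>. (W S \<omega>)\<^sup>2) = expectation (\<lambda>\<omega>. (Z \<omega>)\<^sup>2 - 2 * (Z \<omega> * V \<omega>) + (V \<omega>)\<^sup>2)"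
      by (simp add: WZ power2_diff algebra_simps)
    then show ?thesis using iZ iV iZV Z2 by simp
  qed
  have "\<bar>expectation (\<lambda>\<omega>. Z \<omega> * V \<omega>)\<bar> \<le> d1 S"
    using integral_abs_bound[of M "\<lambda>\<omega>. Z \<omega> * V \<omega>"] ZV(2) by linarith
  moreover have "0 \<le> expectation (\<lambda>\<omega>. (V \<omega>)\<^sup>2)" by (rule integral_nonneg_AE) auto
  moreover have "(1 + d1 S)\<^sup>2 = 1 + 2 * d1 S + (d1 S)\<^sup>2" by (simp add: power2_sum)
  ultimately show "1 - 2 * d1 S \<le> expectation (\<lambda>\<omega>. (W S \<omega>)\<^sup>2)"
    "expectation (\<lambda>\<omega>. (W S \<omega>)\<^sup>2) \<le> (1 + d1 S)\<^sup>2"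
    using e V2 by linarith+
qed

section \<open>Fluctuation of the products of neighbours\<close>

lemma weight_Hoelder:
  assumes w: "weight S \<theta>" and [measurable]: "Z \<in> borel_measurable M"
    and Z: "integrable M (\<lambda>\<omega>. \<theta> \<omega> ^ 4 * (Z \<omega>)\<^sup>2)" "expectation (\<lambda>\<omega>. \<theta> \<omega> ^ 4 * (Z \<omega>)\<^sup>2) \<le> z\<^sup>2" "0 \<le> z"
  shows "integrable M (\<lambda>\<omega>. \<theta> \<omega> ^ 3 * \<bar>Z \<omega>\<bar>)" "expectation (\<lambda>\<omega>. \<theta> \<omega> ^ 3 * \<bar>Z \<omega>\<bar>) \<le> z"
    "m \<in> I \<Longrightarrow> integrable M (\<lambda>\<omega>. \<theta> \<omega> ^ 3 * \<bar>Z \<omega>\<bar> * \<bar>X m \<omega>\<bar>)"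
    "m \<in> I \<Longrightarrow> expectation (\<lambda>\<omega>. \<theta> \<omega> ^ 3 * \<bar>Z \<omega>\<bar> * \<bar>X m \<omega>\<bar>) \<le> z * x m"
proof -
  note wD = weightD[OF w]
  show "integrable M (\<lambda>\<omega>. \<theta> \<omega> ^ 3 * \<bar>Z \<omega>\<bar>)" "expectation (\<lambda>\<omega>. \<theta> \<omega> ^ 3 * \<bar>Z \<omega>\<bar>) \<le> z"
    using Hoelder_cubed[OF wD(6) assms(2), of "\<lambda>_. 1" z 1] wD Z by (simp_all add: prob_space)
  show "integrable M (\<lambda>\<omega>. \<theta> \<omega> ^ 3 * \<bar>Z \<omega>\<bar> * \<bar>X m \<omega>\<bar>)"
    "expectation (\<lambda>\<omega>. \<theta> \<omega> ^ 3 * \<bar>Z \<omega>\<bar> * \<bar>X m \<omega>\<bar>) \<le> z * x m" if "m \<in> I"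
    using Hoelder_cubed[OF wD(6) assms(2) X_M[OF that], of z "x m"] wD Z X4_integrable[OF that]
    by (simp_all add: x_power4)
qed

lemma weight_cube:
  assumes w: "weight S \<theta>"
  shows "integrable M (\<lambda>\<omega>. \<theta> \<omega> ^ 3)" "expectation (\<lambda>\<omega>. \<theta> \<omega> ^ 3) \<le> 1"
    "m \<in> I \<Longrightarrow> integrable M (\<lambda>\<omega>. \<theta> \<omega> ^ 3 * \<bar>X m \<omega>\<bar>)"
  using weight_Hoelder[OF w, where Z = "\<lambda>_. 1" and z = 1] weightD[OF w] by simp_all

lemma weight_cube_X:
  assumes w: "weight S \<theta>" and i: "i \<in> I - N S"
  shows "m \<in> I \<Longrightarrow> integrable M (\<lambda>\<omega>. \<theta> \<omega> ^ 3 * \<bar>X i \<omega>\<bar> * \<bar>X m \<omega>\<bar>)"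
    "m \<in> I \<Longrightarrow> expectation (\<lambda>\<omega>. \<theta> \<omega> ^ 3 * \<bar>X i \<omega>\<bar> * \<bar>X m \<omega>\<bar>) \<le> x i * x m"
  using weight_Hoelder(3,4)[OF w X_M weight_X(1,2)[OF w i]] i by auto

text \<open>
  Products are centred by their mean under the original measure, not under the density \<open>\<theta>\<^sup>4\<close>. Hence
  the mean of the sum over neighbours is a constant that does not depend on \<open>\<theta>\<close>.
\<close>

definition "centred_product = (\<lambda>(i, j) \<omega>. X i \<omega> * X j \<omega> - expectation (\<lambda>\<omega>. X i \<omega> * X j \<omega>))"

lemma centred_product_F: "i \<in> I \<Longrightarrow> j \<in> I \<Longrightarrow> {i, j} \<subseteq> S \<Longrightarrow> S \<subseteq> I \<Longrightarrow> centred_product (i, j) \<in> borel_measurable (F S)"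
  unfolding centred_product_def by (auto intro!: borel_measurable_diff borel_measurable_times X_F_mono)

lemma centred_product_M: "i \<in> I \<Longrightarrow> j \<in> I \<Longrightarrow> centred_product (i, j) \<in> borel_measurable M"
  unfolding centred_product_def by simp

lemma centred_product_square:
  assumes i: "i \<in> I" and j: "j \<in> I"
  shows "integrable M (centred_product (i, j))" "expectation (centred_product (i, j)) = 0"
    "integrable M (\<lambda>\<omega>. (centred_product (i, j) \<omega>)\<^sup>2)" "expectation (\<lambda>\<omega>. (centred_product (i, j) \<omega>)\<^sup>2) \<le> (x i * x j)\<^sup>2"
proof -
  let ?m = "expectation (\<lambda>\<omega>. X i \<omega> * X j \<omega>)"
  note XX = XX_abs(3)[OF i j] XX_square[OF i j]
  show "integrable M (centred_product (i, j))" "expectation (centred_product (i, j)) = 0"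
    using XX by (simp_all add: centred_product_def prob_space)
  have e: "(centred_product (i, j) \<omega>)\<^sup>2 = (X i \<omega> * X j \<omega>)\<^sup>2 - 2 * ?m * (X i \<omega> * X j \<omega>) + ?m\<^sup>2" for \<omega>
    by (simp add: centred_product_def power2_diff mult_ac)
  show "integrable M (\<lambda>\<omega>. (centred_product (i, j) \<omega>)\<^sup>2)" unfolding e using XX by simp
  have "expectation (\<lambda>\<omega>. (centred_product (i, j) \<omega>)\<^sup>2) = expectation (\<lambda>\<omega>. (X i \<omega> * X j \<omega>)\<^sup>2) - 2 * ?m * ?m + ?m\<^sup>2"
    unfolding e using XX by (simp add: prob_space)
  also have "\<dots> \<le> expectation (\<lambda>\<omega>. (X i \<omega> * X j \<omega>)\<^sup>2)" by (simp add: power2_eq_square)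
  also have "\<dots> \<le> (x i * x j)\<^sup>2" by (rule XX(3))
  finally show "expectation (\<lambda>\<omega>. (centred_product (i, j) \<omega>)\<^sup>2) \<le> (x i * x j)\<^sup>2" .
qed

definition "pairs S = Sigma (I - N S) (\<lambda>i. \<A> i \<inter> (I - N S))"

lemma finite_pairs: "finite (pairs S)"
  unfolding pairs_def using finite_I by auto

lemma weight_centred_product_square:
  assumes w: "weight S \<theta>" and p: "(i, j) \<in> pairs S - D S"
  shows "integrable M (\<lambda>\<omega>. \<theta> \<omega> ^ 4 * (centred_product (i, j) \<omega>)\<^sup>2)"
    "expectation (\<lambda>\<omega>. \<theta> \<omega> ^ 4 * (centred_product (i, j) \<omega>)\<^sup>2) \<le> (x i * x j)\<^sup>2"
proof -
  note wD = weightD[OF w]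
  have i: "i \<in> I" and j: "j \<in> I" "j \<in> \<A> i" and S: "S \<subseteq> I - \<A>\<^sub>2 i j"
    using p wD(1) by (auto simp: pairs_def D_def)
  have [measurable]: "centred_product (i, j) \<in> borel_measurable (F {i, j})" using centred_product_F i j by auto
  have m: "(\<lambda>\<omega>. \<theta> \<omega> ^ 4) \<in> borel_measurable (F S)" using wD(2) by measurable
  have *: "integrable M (\<lambda>\<omega>. (centred_product (i, j) \<omega>)\<^sup>2 * \<theta> \<omega> ^ 4)"
    "expectation (\<lambda>\<omega>. (centred_product (i, j) \<omega>)\<^sup>2 * \<theta> \<omega> ^ 4) = expectation (\<lambda>\<omega>. (centred_product (i, j) \<omega>)\<^sup>2) * expectation (\<lambda>\<omega>. \<theta> \<omega> ^ 4)"
    by (rule indep2_mult[OF i j(2) S _ m centred_product_square(3)[OF i j(1)] wD(4)], measurable)+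
  show "integrable M (\<lambda>\<omega>. \<theta> \<omega> ^ 4 * (centred_product (i, j) \<omega>)\<^sup>2)" using *(1) by (simp add: mult.commute)
  have "expectation (\<lambda>\<omega>. (centred_product (i, j) \<omega>)\<^sup>2) * expectation (\<lambda>\<omega>. \<theta> \<omega> ^ 4) \<le> (x i * x j)\<^sup>2 * 1"
    using centred_product_square(4)[OF i j(1)] wD by (intro mult_mono) auto
  then show "expectation (\<lambda>\<omega>. \<theta> \<omega> ^ 4 * (centred_product (i, j) \<omega>)\<^sup>2) \<le> (x i * x j)\<^sup>2"
    using *(2) by (simp add: mult.commute)
qed

text \<open>
  If neither \<open>k\<close> nor \<open>l\<close> lies in \<open>\<A>\<^sub>2 i j\<close>, then the first centred product is independent of the second
  one and \<open>\<theta>\<close> together, so that the weighted covariance vanishes.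
\<close>

lemma weight_centred_products:
  assumes w: "weight S \<theta>" and p: "(i, j) \<in> pairs S - D S" and q: "(k, l) \<in> pairs S - D S"
  shows "integrable M (\<lambda>\<omega>. \<theta> \<omega> ^ 4 * (centred_product (i, j) \<omega> * centred_product (k, l) \<omega>))"
    "expectation (\<lambda>\<omega>. \<theta> \<omega> ^ 4 * (centred_product (i, j) \<omega> * centred_product (k, l) \<omega>)) \<le>
      (if k \<in> \<A>\<^sub>2 i j \<or> l \<in> \<A>\<^sub>2 i j then x i * x j * (x k * x l) else 0)"
proof -
  note wD = weightD[OF w]
  have i: "i \<in> I" and j: "j \<in> I" "j \<in> \<A> i" and S: "S \<subseteq> I - \<A>\<^sub>2 i j" and k: "k \<in> I" and l: "l \<in> I"
    using p q wD(1) by (auto simp: pairs_def D_def)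
  note [measurable] = wD(6) centred_product_M[OF i j(1)] centred_product_M[OF k l]
  have CS: "integrable M (\<lambda>\<omega>. \<theta> \<omega> ^ 4 * \<bar>centred_product (i, j) \<omega>\<bar> * \<bar>centred_product (k, l) \<omega>\<bar>)"
    "(\<integral>\<omega>. \<theta> \<omega> ^ 4 * \<bar>centred_product (i, j) \<omega>\<bar> * \<bar>centred_product (k, l) \<omega>\<bar> \<partial>M) \<le> (x i * x j) * (x k * x l)"
    using weight_centred_product_square[OF w p] weight_centred_product_square[OF w q]
    by (intro weighted_Cauchy_Schwarz[where u = "x i * x j" and v = "x k * x l" and g = "\<lambda>\<omega>. \<theta> \<omega> ^ 4"]; simp)+
  show int: "integrable M (\<lambda>\<omega>. \<theta> \<omega> ^ 4 * (centred_product (i, j) \<omega> * centred_product (k, l) \<omega>))"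
    by (rule Bochner_Integration.integrable_bound[OF CS(1)]) (auto simp: abs_mult)
  show "expectation (\<lambda>\<omega>. \<theta> \<omega> ^ 4 * (centred_product (i, j) \<omega> * centred_product (k, l) \<omega>)) \<le>
      (if k \<in> \<A>\<^sub>2 i j \<or> l \<in> \<A>\<^sub>2 i j then x i * x j * (x k * x l) else 0)"
  proof (cases "k \<in> \<A>\<^sub>2 i j \<or> l \<in> \<A>\<^sub>2 i j")
    case True
    have "expectation (\<lambda>\<omega>. \<theta> \<omega> ^ 4 * (centred_product (i, j) \<omega> * centred_product (k, l) \<omega>)) \<le> (\<integral>\<omega>. \<theta> \<omega> ^ 4 * \<bar>centred_product (i, j) \<omega>\<bar> * \<bar>centred_product (k, l) \<omega>\<bar> \<partial>M)"
      by (rule integral_mono[OF int CS(1)]) (simp add: mult.assoc mult_left_mono flip: abs_mult)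
    with CS(2) True show ?thesis by simp
  next
    case False
    let ?R = "I - \<A>\<^sub>2 i j"
    have [measurable]: "\<theta> \<in> borel_measurable (F ?R)" by (rule F_mono_measurable[OF S _ wD(2)]) auto
    have [measurable]: "centred_product (k, l) \<in> borel_measurable (F ?R)" using False k l by (intro centred_product_F) auto
    have m: "(\<lambda>\<omega>. \<theta> \<omega> ^ 4 * centred_product (k, l) \<omega>) \<in> borel_measurable (F ?R)" by measurable
    have kl: "integrable M (\<lambda>\<omega>. \<theta> \<omega> ^ 4 * centred_product (k, l) \<omega>)"
    proof -
      have "integrable M (\<lambda>\<omega>. \<theta> \<omega> ^ 4 * \<bar>1\<bar> * \<bar>centred_product (k, l) \<omega>\<bar>)"
        using weight_centred_product_square[OF w q] wD
        by (intro weighted_Cauchy_Schwarz[where u = "1" and v = "x k * x l" and g = "\<lambda>\<omega>. \<theta> \<omega> ^ 4"]; simp)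
      then show ?thesis
        by (rule Bochner_Integration.integrable_bound) (auto simp: abs_mult)
    qed
    have "expectation (\<lambda>\<omega>. centred_product (i, j) \<omega> * (\<theta> \<omega> ^ 4 * centred_product (k, l) \<omega>)) = expectation (centred_product (i, j)) * expectation (\<lambda>\<omega>. \<theta> \<omega> ^ 4 * centred_product (k, l) \<omega>)"
      by (rule indep2_mult(2)[OF i j(2) order_refl _ m centred_product_square(1)[OF i j(1)] kl]) (use i j in \<open>auto intro!: centred_product_F\<close>)
    with False centred_product_square(2)[OF i j(1)] show ?thesis by (simp add: mult_ac)
  qed
qed

text \<open>
  The pairs \<open>(k, l)\<close> with \<open>k \<in> \<A>\<^sub>2 i j\<close> satisfy \<open>l \<in> \<A> k\<close>; those with \<open>l \<in> \<A>\<^sub>2 i j\<close> satisfy \<open>k \<in> N {l}\<close>.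
  Exchanging the two roles in the second case explains the index set \<open>\<A> k \<union> N {k}\<close> and the factor 2.
\<close>

lemma sum_neighbouring_pairs:
  assumes i: "i \<in> I" and j: "j \<in> \<A> i"
  shows "(\<Sum>(k, l)\<in>pairs S - D S. if k \<in> \<A>\<^sub>2 i j \<or> l \<in> \<A>\<^sub>2 i j then x k * x l else 0)
    \<le> 2 * (\<Sum>k\<in>\<A>\<^sub>2 i j. \<Sum>l\<in>\<A> k \<union> N {k}. x k * x l)" (is "_ \<le> 2 * ?R")
proof -
  let ?G = "pairs S - D S" and ?B = "\<A>\<^sub>2 i j"
  let ?Q = "Sigma ?B (\<lambda>k. \<A> k \<union> N {k})"
  have fG: "finite ?G" using finite_pairs by simp
  have BI: "?B \<subseteq> I" using A2_sub i j by simp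
  then have fB: "finite ?B" using finite_I finite_subset by blast
  have fQ: "finite ?Q" using fB BI finite_A finite_N by auto
  have R: "?R = (\<Sum>(k, l)\<in>?Q. x k * x l)"
    using fB BI finite_A finite_N by (subst sum.Sigma) auto
  have "(\<Sum>(k, l)\<in>?G. if k \<in> ?B \<or> l \<in> ?B then x k * x l else 0)
    \<le> (\<Sum>p\<in>?G. (if fst p \<in> ?B then x (fst p) * x (snd p) else 0) + (if snd p \<in> ?B then x (snd p) * x (fst p) else 0))"
    by (rule sum_mono) auto
  also have "\<dots> = (\<Sum>p\<in>{p\<in>?G. fst p \<in> ?B}. x (fst p) * x (snd p)) + (\<Sum>p\<in>{p\<in>?G. snd p \<in> ?B}. x (snd p) * x (fst p))"
    by (simp only: sum.distrib sum.inter_filter[OF fG])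
  also have "(\<Sum>p\<in>{p\<in>?G. fst p \<in> ?B}. x (fst p) * x (snd p)) \<le> (\<Sum>p\<in>?Q. x (fst p) * x (snd p))"
    by (rule sum_mono2[OF fQ]) (auto simp: pairs_def)
  also have "(\<Sum>p\<in>{p\<in>?G. snd p \<in> ?B}. x (snd p) * x (fst p)) = (\<Sum>p\<in>prod.swap ` {p\<in>?G. snd p \<in> ?B}. x (fst p) * x (snd p))"
    by (subst sum.reindex) (auto simp: inj_on_def)
  also have "\<dots> \<le> (\<Sum>p\<in>?Q. x (fst p) * x (snd p))"
    by (rule sum_mono2[OF fQ]) (auto simp: pairs_def N_def)
  finally show ?thesis unfolding R by (simp add: split_beta)
qed

definition "fluctuation S \<omega> = (\<Sum>p\<in>pairs S. centred_product p \<omega>)"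

text \<open>
  Pairs in \<open>D S\<close> may be correlated with \<open>\<theta>\<close> and are bounded in absolute value, which gives \<open>d4\<close>. For
  the remaining pairs the second moment under the density \<open>\<theta>\<^sup>4\<close> is a sum of covariances, of which
  only those between neighbouring pairs survive, which gives \<open>d6a\<close>.
\<close>

lemma weight_fluctuation:
  assumes w: "weight S \<theta>"
  shows "integrable M (\<lambda>\<omega>. \<theta> \<omega> ^ 3 * \<bar>fluctuation S \<omega>\<bar>)"
    "expectation (\<lambda>\<omega>. \<theta> \<omega> ^ 3 * \<bar>fluctuation S \<omega>\<bar>) \<le> 2 * d4 S + sqrt (2 * d6a)"
proof -
  note wD = weightD[OF w]
  note [measurable] = wD(6)
  let ?G = "pairs S - D S" and ?H = "pairs S \<inter> D S"
  have fin: "finite ?G" "finite ?H" using finite_pairs by auto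
  have pI: "i \<in> I" "j \<in> I" "i \<in> I - N S" "j \<in> \<A> i" if "(i, j) \<in> pairs S" for i j
    using that by (auto simp: pairs_def)
  have [measurable]: "centred_product p \<in> borel_measurable M" if "p \<in> pairs S" for p
    using that pI centred_product_M by (cases p) auto
  define f1 where "f1 \<omega> = (\<Sum>p\<in>?G. centred_product p \<omega>)" for \<omega>
  define f2 where "f2 \<omega> = (\<Sum>p\<in>?H. \<bar>centred_product p \<omega>\<bar>)" for \<omega>
  have [measurable]: "f1 \<in> borel_measurable M" "f2 \<in> borel_measurable M" "fluctuation S \<in> borel_measurable M"
    unfolding f1_def[abs_def] f2_def[abs_def] fluctuation_def[abs_def] by auto
  have split: "fluctuation S \<omega> = (\<Sum>p\<in>?G. centred_product p \<omega>) + (\<Sum>p\<in>?H. centred_product p \<omega>)" for \<omega>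
    using sum.Int_Diff[OF finite_pairs, of "\<lambda>p. centred_product p \<omega>" S "D S"] by (simp add: fluctuation_def)
  have le: "\<bar>fluctuation S \<omega>\<bar> \<le> \<bar>f1 \<omega>\<bar> + f2 \<omega>" for \<omega>
    unfolding split f1_def f2_def
    by (rule order_trans[OF abs_triangle_ineq]) (intro add_left_mono sum_abs)
  have f1: "integrable M (\<lambda>\<omega>. \<theta> \<omega> ^ 3 * \<bar>f1 \<omega>\<bar>)" "expectation (\<lambda>\<omega>. \<theta> \<omega> ^ 3 * \<bar>f1 \<omega>\<bar>) \<le> sqrt (2 * d6a)"
  proof -
    have e: "\<theta> \<omega> ^ 4 * (f1 \<omega>)\<^sup>2 = (\<Sum>p\<in>?G. \<Sum>q\<in>?G. \<theta> \<omega> ^ 4 * (centred_product p \<omega> * centred_product q \<omega>))" for \<omega>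
      unfolding f1_def power2_eq_square sum_product by (simp only: sum_distrib_left)
    have int: "integrable M (\<lambda>\<omega>. \<theta> \<omega> ^ 4 * (centred_product p \<omega> * centred_product q \<omega>))" if "p \<in> ?G" "q \<in> ?G" for p q
      using weight_centred_products(1)[OF w, of "fst p" "snd p" "fst q" "snd q"] that by simp
    have 1: "integrable M (\<lambda>\<omega>. \<theta> \<omega> ^ 4 * (f1 \<omega>)\<^sup>2)" unfolding e
      by (intro Bochner_Integration.integrable_sum int)
    have "expectation (\<lambda>\<omega>. \<theta> \<omega> ^ 4 * (f1 \<omega>)\<^sup>2) = (\<Sum>p\<in>?G. \<Sum>q\<in>?G. expectation (\<lambda>\<omega>. \<theta> \<omega> ^ 4 * (centred_product p \<omega> * centred_product q \<omega>)))"
      unfolding e by (rule integral_double_sum) (rule int)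
    also have "\<dots> \<le> (\<Sum>p\<in>?G. \<Sum>q\<in>?G. x (fst p) * x (snd p) *
        (if fst q \<in> \<A>\<^sub>2 (fst p) (snd p) \<or> snd q \<in> \<A>\<^sub>2 (fst p) (snd p) then x (fst q) * x (snd q) else 0))"
    proof (intro sum_mono)
      fix p q assume "p \<in> ?G" "q \<in> ?G"
      then show "expectation (\<lambda>\<omega>. \<theta> \<omega> ^ 4 * (centred_product p \<omega> * centred_product q \<omega>)) \<le> x (fst p) * x (snd p) *
        (if fst q \<in> \<A>\<^sub>2 (fst p) (snd p) \<or> snd q \<in> \<A>\<^sub>2 (fst p) (snd p) then x (fst q) * x (snd q) else 0)"
        using weight_centred_products(2)[OF w, of "fst p" "snd p" "fst q" "snd q"] by (auto split: if_splits)
    qed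
    also have "\<dots> \<le> (\<Sum>p\<in>?G. x (fst p) * x (snd p) * (2 * (\<Sum>k\<in>\<A>\<^sub>2 (fst p) (snd p). \<Sum>l\<in>\<A> k \<union> N {k}. x k * x l)))"
    proof (rule sum_mono)
      fix p assume "p \<in> ?G"
      then have "fst p \<in> I" "snd p \<in> \<A> (fst p)" by (auto simp: pairs_def)
      from sum_neighbouring_pairs[OF this, of S]
      show "(\<Sum>q\<in>?G. x (fst p) * x (snd p) *
        (if fst q \<in> \<A>\<^sub>2 (fst p) (snd p) \<or> snd q \<in> \<A>\<^sub>2 (fst p) (snd p) then x (fst q) * x (snd q) else 0))
        \<le> x (fst p) * x (snd p) * (2 * (\<Sum>k\<in>\<A>\<^sub>2 (fst p) (snd p). \<Sum>l\<in>\<A> k \<union> N {k}. x k * x l))"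
        unfolding sum_distrib_left[symmetric] by (intro mult_left_mono) (simp_all add: split_beta)
    qed
    also have "\<dots> \<le> (\<Sum>p\<in>Sigma I \<A>. x (fst p) * x (snd p) * (2 * (\<Sum>k\<in>\<A>\<^sub>2 (fst p) (snd p). \<Sum>l\<in>\<A> k \<union> N {k}. x k * x l)))"
      by (rule sum_mono2) (use finite_I finite_A in \<open>auto simp: pairs_def intro!: sum_nonneg mult_nonneg_nonneg\<close>)
    also have "\<dots> = 2 * d6a"
    proof -
      have "d6a = (\<Sum>(i, j)\<in>Sigma I \<A>. \<Sum>k\<in>\<A>\<^sub>2 i j. \<Sum>l\<in>\<A> k \<union> N {k}. x i * x j * x k * x l)"
        unfolding d6a_def using finite_I finite_A by (subst sum.Sigma) auto
      then show ?thesis by (simp add: sum_distrib_left split_beta mult_ac)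
    qed
    finally have "expectation (\<lambda>\<omega>. \<theta> \<omega> ^ 4 * (f1 \<omega>)\<^sup>2) \<le> (sqrt (2 * d6a))\<^sup>2"
      using d1_d4_d6a_nonneg by simp
    from weight_Hoelder(1,2)[OF w _ 1 this]
    show "integrable M (\<lambda>\<omega>. \<theta> \<omega> ^ 3 * \<bar>f1 \<omega>\<bar>)" "expectation (\<lambda>\<omega>. \<theta> \<omega> ^ 3 * \<bar>f1 \<omega>\<bar>) \<le> sqrt (2 * d6a)"
      using d1_d4_d6a_nonneg by simp_all
  qed
  have f2: "integrable M (\<lambda>\<omega>. \<theta> \<omega> ^ 3 * f2 \<omega>)" "expectation (\<lambda>\<omega>. \<theta> \<omega> ^ 3 * f2 \<omega>) \<le> 2 * d4 S"
  proof -
    have cpb: "integrable M (\<lambda>\<omega>. \<theta> \<omega> ^ 3 * \<bar>centred_product p \<omega>\<bar>) \<and> expectation (\<lambda>\<omega>. \<theta> \<omega> ^ 3 * \<bar>centred_product p \<omega>\<bar>) \<le> 2 * (x (fst p) * x (snd p))"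
      if p: "p \<in> ?H" for p
    proof -
      obtain i j where ij: "p = (i, j)" by force
      have i: "i \<in> I - N S" "i \<in> I" and j: "j \<in> I" using p pI unfolding ij by auto
      let ?m = "expectation (\<lambda>\<omega>. X i \<omega> * X j \<omega>)"
      have b: "\<theta> \<omega> ^ 3 * \<bar>centred_product p \<omega>\<bar> \<le> \<theta> \<omega> ^ 3 * \<bar>X i \<omega>\<bar> * \<bar>X j \<omega>\<bar> + \<bar>?m\<bar> * \<theta> \<omega> ^ 3" for \<omega>
      proof -
        have "\<bar>centred_product p \<omega>\<bar> \<le> \<bar>X i \<omega>\<bar> * \<bar>X j \<omega>\<bar> + \<bar>?m\<bar>"
          unfolding ij centred_product_def prod.case by (rule order_trans[OF abs_triangle_ineq4]) (simp add: abs_mult)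
        from mult_left_mono[OF this, of "\<theta> \<omega> ^ 3"] wD(3)[of \<omega>] show ?thesis
          by (simp add: algebra_simps)
      qed
      have int': "integrable M (\<lambda>\<omega>. \<theta> \<omega> ^ 3 * \<bar>X i \<omega>\<bar> * \<bar>X j \<omega>\<bar> + \<bar>?m\<bar> * \<theta> \<omega> ^ 3)"
        using weight_cube_X(1)[OF w i(1) j] weight_cube(1)[OF w] by simp
      have [measurable]: "centred_product p \<in> borel_measurable M" using p by simp
      have int: "integrable M (\<lambda>\<omega>. \<theta> \<omega> ^ 3 * \<bar>centred_product p \<omega>\<bar>)"
        by (rule Bochner_Integration.integrable_bound[OF int'])
          (auto intro!: AE_I2 order_trans[OF _ abs_ge_self] b simp: wD(3))
      have "expectation (\<lambda>\<omega>. \<theta> \<omega> ^ 3 * \<bar>centred_product p \<omega>\<bar>) \<le> expectation (\<lambda>\<omega>. \<theta> \<omega> ^ 3 * \<bar>X i \<omega>\<bar> * \<bar>X j \<omega>\<bar> + \<bar>?m\<bar> * \<theta> \<omega> ^ 3)"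
        by (rule integral_mono[OF int int']) (rule b)
      also have "\<dots> = expectation (\<lambda>\<omega>. \<theta> \<omega> ^ 3 * \<bar>X i \<omega>\<bar> * \<bar>X j \<omega>\<bar>) + \<bar>?m\<bar> * expectation (\<lambda>\<omega>. \<theta> \<omega> ^ 3)"
        using weight_cube_X(1)[OF w i(1) j] weight_cube(1)[OF w] by simp
      also have "\<dots> \<le> x i * x j + x i * x j * 1"
        by (intro add_mono mult_mono weight_cube_X(2)[OF w i(1) j] weight_cube(2)[OF w] XX_abs(4) i j)
          (auto intro!: integral_nonneg_AE simp: wD(3))
      finally show ?thesis using int by (simp add: ij)
    qed
    have e: "\<theta> \<omega> ^ 3 * f2 \<omega> = (\<Sum>p\<in>?H. \<theta> \<omega> ^ 3 * \<bar>centred_product p \<omega>\<bar>)" for \<omega>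
      by (simp add: f2_def sum_distrib_left)
    show "integrable M (\<lambda>\<omega>. \<theta> \<omega> ^ 3 * f2 \<omega>)" unfolding e using cpb by auto
    have "expectation (\<lambda>\<omega>. \<theta> \<omega> ^ 3 * f2 \<omega>) = (\<Sum>p\<in>?H. expectation (\<lambda>\<omega>. \<theta> \<omega> ^ 3 * \<bar>centred_product p \<omega>\<bar>))"
      unfolding e using cpb by (intro Bochner_Integration.integral_sum) auto
    also have "\<dots> \<le> (\<Sum>p\<in>?H. 2 * (x (fst p) * x (snd p)))" using cpb by (intro sum_mono) auto
    also have "\<dots> \<le> (\<Sum>p\<in>D S. 2 * (x (fst p) * x (snd p)))" by (rule sum_mono2[OF finite_D]) auto
    also have "\<dots> = 2 * d4 S" by (simp add: d4_def sum_distrib_left split_beta)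
    finally show "expectation (\<lambda>\<omega>. \<theta> \<omega> ^ 3 * f2 \<omega>) \<le> 2 * d4 S" .
  qed
  have b: "\<theta> \<omega> ^ 3 * \<bar>fluctuation S \<omega>\<bar> \<le> \<theta> \<omega> ^ 3 * \<bar>f1 \<omega>\<bar> + \<theta> \<omega> ^ 3 * f2 \<omega>" for \<omega>
    using mult_left_mono[OF le[of \<omega>], of "\<theta> \<omega> ^ 3"] wD(3)[of \<omega>] by (simp add: distrib_left)
  have int': "integrable M (\<lambda>\<omega>. \<theta> \<omega> ^ 3 * \<bar>f1 \<omega>\<bar> + \<theta> \<omega> ^ 3 * f2 \<omega>)" using f1 f2 by simp
  show int: "integrable M (\<lambda>\<omega>. \<theta> \<omega> ^ 3 * \<bar>fluctuation S \<omega>\<bar>)"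
    by (rule Bochner_Integration.integrable_bound[OF int'])
      (auto intro!: AE_I2 order_trans[OF _ abs_ge_self] b simp: wD(3))
  have "expectation (\<lambda>\<omega>. \<theta> \<omega> ^ 3 * \<bar>fluctuation S \<omega>\<bar>) \<le> expectation (\<lambda>\<omega>. \<theta> \<omega> ^ 3 * \<bar>f1 \<omega>\<bar> + \<theta> \<omega> ^ 3 * f2 \<omega>)"
    by (rule integral_mono[OF int int']) (rule b)
  also have "\<dots> \<le> 2 * d4 S + sqrt (2 * d6a)" using f1 f2 by simp
  finally show "expectation (\<lambda>\<omega>. \<theta> \<omega> ^ 3 * \<bar>fluctuation S \<omega>\<bar>) \<le> 2 * d4 S + sqrt (2 * d6a)" .
qed

end

section \<open>Concentration events\<close>

text \<open>
  Indices that belong to both sets cancel, so each index of the union is counted only once.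
\<close>

lemma abs_diff_sum_le:
  fixes f :: "'b \<Rightarrow> real"
  assumes "finite B" "P \<subseteq> B" "Q \<subseteq> B"
  shows "\<bar>sum f P - sum f Q\<bar> \<le> (\<Sum>m\<in>B. \<bar>f m\<bar>)"
proof -
  have fin: "finite P" "finite Q" using assms finite_subset by auto
  have "sum f P - sum f Q = (\<Sum>m\<in>B. f m * (of_bool (m \<in> P) - of_bool (m \<in> Q)))"
    unfolding right_diff_distrib sum_subtractf
    using assms by (simp add: of_bool_def if_distrib sum.inter_restrict[symmetric] Int_absorb1 cong: if_cong)
  also have "\<bar>\<dots>\<bar> \<le> (\<Sum>m\<in>B. \<bar>f m\<bar>)"
    by (rule order_trans[OF sum_abs]) (auto intro!: sum_mono)
  finally show ?thesis .
qed

lemma sum_Un_le: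
  fixes f :: "'b \<Rightarrow> real"
  assumes "finite P" "finite Q" "\<And>p. p \<in> P \<union> Q \<Longrightarrow> 0 \<le> f p"
  shows "sum f (P \<union> Q) \<le> sum f P + sum f Q"
  using assms by (auto simp: sum_Un intro!: sum_nonneg)

text \<open>
  This is \<open>(p - q)\<^sup>2 (p + 2 q) \<ge> 0\<close>.
\<close>

lemma mult_square_le_cubes:
  fixes p q :: real
  assumes "0 \<le> p" "0 \<le> q"
  shows "p * q\<^sup>2 \<le> p ^ 3 / 3 + 2 * q ^ 3 / 3"
proof -
  have "0 \<le> (p - q)\<^sup>2 * (p + 2 * q)" using assms by simp
  also have "\<dots> = p ^ 3 - 3 * (p * q\<^sup>2) + 2 * q ^ 3"
    by (simp add: power2_eq_square power3_eq_cube algebra_simps)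
  finally show ?thesis by simp
qed

lemma mult_square_sum_le_cubes:
  fixes p :: real and f :: "'b \<Rightarrow> real"
  assumes p: "0 \<le> p" and B: "finite B" "P \<subseteq> B"
  shows "p * (sum f P)\<^sup>2 \<le> (card B)\<^sup>2 * p ^ 3 + card B * (\<Sum>j\<in>P. \<bar>f j\<bar> ^ 3)"
proof -
  have c: "real (card P) \<le> card B" using card_mono[OF B] by simp
  have "(sum f P)\<^sup>2 \<le> (\<Sum>j\<in>P. (f j)\<^sup>2) * card P" by (rule sum_squared_le_sum_of_squares)
  then have "p * (sum f P)\<^sup>2 \<le> p * ((\<Sum>j\<in>P. (f j)\<^sup>2) * card P)" by (rule mult_left_mono) (rule p)
  also have "\<dots> = card P * (\<Sum>j\<in>P. p * \<bar>f j\<bar>\<^sup>2)" by (simp add: sum_distrib_left mult_ac)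
  also have "\<dots> \<le> card P * (\<Sum>j\<in>P. p ^ 3 + \<bar>f j\<bar> ^ 3)"
  proof (intro mult_left_mono sum_mono)
    fix j
    show "p * \<bar>f j\<bar>\<^sup>2 \<le> p ^ 3 + \<bar>f j\<bar> ^ 3"
      using mult_square_le_cubes[OF p abs_ge_zero[of "f j"]] p zero_le_power[OF p, of 3]
        zero_le_power[OF abs_ge_zero[of "f j"], of 3] by linarith
  qed simp
  also have "\<dots> = card P * card P * p ^ 3 + card P * (\<Sum>j\<in>P. \<bar>f j\<bar> ^ 3)"
    by (simp add: sum.distrib distrib_left)
  also have "\<dots> \<le> card B * card B * p ^ 3 + card B * (\<Sum>j\<in>P. \<bar>f j\<bar> ^ 3)"
    using c p mult_mono[OF c c] by (intro add_mono mult_right_mono) (auto intro!: mult_right_mono sum_nonneg)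
  finally show ?thesis by (simp add: power2_eq_square)
qed

context locally_dependent begin

definition "blur w \<omega> = (\<Sum>m\<in>I. w m * \<bar>X m \<omega>\<bar>)"

definition "concentrated S w a b \<omega> \<longleftrightarrow> a - blur w \<omega> \<le> W S \<omega> \<and> W S \<omega> \<le> b + blur w \<omega>"

text \<open>
  The inequality with a constant \<open>\<kappa>\<close>, uniformly over the weight, the index set, the blurring of the
  end points and the interval. The uniformity is what makes it applicable to its own remainder.
\<close>

definition "concentration_bound \<kappa> \<longleftrightarrow> (\<forall>S \<theta> w a b. weight S \<theta> \<longrightarrow> (\<forall>m. 0 \<le> w m) \<longrightarrow> a \<le> b \<longrightarrow>
   expectation (\<lambda>\<omega>. \<theta> \<omega> ^ 3 * of_bool (concentrated S w a b \<omega>)) \<le> \<kappa> * ((b - a) / 100 + rest S w))"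

lemma blur_M [measurable]: "blur w \<in> borel_measurable M"
  unfolding blur_def[abs_def] by (intro borel_measurable_sum borel_measurable_times borel_measurable_abs X_M) auto

lemma concentrated_M [measurable]: "Measurable.pred M (concentrated S w a b)"
  unfolding concentrated_def[abs_def] by measurable

lemma d2_d7_nonneg:
  "(\<And>m. 0 \<le> w m) \<Longrightarrow> 0 \<le> d2 w" "(\<And>m. 0 \<le> w m) \<Longrightarrow> 0 \<le> d3 w" "0 \<le> d5" "0 \<le> d6bc" "0 \<le> d7sq" "0 \<le> d6" "0 \<le> d7"
proof -
  show "(\<And>m. 0 \<le> w m) \<Longrightarrow> 0 \<le> d2 w" "(\<And>m. 0 \<le> w m) \<Longrightarrow> 0 \<le> d3 w" "0 \<le> d5"
    unfolding d2_def d3_def d5_def by (auto intro!: sum_nonneg add_nonneg_nonneg mult_nonneg_nonneg)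
  show a: "0 \<le> d6bc" unfolding d6bc_def by (auto intro!: sum_nonneg add_nonneg_nonneg mult_nonneg_nonneg)
  show b: "0 \<le> d7sq" unfolding d7sq_def by (auto intro!: sum_nonneg add_nonneg_nonneg mult_nonneg_nonneg)
  show "0 \<le> d6" "0 \<le> d7" unfolding d6_def d7_def using a b d1_d4_d6a_nonneg by auto
qed

lemma rest_nonneg: "(\<And>m. 0 \<le> w m) \<Longrightarrow> 0 \<le> rest S w"
  unfolding rest_def by (intro add_nonneg_nonneg d1_d4_d6a_nonneg d2_d7_nonneg)

lemma concentrated_integrable:
  assumes "weight S \<theta>"
  shows "integrable M (\<lambda>\<omega>. \<theta> \<omega> ^ 3 * of_bool (concentrated S' w a b \<omega>))"
proof (rule Bochner_Integration.integrable_bound[OF weight_cube(1)[OF assms]])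
  note [measurable] = weightD(6)[OF assms]
  show "(\<lambda>\<omega>. \<theta> \<omega> ^ 3 * of_bool (concentrated S' w a b \<omega>)) \<in> borel_measurable M" by measurable
qed (auto simp: of_bool_def)

lemma N_insert: "N (insert i S) = N S \<union> N {i}" by (auto simp: N_def)

lemma D_insert: "D (insert i S) = D S \<union> D {i}" by (auto simp: D_def)

text \<open>
  Multiplying by \<open>\<bar>X i\<bar>\<close> keeps the normalization because \<open>X i\<close> and \<open>\<theta>\<close> are independent. This is the
  reason to work with \<open>L\<^sup>4\<^sup>/\<^sup>3\<close>: the norm of \<open>\<bar>X i\<bar>\<^sup>3\<close> in this space is the third power of \<open>x i\<close>.
\<close>

lemma weight_insert:
  assumes w: "weight S \<theta>" and i: "i \<in> I - N S" and x: "x i > 0"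
  shows "weight (insert i S) (\<lambda>\<omega>. \<theta> \<omega> * \<bar>X i \<omega>\<bar> / x i)"
  unfolding weight_def
proof (intro conjI allI)
  note wD = weightD[OF w]
  show sub: "insert i S \<subseteq> I" using wD i by auto
  have [measurable]: "\<theta> \<in> borel_measurable (F (insert i S))" "X i \<in> borel_measurable (F (insert i S))"
    using F_mono_measurable[OF _ sub wD(2)] X_F_mono[OF _ sub] by auto
  show "(\<lambda>\<omega>. \<theta> \<omega> * \<bar>X i \<omega>\<bar> / x i) \<in> borel_measurable (F (insert i S))" by measurable
  show "0 \<le> \<theta> \<omega> * \<bar>X i \<omega>\<bar> / x i" for \<omega> using wD by simp
  have e: "(\<theta> \<omega> * \<bar>X i \<omega>\<bar> / x i) ^ 4 = \<theta> \<omega> ^ 4 * X i \<omega> ^ 4 / x i ^ 4" for \<omega>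
    by (simp add: power_mult_distrib power_divide)
  show "integrable M (\<lambda>\<omega>. (\<theta> \<omega> * \<bar>X i \<omega>\<bar> / x i) ^ 4)"
    unfolding e using weight_X(3)[OF w i] by simp
  show "expectation (\<lambda>\<omega>. (\<theta> \<omega> * \<bar>X i \<omega>\<bar> / x i) ^ 4) \<le> 1"
    unfolding e using weight_X(4)[OF w i] x by (simp add: divide_le_eq)
qed

text \<open>
  The weight is rescaled by \<open>x i\<close>. If \<open>x i = 0\<close>, then \<open>X i\<close> vanishes almost surely, and so do both
  sides.
\<close>

lemma concentration_bound_cube:
  assumes \<kappa>: "concentration_bound \<kappa>" and w: "weight S \<theta>" and i: "i \<in> I - N S" and v: "\<And>m. 0 \<le> v m" and ab: "a \<le> b"
  shows "integrable M (\<lambda>\<omega>. \<theta> \<omega> ^ 3 * \<bar>X i \<omega>\<bar> ^ 3 * of_bool (concentrated (insert i S) v a b \<omega>))"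
    "expectation (\<lambda>\<omega>. \<theta> \<omega> ^ 3 * \<bar>X i \<omega>\<bar> ^ 3 * of_bool (concentrated (insert i S) v a b \<omega>))
      \<le> \<kappa> * x i ^ 3 * ((b - a) / 100 + rest (insert i S) v)"
proof -
  let ?f = "\<lambda>\<omega>. \<theta> \<omega> ^ 3 * \<bar>X i \<omega>\<bar> ^ 3 * of_bool (concentrated (insert i S) v a b \<omega>)"
  note wD = weightD[OF w]
  note [measurable] = wD(6)
  have iI: "i \<in> I" using i by simp
  then have [measurable]: "X i \<in> borel_measurable M" by simp
  have "integrable M ?f \<and> expectation ?f \<le> \<kappa> * x i ^ 3 * ((b - a) / 100 + rest (insert i S) v)"
  proof (cases "x i = 0")
    case True
    then have "expectation (\<lambda>\<omega>. X i \<omega> ^ 4) = 0" using x_power4[of i] by simp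
    then have "AE \<omega> in M. X i \<omega> ^ 4 = 0"
      using integral_nonneg_eq_0_iff_AE[OF X4_integrable[OF iI]] by simp
    then have ae: "AE \<omega> in M. ?f \<omega> = 0" by eventually_elim auto
    have "integrable M ?f = integrable M (\<lambda>_. 0 :: real)" by (rule integrable_cong_AE) (use ae in auto)
    moreover have "expectation ?f = expectation (\<lambda>_. 0)" by (rule integral_cong_AE) (use ae in auto)
    ultimately show ?thesis using True by simp
  next
    case False
    then have x: "x i > 0" using x_nonneg[of i] by linarith
    note w' = weight_insert[OF w i x]
    have e: "?f \<omega> = x i ^ 3 * ((\<theta> \<omega> * \<bar>X i \<omega>\<bar> / x i) ^ 3 * of_bool (concentrated (insert i S) v a b \<omega>))" for \<omega>
      using x by (simp add: power_mult_distrib power_divide)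
    have "expectation (\<lambda>\<omega>. (\<theta> \<omega> * \<bar>X i \<omega>\<bar> / x i) ^ 3 * of_bool (concentrated (insert i S) v a b \<omega>)) \<le> \<kappa> * ((b - a) / 100 + rest (insert i S) v)"
      using \<kappa> w' v ab unfolding concentration_bound_def by blast
    then have "x i ^ 3 * expectation (\<lambda>\<omega>. (\<theta> \<omega> * \<bar>X i \<omega>\<bar> / x i) ^ 3 * of_bool (concentrated (insert i S) v a b \<omega>)) \<le> x i ^ 3 * (\<kappa> * ((b - a) / 100 + rest (insert i S) v))"
      by (rule mult_left_mono) simp
    then show ?thesis unfolding e using concentrated_integrable[OF w'] by (simp add: mult_ac)
  qed
  then show "integrable M ?f" "expectation ?f \<le> \<kappa> * x i ^ 3 * ((b - a) / 100 + rest (insert i S) v)" by auto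
qed

text \<open>
  An upper bound for the growth of \<open>d1\<close>, \<open>d2\<close>, \<open>d3\<close> and \<open>d4\<close> when \<open>j\<close> joins the index set and the
  weights \<open>w\<close> increase by one on \<open>B\<close>.
\<close>

definition "increment B j = d1 {j} + (\<Sum>m\<in>B. x m) + (\<Sum>m\<in>B. \<Sum>k\<in>N {m}. x k * x m) + d4 {j}"

lemma increment_nonneg: "0 \<le> increment B j"
  unfolding increment_def by (intro add_nonneg_nonneg d1_d4_d6a_nonneg sum_nonneg mult_nonneg_nonneg x_nonneg)

lemma sum_add_of_bool:
  fixes f :: "'i \<Rightarrow> real"
  assumes B: "B \<subseteq> I"
  shows "(\<Sum>m\<in>I. (w m + of_bool (m \<in> B)) * f m) = (\<Sum>m\<in>I. w m * f m) + (\<Sum>m\<in>B. f m)"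
proof -
  have "(\<Sum>m\<in>I. (w m + of_bool (m \<in> B)) * f m) = (\<Sum>m\<in>I. w m * f m + (if m \<in> B then f m else 0))"
    by (rule sum.cong) (auto simp: distrib_right)
  also have "\<dots> = (\<Sum>m\<in>I. w m * f m) + sum f (I \<inter> B)"
    by (simp add: sum.distrib sum.inter_restrict[OF finite_I])
  also have "I \<inter> B = B" using B by auto
  finally show ?thesis .
qed

lemma rest_insert:
  assumes B: "B \<subseteq> I"
  shows "rest (insert j S) (\<lambda>m. w m + of_bool (m \<in> B)) \<le> rest S w + increment B j"
proof -
  have "d1 (insert j S) \<le> d1 S + d1 {j}"
    unfolding d1_def N_insert[of j S] by (rule sum_Un_le) (auto simp: finite_N)
  moreover have "d4 (insert j S) \<le> d4 S + d4 {j}"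
    unfolding d4_def D_insert[of j S] by (rule sum_Un_le) (auto simp: finite_D)
  moreover have "d2 (\<lambda>m. w m + of_bool (m \<in> B)) = d2 w + (\<Sum>m\<in>B. x m)"
    unfolding d2_def by (rule sum_add_of_bool[OF B])
  moreover have "d3 (\<lambda>m. w m + of_bool (m \<in> B)) = d3 w + (\<Sum>m\<in>B. \<Sum>k\<in>N {m}. x k * x m)"
    unfolding d3_def sum_distrib_left[symmetric] by (rule sum_add_of_bool[OF B])
  ultimately show ?thesis unfolding rest_def increment_def by linarith
qed

text \<open>
  If the segment between \<open>W - u\<close> and \<open>W\<close> meets a blurred interval, then so does the smaller sum
  \<open>W (insert j S)\<close>, after further blurring: it differs from \<open>W\<close> by the sum \<open>V\<close> over \<open>N {j}\<close>, and
  from \<open>W - u\<close> by \<open>V - u\<close>, where the common indices cancel, so that one unit of weight on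
  \<open>\<A> i \<union> N {j}\<close> suffices.
\<close>

lemma concentrated_near_edge:
  assumes ii: "i \<in> I - N S" and jj: "j \<in> I - N S" and B: "B \<subseteq> I" "\<A> i \<union> N {j} \<subseteq> B"
    and u: "u = (\<Sum>k\<in>\<A> i \<inter> (I - N S). X k \<omega>)"
    and lo: "min (W S \<omega>) (W S \<omega> - u) \<le> q + blur w \<omega>" and hi: "p - blur w \<omega> \<le> max (W S \<omega>) (W S \<omega> - u)"
  shows "concentrated (insert j S) (\<lambda>m. w m + of_bool (m \<in> B)) p q \<omega>"
proof -
  let ?T = "I - N S"
  define V where "V = (\<Sum>k\<in>N {j} \<inter> ?T. X k \<omega>)"
  have fB: "finite B" using B finite_I finite_subset by auto
  have WV: "W (insert j S) \<omega> = W S \<omega> - V"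
  proof -
    have "?T = (N {j} \<inter> ?T) \<union> (I - N (insert j S))" by (auto simp: N_def)
    moreover have "(N {j} \<inter> ?T) \<inter> (I - N (insert j S)) = {}" by (auto simp: N_def)
    moreover have "sum (\<lambda>k. X k \<omega>) ((N {j} \<inter> ?T) \<union> (I - N (insert j S))) = V + W (insert j S) \<omega>"
      unfolding W_def V_def by (rule sum.union_disjoint) (use finite_I calculation(2) in auto)
    ultimately have "W S \<omega> = V + W (insert j S) \<omega>" by (simp only: W_def)
    then show ?thesis by simp
  qed
  let ?b = "\<Sum>m\<in>B. \<bar>X m \<omega>\<bar>"
  have bl: "blur (\<lambda>m. w m + of_bool (m \<in> B)) \<omega> = blur w \<omega> + ?b"
    unfolding blur_def by (rule sum_add_of_bool[OF B(1)])
  have "\<bar>V\<bar> \<le> ?b"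
    using abs_diff_sum_le[OF fB, of "N {j} \<inter> ?T" "{}" "\<lambda>k. X k \<omega>"] B by (auto simp: V_def)
  moreover have "\<bar>V - u\<bar> \<le> ?b"
    unfolding V_def u by (rule abs_diff_sum_le[OF fB]) (use B in auto)
  ultimately show ?thesis using lo hi unfolding concentrated_def WV bl by linarith
qed

section \<open>The Taylor remainder as a concentration probability\<close>

text \<open>
  The two intervals of length \<open>\<epsilon>\<close> are those on which the trapezoid has nonzero slope.
\<close>

definition "edge S w a b \<epsilon> j B \<theta> \<omega> = \<theta> \<omega> ^ 3 * \<bar>X j \<omega>\<bar> ^ 3 *
   (of_bool (concentrated (insert j S) (\<lambda>m. w m + of_bool (m \<in> B)) (a - \<epsilon>) a \<omega>)
  + of_bool (concentrated (insert j S) (\<lambda>m. w m + of_bool (m \<in> B)) b (b + \<epsilon>) \<omega>))"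

lemma edge_bound:
  assumes \<kappa>: "concentration_bound \<kappa>" "0 \<le> \<kappa>" and w: "weight S \<theta>" and j: "j \<in> I - N S" and v: "\<And>m. 0 \<le> w m"
    and \<epsilon>: "0 \<le> \<epsilon>" and B: "B \<subseteq> I"
  shows "integrable M (edge S w a b \<epsilon> j B \<theta>)"
    "expectation (edge S w a b \<epsilon> j B \<theta>) \<le> 2 * \<kappa> * (x j ^ 3 * (\<epsilon> / 100 + rest S w + increment B j))"
proof -
  let ?w = "\<lambda>m. w m + of_bool (m \<in> B)"
  have v': "0 \<le> ?w m" for m using v[of m] by simp
  note L = concentration_bound_cube[where v = ?w and a = "a - \<epsilon>" and b = a, OF \<kappa>(1) w j v']
    and R = concentration_bound_cube[where v = ?w and a = b and b = "b + \<epsilon>", OF \<kappa>(1) w j v']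
  show "integrable M (edge S w a b \<epsilon> j B \<theta>)"
    unfolding edge_def distrib_left using L(1) R(1) \<epsilon> by simp
  have "expectation (edge S w a b \<epsilon> j B \<theta>) \<le> 2 * (\<kappa> * x j ^ 3 * (\<epsilon> / 100 + rest (insert j S) ?w))"
  proof -
    let ?K = "\<kappa> * x j ^ 3 * (\<epsilon> / 100 + rest (insert j S) ?w)"
    have "expectation (edge S w a b \<epsilon> j B \<theta>) =
        expectation (\<lambda>\<omega>. \<theta> \<omega> ^ 3 * \<bar>X j \<omega>\<bar> ^ 3 * of_bool (concentrated (insert j S) ?w (a - \<epsilon>) a \<omega>)) +
        expectation (\<lambda>\<omega>. \<theta> \<omega> ^ 3 * \<bar>X j \<omega>\<bar> ^ 3 * of_bool (concentrated (insert j S) ?w b (b + \<epsilon>) \<omega>))"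
      unfolding edge_def distrib_left using L(1) R(1) \<epsilon> by simp
    also have "\<dots> \<le> ?K + ?K"
      by (rule add_mono; rule order_trans[OF L(2)] order_trans[OF R(2)]) (use \<epsilon> in auto)
    finally show ?thesis by simp
  qed
  also have "\<dots> \<le> 2 * (\<kappa> * x j ^ 3 * (\<epsilon> / 100 + (rest S w + increment B j)))"
    using \<kappa>(2) rest_insert[OF B, of j S w] by (intro mult_left_mono add_left_mono) auto
  finally show "expectation (edge S w a b \<epsilon> j B \<theta>) \<le> 2 * \<kappa> * (x j ^ 3 * (\<epsilon> / 100 + rest S w + increment B j))"
    by (simp add: mult_ac add_ac)
qed

text \<open>
  A majorant of \<open>\<theta>\<^sup>3 \<bar>X i\<bar>\<close> times the second order Taylor remainder at \<open>W\<close> with increment \<open>Y\<^sub>i\<close>.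
\<close>

definition "remainder S w a b \<epsilon> \<theta> i \<omega> = 1 / (2 * \<epsilon>) *
   ((card (\<A> i))\<^sup>2 * edge S w a b \<epsilon> i (\<A> i \<union> N {i}) \<theta> \<omega>
    + card (\<A> i) * (\<Sum>j\<in>\<A> i \<inter> (I - N S). edge S w a b \<epsilon> j (\<A> i \<union> N {j}) \<theta> \<omega>))"

text \<open>
  The bound with constant \<open>\<kappa>\<close> is applied to \<open>\<theta> \<bar>X i\<bar>\<close> and to \<open>\<theta> \<bar>X j\<bar>\<close> for the neighbours \<open>j\<close> of \<open>i\<close>.
  The two slopes and the factor \<open>1 / (2 \<epsilon>)\<close> combine to \<open>\<kappa> / \<epsilon>\<close>.
\<close>

lemma remainder_bound:
  assumes \<kappa>: "concentration_bound \<kappa>" "0 \<le> \<kappa>" and w: "weight S \<theta>" and i: "i \<in> I - N S" and v: "\<And>m. 0 \<le> w m"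
    and \<epsilon>: "0 < \<epsilon>"
  shows "integrable M (remainder S w a b \<epsilon> \<theta> i)"
    "expectation (remainder S w a b \<epsilon> \<theta> i) \<le> \<kappa> / \<epsilon> *
      ((card (\<A> i))\<^sup>2 * (x i ^ 3 * (\<epsilon> / 100 + rest S w + increment (\<A> i \<union> N {i}) i))
       + (\<Sum>j\<in>\<A> i. card (\<A> i) * (x j ^ 3 * (\<epsilon> / 100 + rest S w + increment (\<A> i \<union> N {j}) j))))"
proof -
  have iI: "i \<in> I" using i by simp
  have B: "\<A> i \<union> N {j} \<subseteq> I" for j using A_sub[OF iI] N_sub by auto
  note E = edge_bound[where w = w and a = a and b = b, OF \<kappa> w _ v less_imp_le[OF \<epsilon>] B]
  let ?J = "\<A> i \<inter> (I - N S)"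
  have J: "j \<in> I - N S" if "j \<in> ?J" for j using that by auto
  show "integrable M (remainder S w a b \<epsilon> \<theta> i)"
    unfolding remainder_def using E(1)[OF i] E(1)[OF J] by (intro integrable_mult_right Bochner_Integration.integrable_add Bochner_Integration.integrable_sum) auto
  have nn: "0 \<le> x j ^ 3 * (\<epsilon> / 100 + rest S w + increment (\<A> i \<union> N {j}) j)" for j
    using \<epsilon> rest_nonneg[of w S] v by (intro mult_nonneg_nonneg add_nonneg_nonneg increment_nonneg) auto
  have "expectation (remainder S w a b \<epsilon> \<theta> i) = 1 / (2 * \<epsilon>) *
      ((card (\<A> i))\<^sup>2 * expectation (edge S w a b \<epsilon> i (\<A> i \<union> N {i}) \<theta>)
    + card (\<A> i) * (\<Sum>j\<in>?J. expectation (edge S w a b \<epsilon> j (\<A> i \<union> N {j}) \<theta>)))"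
  proof -
    have "integrable M (\<lambda>\<omega>. \<Sum>j\<in>?J. edge S w a b \<epsilon> j (\<A> i \<union> N {j}) \<theta> \<omega>)"
      by (intro Bochner_Integration.integrable_sum E(1) J)
    moreover have "expectation (\<lambda>\<omega>. \<Sum>j\<in>?J. edge S w a b \<epsilon> j (\<A> i \<union> N {j}) \<theta> \<omega>)
        = (\<Sum>j\<in>?J. expectation (edge S w a b \<epsilon> j (\<A> i \<union> N {j}) \<theta>))"
      by (intro Bochner_Integration.integral_sum E(1) J)
    ultimately show ?thesis unfolding remainder_def using E(1)[OF i] by simp
  qed
  also have "\<dots> \<le> 1 / (2 * \<epsilon>) *
      ((card (\<A> i))\<^sup>2 * (2 * \<kappa> * (x i ^ 3 * (\<epsilon> / 100 + rest S w + increment (\<A> i \<union> N {i}) i)))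
    + card (\<A> i) * (\<Sum>j\<in>?J. 2 * \<kappa> * (x j ^ 3 * (\<epsilon> / 100 + rest S w + increment (\<A> i \<union> N {j}) j))))"
    using \<epsilon> by (intro mult_left_mono add_mono sum_mono E(2) i J) auto
  also have "\<dots> \<le> 1 / (2 * \<epsilon>) *
      ((card (\<A> i))\<^sup>2 * (2 * \<kappa> * (x i ^ 3 * (\<epsilon> / 100 + rest S w + increment (\<A> i \<union> N {i}) i)))
    + card (\<A> i) * (\<Sum>j\<in>\<A> i. 2 * \<kappa> * (x j ^ 3 * (\<epsilon> / 100 + rest S w + increment (\<A> i \<union> N {j}) j))))"
    using \<epsilon> \<kappa>(2) nn finite_A[OF iI] by (intro mult_left_mono add_mono sum_mono2) auto
  also have "\<dots> = \<kappa> / \<epsilon> *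
      ((card (\<A> i))\<^sup>2 * (x i ^ 3 * (\<epsilon> / 100 + rest S w + increment (\<A> i \<union> N {i}) i))
       + (\<Sum>j\<in>\<A> i. card (\<A> i) * (x j ^ 3 * (\<epsilon> / 100 + rest S w + increment (\<A> i \<union> N {j}) j))))"
  proof -
    have "1 / (2 * \<epsilon>) * (p * (2 * \<kappa> * y) + q * (2 * \<kappa> * z)) = \<kappa> / \<epsilon> * (p * y + q * z)" for p q y z :: real
      using \<epsilon> by (simp add: field_simps)
    then show ?thesis by (simp only: sum_distrib_left[symmetric])
  qed
  finally show "expectation (remainder S w a b \<epsilon> \<theta> i) \<le> \<kappa> / \<epsilon> *
      ((card (\<A> i))\<^sup>2 * (x i ^ 3 * (\<epsilon> / 100 + rest S w + increment (\<A> i \<union> N {i}) i))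
       + (\<Sum>j\<in>\<A> i. card (\<A> i) * (x j ^ 3 * (\<epsilon> / 100 + rest S w + increment (\<A> i \<union> N {j}) j))))" .
qed

text \<open>
  The increments, weighted as the summands of \<open>d5\<close>, are the terms of \<open>d6bc\<close> and \<open>d7sq\<close>. The factor 2
  stems from the indices in \<open>N {j}\<close>, which occur once in \<open>d1 {j}\<close> and once in the sum over the set
  \<open>\<A> i \<union> N {j}\<close>.
\<close>

lemma sum_increment_le:
  "(\<Sum>i\<in>I. (card (\<A> i))\<^sup>2 * (x i ^ 3 * (r + increment (\<A> i \<union> N {i}) i))
       + (\<Sum>j\<in>\<A> i. card (\<A> i) * (x j ^ 3 * (r + increment (\<A> i \<union> N {j}) j)))) \<le> r * d5 + 2 * d6bc + d7sq"
proof -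
  have fin: "finite (\<A> i \<union> N S)" if "i \<in> I" for i S using that finite_A finite_N by auto
  let ?e = "\<lambda>B j. 2 * (\<Sum>m\<in>B. x m) + (\<Sum>m\<in>B. \<Sum>k\<in>N {m}. x k * x m) + d4 {j}"
  have ex: "increment (\<A> i \<union> N {j}) j \<le> ?e (\<A> i \<union> N {j}) j" if "i \<in> I" for i j
  proof -
    have "d1 {j} \<le> (\<Sum>m\<in>\<A> i \<union> N {j}. x m)"
      unfolding d1_def by (rule sum_mono2) (use fin[OF that] in auto)
    then show ?thesis unfolding increment_def by linarith
  qed
  have "(\<Sum>i\<in>I. (card (\<A> i))\<^sup>2 * (x i ^ 3 * (r + increment (\<A> i \<union> N {i}) i))
       + (\<Sum>j\<in>\<A> i. card (\<A> i) * (x j ^ 3 * (r + increment (\<A> i \<union> N {j}) j))))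
    \<le> (\<Sum>i\<in>I. (card (\<A> i))\<^sup>2 * (x i ^ 3 * (r + ?e (\<A> i \<union> N {i}) i))
       + (\<Sum>j\<in>\<A> i. card (\<A> i) * (x j ^ 3 * (r + ?e (\<A> i \<union> N {j}) j))))"
    using ex by (intro sum_mono add_mono mult_left_mono) auto
  also have "\<dots> = r * d5 + 2 * d6bc + d7sq"
    unfolding d5_def d6bc_def d7sq_def d4_def
    by (simp add: sum.distrib sum_distrib_left sum_distrib_right distrib_left mult_ac split_beta)
  finally show ?thesis .
qed

lemma X_uncorrelated:
  assumes "i \<in> I" "j \<in> I - \<A> i"
  shows "expectation (\<lambda>\<omega>. X i \<omega> * X j \<omega>) = 0"
proof -
  have "expectation (\<lambda>\<omega>. X i \<omega> * X j \<omega>) = expectation (X i) * expectation (X j)"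
    by (rule indep1_mult(2)[of i "{j}"]) (use assms in \<open>auto intro: X_F X_integrable\<close>)
  then show ?thesis using X_centred[OF assms(1)] by simp
qed

lemma sum_pairs:
  fixes f :: "'i \<Rightarrow> 'i \<Rightarrow> real"
  shows "(\<Sum>i\<in>I - N S. \<Sum>j\<in>\<A> i \<inter> (I - N S). f i j) = (\<Sum>(i, j)\<in>pairs S. f i j)"
  unfolding pairs_def using finite_I by (subst sum.Sigma) auto

lemma W_square_pairs:
  "expectation (\<lambda>\<omega>. (W S \<omega>)\<^sup>2) = (\<Sum>(i, j)\<in>pairs S. expectation (\<lambda>\<omega>. X i \<omega> * X j \<omega>))"
  unfolding W_square(2) sum_pairs[symmetric]
  by (intro sum.cong refl sum.mono_neutral_right) (use finite_I X_uncorrelated in auto)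

lemma sum_X_neighbours:
  "(\<Sum>i\<in>I - N S. X i \<omega> * (\<Sum>j\<in>\<A> i \<inter> (I - N S). X j \<omega>)) = fluctuation S \<omega> + expectation (\<lambda>\<omega>. (W S \<omega>)\<^sup>2)"
  unfolding W_square_pairs fluctuation_def sum_distrib_left sum_pairs sum.distrib[symmetric]
  by (rule sum.cong) (auto simp: centred_product_def)

text \<open>
  The remainder vanishes unless \<open>W\<close> comes close to a slope, and then the near-edge lemma applies for
  \<open>i\<close> and for every neighbour \<open>j\<close>; the cubic factors come from \<open>mult_square_sum_le_cubes\<close>.
\<close>

lemma remainder_taylor:
  assumes i: "i \<in> I - N S" and \<theta>: "0 \<le> \<theta> \<omega>" and \<epsilon>: "0 < \<epsilon>"
    and u: "u = (\<Sum>j\<in>\<A> i \<inter> (I - N S). X j \<omega>)"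
    and w: "\<And>m. 0 \<le> w m" and h: "h = (b - a) / 2 + blur w \<omega>" and y: "y = W S \<omega> - (a + b) / 2"
  shows "\<theta> \<omega> ^ 3 * \<bar>X i \<omega>\<bar> * \<bar>stein_fun \<epsilon> h y - stein_fun \<epsilon> h (y - u) - u * trapezoid \<epsilon> h y\<bar>
    \<le> remainder S w a b \<epsilon> \<theta> i \<omega>"
proof -
  let ?J = "\<A> i \<inter> (I - N S)" and ?c = "card (\<A> i)"
  have iI: "i \<in> I" using i by simp
  define L :: real where "L = of_bool (min y (y - u) \<le> - h \<and> - h - \<epsilon> \<le> max y (y - u))"
  define R :: real where "R = of_bool (min y (y - u) \<le> h + \<epsilon> \<and> h \<le> max y (y - u))"
  have bl: "0 \<le> blur w \<omega>" unfolding blur_def using w by (intro sum_nonneg mult_nonneg_nonneg) auto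
  have LR: "0 \<le> L" "0 \<le> R" by (auto simp: L_def R_def)
  have edge: "\<theta> \<omega> ^ 3 * \<bar>X j \<omega>\<bar> ^ 3 * (L + R) \<le> edge S w a b \<epsilon> j (\<A> i \<union> N {j}) \<theta> \<omega>" if j: "j \<in> I - N S" for j
  proof -
    let ?B = "\<A> i \<union> N {j}"
    have B: "?B \<subseteq> I" using A_sub[OF iI] N_sub by auto
    note near = concentrated_near_edge[OF i j B order_refl u]
    define mn mx where "mn = min y (y - u)" and "mx = max y (y - u)"
    have mm: "min (W S \<omega>) (W S \<omega> - u) = mn + (a + b) / 2"
      "max (W S \<omega>) (W S \<omega> - u) = mx + (a + b) / 2" by (auto simp: y mn_def mx_def min_def max_def)
    have h': "h = b / 2 - a / 2 + blur w \<omega>" by (simp add: h diff_divide_distrib)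
    have "L \<le> of_bool (concentrated (insert j S) (\<lambda>m. w m + of_bool (m \<in> ?B)) (a - \<epsilon>) a \<omega>)"
    proof (cases "min y (y - u) \<le> - h \<and> - h - \<epsilon> \<le> max y (y - u)")
      case True
      have "concentrated (insert j S) (\<lambda>m. w m + of_bool (m \<in> ?B)) (a - \<epsilon>) a \<omega>"

      proof (rule near, goal_cases)
        case 1 show ?case unfolding mm using True[folded mn_def mx_def] h' bl \<epsilon> by argo
        case 2 show ?case unfolding mm using True[folded mn_def mx_def] h' bl \<epsilon> by argo
      qed
      then show ?thesis by (simp add: L_def)
    next
      case False
      then have "L = 0" unfolding L_def by (simp only: of_bool_eq)
      then show ?thesis by simp
    qed
    moreover have "R \<le> of_bool (concentrated (insert j S) (\<lambda>m. w m + of_bool (m \<in> ?B)) b (b + \<epsilon>) \<omega>)"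
    proof (cases "min y (y - u) \<le> h + \<epsilon> \<and> h \<le> max y (y - u)")
      case True
      have "concentrated (insert j S) (\<lambda>m. w m + of_bool (m \<in> ?B)) b (b + \<epsilon>) \<omega>"

      proof (rule near, goal_cases)
        case 1 show ?case unfolding mm using True[folded mn_def mx_def] h' bl \<epsilon> by argo
        case 2 show ?case unfolding mm using True[folded mn_def mx_def] h' bl \<epsilon> by argo
      qed
      then show ?thesis by (simp add: R_def)
    next
      case False
      then have "R = 0" unfolding R_def by (simp only: of_bool_eq)
      then show ?thesis by simp
    qed
    ultimately show ?thesis unfolding edge_def using \<theta> by (intro mult_left_mono add_mono) auto
  qed
  have "\<theta> \<omega> ^ 3 * \<bar>X i \<omega>\<bar> * \<bar>stein_fun \<epsilon> h y - stein_fun \<epsilon> h (y - u) - u * trapezoid \<epsilon> h y\<bar>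
     \<le> \<theta> \<omega> ^ 3 * \<bar>X i \<omega>\<bar> * (u\<^sup>2 / (2 * \<epsilon>) * (L + R))"
    unfolding L_def R_def by (intro mult_left_mono stein_fun_taylor \<epsilon>) (use \<theta> in auto)
  also have "\<dots> = 1 / (2 * \<epsilon>) * (\<theta> \<omega> ^ 3 * (L + R) * (\<bar>X i \<omega>\<bar> * u\<^sup>2))" by simp
  also have "\<dots> \<le> 1 / (2 * \<epsilon>) * (\<theta> \<omega> ^ 3 * (L + R) * (?c\<^sup>2 * \<bar>X i \<omega>\<bar> ^ 3 + ?c * (\<Sum>j\<in>?J. \<bar>X j \<omega>\<bar> ^ 3)))"
    using mult_square_sum_le_cubes[of "\<bar>X i \<omega>\<bar>" "\<A> i" ?J "\<lambda>j. X j \<omega>"] finite_A[OF iI] \<theta> LR \<epsilon>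
    unfolding u by (intro mult_left_mono) auto
  also have "\<dots> = 1 / (2 * \<epsilon>) * (?c\<^sup>2 * (\<theta> \<omega> ^ 3 * \<bar>X i \<omega>\<bar> ^ 3 * (L + R)) + ?c * (\<Sum>j\<in>?J. \<theta> \<omega> ^ 3 * \<bar>X j \<omega>\<bar> ^ 3 * (L + R)))"
    unfolding sum_distrib_right[symmetric] sum_distrib_left[symmetric] by (simp add: algebra_simps)
  also have "\<dots> \<le> remainder S w a b \<epsilon> \<theta> i \<omega>"
    unfolding remainder_def using \<epsilon> i by (intro mult_left_mono add_mono sum_mono edge) auto
  finally show ?thesis .
qed

section \<open>The Stein step\<close>

text \<open>
  The value of the Stein function after deleting the indices in \<open>\<A> i\<close> both from the sum and from the
  blurring of the end points; it is a function of the variables outside \<open>\<A> i\<close>.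
\<close>

definition "decoupled S w a b \<epsilon> i \<omega> = stein_fun \<epsilon>
  ((b - a) / 2 + (\<Sum>m\<in>I - \<A> i. w m * \<bar>X m \<omega>\<bar>)) ((\<Sum>j\<in>I - N S - \<A> i. X j \<omega>) - (a + b) / 2)"

text \<open>
  The Stein identity before taking expectations. For each \<open>i\<close>, the difference between
  \<open>X i * stein_fun\<close> and its decoupled value splits into \<open>X i * u i * trapezoid\<close>, the Taylor remainder
  and the effect of the change of width. The sum of \<open>X i * u i\<close> is \<open>E W\<^sup>2\<close> plus the fluctuation, and
  the trapezoid lies between the indicator of the event and 1.
\<close>

lemma stein_pointwise:
  assumes \<theta>: "0 \<le> \<theta> \<omega>" and w: "\<And>m. 0 \<le> w m" and ab: "a \<le> b" and \<epsilon>: "0 < \<epsilon>"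
  shows "expectation (\<lambda>\<omega>. (W S \<omega>)\<^sup>2) * (\<theta> \<omega> ^ 3 * of_bool (concentrated S w a b \<omega>)) \<le>
     \<theta> \<omega> ^ 3 * \<bar>W S \<omega>\<bar> * ((b - a) / 2 + blur w \<omega> + \<epsilon> / 2) + \<theta> \<omega> ^ 3 * \<bar>fluctuation S \<omega>\<bar>
     + (\<Sum>i\<in>I - N S. remainder S w a b \<epsilon> \<theta> i \<omega> + \<theta> \<omega> ^ 3 * \<bar>X i \<omega>\<bar> * (\<Sum>m\<in>\<A> i. w m * \<bar>X m \<omega>\<bar>) - X i \<omega> * (\<theta> \<omega> ^ 3 * decoupled S w a b \<epsilon> i \<omega>))"
proof -
  let ?T = "I - N S"
  define v where "v = expectation (\<lambda>\<omega>. (W S \<omega>)\<^sup>2)"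
  define h where "h = (b - a) / 2 + blur w \<omega>"
  define y where "y = W S \<omega> - (a + b) / 2"
  define u where "u i = (\<Sum>j\<in>\<A> i \<inter> ?T. X j \<omega>)" for i
  define tr where "tr = trapezoid \<epsilon> h y"
  have v0: "0 \<le> v" unfolding v_def by (rule integral_nonneg_AE) auto
  have bl: "0 \<le> blur w \<omega>" unfolding blur_def using w by (intro sum_nonneg mult_nonneg_nonneg) auto
  have h0: "0 \<le> h" using ab bl by (simp add: h_def)
  have th: "0 \<le> \<theta> \<omega> ^ 3" using \<theta> by simp
  have tr: "0 \<le> tr" "tr \<le> 1" unfolding tr_def by (rule trapezoid_bounds[OF \<epsilon> h0])+
  have tr1: "of_bool (concentrated S w a b \<omega>) \<le> tr"
  proof (cases "concentrated S w a b \<omega>")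
    case True
    then have "\<bar>y\<bar> \<le> h" by (auto simp: concentrated_def y_def h_def abs_le_iff field_simps)
    then show ?thesis using trapezoid_eq_1[OF \<epsilon>] by (simp add: tr_def)
  qed (use tr in simp)
  have summand: "X i \<omega> * u i * tr * \<theta> \<omega> ^ 3 \<le> \<theta> \<omega> ^ 3 * X i \<omega> * stein_fun \<epsilon> h y
      + (remainder S w a b \<epsilon> \<theta> i \<omega> + \<theta> \<omega> ^ 3 * \<bar>X i \<omega>\<bar> * (\<Sum>m\<in>\<A> i. w m * \<bar>X m \<omega>\<bar>) - X i \<omega> * (\<theta> \<omega> ^ 3 * decoupled S w a b \<epsilon> i \<omega>))"
    if i: "i \<in> ?T" for i
  proof -
    have Ai: "\<A> i \<subseteq> I" using A_sub i by auto
    let ?h = "(b - a) / 2 + (\<Sum>m\<in>I - \<A> i. w m * \<bar>X m \<omega>\<bar>)"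
    have hh: "h - ?h = (\<Sum>m\<in>\<A> i. w m * \<bar>X m \<omega>\<bar>)"
      unfolding h_def blur_def using sum_diff[OF finite_I Ai, of "\<lambda>m. w m * \<bar>X m \<omega>\<bar>"] by simp
    have hle: "?h \<le> h" using hh sum_nonneg[of "\<A> i" "\<lambda>m. w m * \<bar>X m \<omega>\<bar>"] w by simp
    have yu: "(\<Sum>j\<in>?T - \<A> i. X j \<omega>) - (a + b) / 2 = y - u i"
    proof -
      have "(\<Sum>j\<in>?T. X j \<omega>) = (\<Sum>j\<in>?T \<inter> \<A> i. X j \<omega>) + (\<Sum>j\<in>?T - \<A> i. X j \<omega>)"
        by (rule sum.Int_Diff) (use finite_I in simp)
      then show ?thesis by (simp add: y_def u_def W_def Int_commute)
    qed
    have decoupled: "decoupled S w a b \<epsilon> i \<omega> = stein_fun \<epsilon> ?h (y - u i)" unfolding decoupled_def yu ..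
    define r where "r = stein_fun \<epsilon> h y - stein_fun \<epsilon> h (y - u i) - u i * tr"
    define d where "d = stein_fun \<epsilon> h (y - u i) - decoupled S w a b \<epsilon> i \<omega>"
    have r: "\<theta> \<omega> ^ 3 * \<bar>X i \<omega>\<bar> * \<bar>r\<bar> \<le> remainder S w a b \<epsilon> \<theta> i \<omega>"
      unfolding r_def tr_def by (rule remainder_taylor[OF i _ \<epsilon> _ w h_def y_def]) (simp_all add: \<theta> u_def)
    have "\<bar>d\<bar> \<le> (\<Sum>m\<in>\<A> i. w m * \<bar>X m \<omega>\<bar>)"
      unfolding d_def decoupled using stein_fun_width[OF \<epsilon> hle, of "y - u i"] hh by simp
    then have d: "\<theta> \<omega> ^ 3 * \<bar>X i \<omega>\<bar> * \<bar>d\<bar> \<le> \<theta> \<omega> ^ 3 * \<bar>X i \<omega>\<bar> * (\<Sum>m\<in>\<A> i. w m * \<bar>X m \<omega>\<bar>)"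
      using th by (intro mult_left_mono) auto
    have "X i \<omega> * u i * tr * \<theta> \<omega> ^ 3 = \<theta> \<omega> ^ 3 * X i \<omega> * stein_fun \<epsilon> h y - X i \<omega> * (\<theta> \<omega> ^ 3 * decoupled S w a b \<epsilon> i \<omega>)
       - \<theta> \<omega> ^ 3 * X i \<omega> * r - \<theta> \<omega> ^ 3 * X i \<omega> * d"
      by (simp add: r_def d_def algebra_simps)
    moreover have "- (\<theta> \<omega> ^ 3 * X i \<omega> * r) \<le> \<theta> \<omega> ^ 3 * \<bar>X i \<omega>\<bar> * \<bar>r\<bar>" "- (\<theta> \<omega> ^ 3 * X i \<omega> * d) \<le> \<theta> \<omega> ^ 3 * \<bar>X i \<omega>\<bar> * \<bar>d\<bar>"
      using abs_ge_minus_self[of "\<theta> \<omega> ^ 3 * X i \<omega> * r"] abs_ge_minus_self[of "\<theta> \<omega> ^ 3 * X i \<omega> * d"] \<theta>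
      by (simp_all add: abs_mult)
    ultimately show ?thesis using r d by linarith
  qed
  have "v * (\<theta> \<omega> ^ 3 * of_bool (concentrated S w a b \<omega>)) \<le> v * (\<theta> \<omega> ^ 3 * tr)"
    using v0 th tr1 by (intro mult_left_mono) auto
  also have "\<dots> = (\<Sum>i\<in>?T. X i \<omega> * u i) * tr * \<theta> \<omega> ^ 3 - \<theta> \<omega> ^ 3 * fluctuation S \<omega> * tr"
    unfolding u_def sum_X_neighbours v_def by (simp add: algebra_simps)
  also have "- (\<theta> \<omega> ^ 3 * fluctuation S \<omega> * tr) \<le> \<theta> \<omega> ^ 3 * \<bar>fluctuation S \<omega>\<bar>"
  proof -
    have "- (\<theta> \<omega> ^ 3 * fluctuation S \<omega> * tr) \<le> \<theta> \<omega> ^ 3 * \<bar>fluctuation S \<omega>\<bar> * tr"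
      using abs_ge_minus_self[of "\<theta> \<omega> ^ 3 * fluctuation S \<omega> * tr"] \<theta> tr by (simp add: abs_mult)
    also have "\<dots> \<le> \<theta> \<omega> ^ 3 * \<bar>fluctuation S \<omega>\<bar> * 1" using th tr by (intro mult_left_mono) auto
    finally show ?thesis by simp
  qed
  then have "(\<Sum>i\<in>?T. X i \<omega> * u i) * tr * \<theta> \<omega> ^ 3 - \<theta> \<omega> ^ 3 * fluctuation S \<omega> * tr \<le>
      (\<Sum>i\<in>?T. X i \<omega> * u i * tr * \<theta> \<omega> ^ 3) + \<theta> \<omega> ^ 3 * \<bar>fluctuation S \<omega>\<bar>"
    by (simp add: sum_distrib_right)
  also have "(\<Sum>i\<in>?T. X i \<omega> * u i * tr * \<theta> \<omega> ^ 3) \<le> (\<Sum>i\<in>?T. \<theta> \<omega> ^ 3 * X i \<omega> * stein_fun \<epsilon> h y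
      + (remainder S w a b \<epsilon> \<theta> i \<omega> + \<theta> \<omega> ^ 3 * \<bar>X i \<omega>\<bar> * (\<Sum>m\<in>\<A> i. w m * \<bar>X m \<omega>\<bar>) - X i \<omega> * (\<theta> \<omega> ^ 3 * decoupled S w a b \<epsilon> i \<omega>)))"
    by (intro sum_mono summand)
  also have "\<dots> = \<theta> \<omega> ^ 3 * W S \<omega> * stein_fun \<epsilon> h y + (\<Sum>i\<in>?T. remainder S w a b \<epsilon> \<theta> i \<omega> + \<theta> \<omega> ^ 3 * \<bar>X i \<omega>\<bar> * (\<Sum>m\<in>\<A> i. w m * \<bar>X m \<omega>\<bar>) - X i \<omega> * (\<theta> \<omega> ^ 3 * decoupled S w a b \<epsilon> i \<omega>))"
    unfolding sum.distrib[of "\<lambda>i. \<theta> \<omega> ^ 3 * X i \<omega> * stein_fun \<epsilon> h y"] by (simp add: W_def sum_distrib_left sum_distrib_right)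
  also have "\<theta> \<omega> ^ 3 * W S \<omega> * stein_fun \<epsilon> h y \<le> \<theta> \<omega> ^ 3 * \<bar>W S \<omega>\<bar> * (h + \<epsilon> / 2)"
  proof -
    have "\<theta> \<omega> ^ 3 * W S \<omega> * stein_fun \<epsilon> h y \<le> \<theta> \<omega> ^ 3 * \<bar>W S \<omega>\<bar> * \<bar>stein_fun \<epsilon> h y\<bar>"
      using abs_ge_self[of "\<theta> \<omega> ^ 3 * W S \<omega> * stein_fun \<epsilon> h y"] \<theta> by (simp add: abs_mult)
    also have "\<dots> \<le> \<theta> \<omega> ^ 3 * \<bar>W S \<omega>\<bar> * (h + \<epsilon> / 2)"
      using th by (intro mult_left_mono stein_fun_bound \<epsilon> h0) auto
    finally show ?thesis .
  qed
  finally show ?thesis by (simp add: v_def h_def)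
qed

text \<open>
  \<open>X i\<close> is centred and independent of \<open>\<theta>\<close> and of all variables outside \<open>\<A> i\<close> together.
\<close>

lemma decoupled_orthogonal:
  assumes w: "weight S \<theta>" and i: "i \<in> I - N S" and v: "\<And>m. 0 \<le> w m" and ab: "a \<le> b" and \<epsilon>: "0 < \<epsilon>"
  shows "integrable M (\<lambda>\<omega>. X i \<omega> * (\<theta> \<omega> ^ 3 * decoupled S w a b \<epsilon> i \<omega>))"
    "expectation (\<lambda>\<omega>. X i \<omega> * (\<theta> \<omega> ^ 3 * decoupled S w a b \<epsilon> i \<omega>)) = 0"
proof -
  note wD = weightD[OF w]
  have iI: "i \<in> I" using i by simp
  let ?R = "I - \<A> i"
  let ?h = "\<lambda>\<omega>. (b - a) / 2 + (\<Sum>m\<in>?R. w m * \<bar>X m \<omega>\<bar>)"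
  have [measurable]: "\<theta> \<in> borel_measurable (F ?R)" by (rule F_mono_measurable[OF away_sub[OF i wD(1)] _ wD(2)]) auto
  have XR: "X j \<in> borel_measurable (F ?R)" if "j \<in> ?R" for j using that by (intro X_F_mono) auto
  have [measurable]: "decoupled S w a b \<epsilon> i \<in> borel_measurable (F ?R)"
    unfolding decoupled_def[abs_def]
    by (intro stein_fun_measurable borel_measurable_add borel_measurable_diff borel_measurable_sum
        borel_measurable_times borel_measurable_abs borel_measurable_const XR) auto
  have m: "(\<lambda>\<omega>. \<theta> \<omega> ^ 3 * decoupled S w a b \<epsilon> i \<omega>) \<in> borel_measurable (F ?R)" by measurable
  have int: "integrable M (\<lambda>\<omega>. \<theta> \<omega> ^ 3 * decoupled S w a b \<epsilon> i \<omega>)"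
  proof (rule Bochner_Integration.integrable_bound)
    show "integrable M (\<lambda>\<omega>. ((b - a) / 2 + \<epsilon> / 2) * \<theta> \<omega> ^ 3 + (\<Sum>m\<in>?R. w m * (\<theta> \<omega> ^ 3 * \<bar>X m \<omega>\<bar>)))"
      using weight_cube[OF w] by (intro Bochner_Integration.integrable_add integrable_mult_right Bochner_Integration.integrable_sum) auto
    show "(\<lambda>\<omega>. \<theta> \<omega> ^ 3 * decoupled S w a b \<epsilon> i \<omega>) \<in> borel_measurable M" by (rule F_measurable_M[OF _ m]) auto
    show "AE \<omega> in M. norm (\<theta> \<omega> ^ 3 * decoupled S w a b \<epsilon> i \<omega>) \<le>
        norm (((b - a) / 2 + \<epsilon> / 2) * \<theta> \<omega> ^ 3 + (\<Sum>m\<in>?R. w m * (\<theta> \<omega> ^ 3 * \<bar>X m \<omega>\<bar>)))"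
    proof (rule AE_I2)
      fix \<omega>
      have h0: "0 \<le> ?h \<omega>" using ab v by (intro add_nonneg_nonneg sum_nonneg) auto
      have "\<bar>\<theta> \<omega> ^ 3 * decoupled S w a b \<epsilon> i \<omega>\<bar> = \<theta> \<omega> ^ 3 * \<bar>decoupled S w a b \<epsilon> i \<omega>\<bar>"
        using wD(3)[of \<omega>] by (simp add: abs_mult)
      also have "\<dots> \<le> \<theta> \<omega> ^ 3 * (?h \<omega> + \<epsilon> / 2)"
        unfolding decoupled_def by (intro mult_left_mono stein_fun_bound[OF \<epsilon> h0]) (use wD(3)[of \<omega>] in simp)
      also have "\<dots> = ((b - a) / 2 + \<epsilon> / 2) * \<theta> \<omega> ^ 3 + (\<Sum>m\<in>?R. w m * (\<theta> \<omega> ^ 3 * \<bar>X m \<omega>\<bar>))"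
        by (simp add: algebra_simps sum_distrib_left)
      finally show "norm (\<theta> \<omega> ^ 3 * decoupled S w a b \<epsilon> i \<omega>) \<le>
        norm (((b - a) / 2 + \<epsilon> / 2) * \<theta> \<omega> ^ 3 + (\<Sum>m\<in>?R. w m * (\<theta> \<omega> ^ 3 * \<bar>X m \<omega>\<bar>)))"
        by simp
    qed
  qed
  note * = indep1_mult[OF iI order_refl X_F[OF iI] m X_integrable[OF iI] int]
  show "integrable M (\<lambda>\<omega>. X i \<omega> * (\<theta> \<omega> ^ 3 * decoupled S w a b \<epsilon> i \<omega>))" by (rule *(1))
  show "expectation (\<lambda>\<omega>. X i \<omega> * (\<theta> \<omega> ^ 3 * decoupled S w a b \<epsilon> i \<omega>)) = 0" using *(2) X_centred[OF iI] by simp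
qed

text \<open>
  Here \<open>m \<in> \<A> i\<close> is read as \<open>i \<in> N {m}\<close>.
\<close>

lemma sum_neighbours_d3:
  assumes v: "\<And>m. 0 \<le> w m"
  shows "(\<Sum>i\<in>I - N S. \<Sum>m\<in>\<A> i. w m * (x i * x m)) \<le> d3 w"
proof -
  have "(\<Sum>i\<in>I - N S. \<Sum>m\<in>\<A> i. w m * (x i * x m)) \<le> (\<Sum>i\<in>I. \<Sum>m\<in>\<A> i. w m * (x i * x m))"
    by (rule sum_mono2[OF finite_I]) (use v in \<open>auto intro!: sum_nonneg mult_nonneg_nonneg\<close>)
  also have "\<dots> = (\<Sum>i\<in>I. \<Sum>m | m \<in> I \<and> m \<in> \<A> i. w m * (x i * x m))"
    by (intro sum.cong refl) (use A_sub in blast)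
  also have "\<dots> = (\<Sum>m\<in>I. \<Sum>i | i \<in> I \<and> m \<in> \<A> i. w m * (x i * x m))"
    by (rule sum.swap_restrict[OF finite_I finite_I])
  also have "\<dots> = d3 w" unfolding d3_def by (intro sum.cong refl) (auto simp: N_def)
  finally show ?thesis .
qed

text \<open>
  The expectation of the pointwise identity. The decoupled terms vanish, the remainder is bounded by
  the assumed inequality with constant \<open>\<kappa>\<close>, and \<open>t\<close> bounds \<open>W\<close> in \<open>L\<^sup>2\<close> relative to the density \<open>\<theta>\<^sup>4\<close>.
\<close>

lemma stein_inequality:
  assumes \<kappa>: "concentration_bound \<kappa>" "0 \<le> \<kappa>" and w: "weight S \<theta>" and v: "\<And>m. 0 \<le> w m" and ab: "a \<le> b" and \<epsilon>: "0 < \<epsilon>"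
    and t: "expectation (\<lambda>\<omega>. (W S \<omega>)\<^sup>2) + 2 * d4 S \<le> t\<^sup>2" "0 \<le> t"
  shows "expectation (\<lambda>\<omega>. (W S \<omega>)\<^sup>2) * expectation (\<lambda>\<omega>. \<theta> \<omega> ^ 3 * of_bool (concentrated S w a b \<omega>)) \<le>
    t * ((b - a) / 2 + \<epsilon> / 2 + d2 w) + (2 * d4 S + sqrt (2 * d6a))
    + (\<kappa> / \<epsilon> * ((\<epsilon> / 100 + rest S w) * d5 + 2 * d6bc + d7sq) + d3 w)"
proof -
  note wD = weightD[OF w]
  let ?T = "I - N S"
  have tW: "expectation (\<lambda>\<omega>. \<theta> \<omega> ^ 4 * (W S \<omega>)\<^sup>2) \<le> t\<^sup>2"
    using weight_W_square(2)[OF w] t by simp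
  note WH = weight_Hoelder[OF w W_M weight_W_square(1)[OF w] tW t(2)]
  define f1 where "f1 \<omega> = \<theta> \<omega> ^ 3 * \<bar>W S \<omega>\<bar> * ((b - a) / 2 + blur w \<omega> + \<epsilon> / 2)" for \<omega>
  define f2 where "f2 \<omega> = \<theta> \<omega> ^ 3 * \<bar>fluctuation S \<omega>\<bar>" for \<omega>
  define g where "g i \<omega> = \<theta> \<omega> ^ 3 * \<bar>X i \<omega>\<bar> * (\<Sum>m\<in>\<A> i. w m * \<bar>X m \<omega>\<bar>)" for i \<omega>
  define r where "r i \<omega> = remainder S w a b \<epsilon> \<theta> i \<omega>" for i \<omega>
  define f where "f i \<omega> = X i \<omega> * (\<theta> \<omega> ^ 3 * decoupled S w a b \<epsilon> i \<omega>)" for i \<omega>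
  define K where "K i = \<kappa> / \<epsilon> *
      ((card (\<A> i))\<^sup>2 * (x i ^ 3 * (\<epsilon> / 100 + rest S w + increment (\<A> i \<union> N {i}) i))
       + (\<Sum>j\<in>\<A> i. card (\<A> i) * (x j ^ 3 * (\<epsilon> / 100 + rest S w + increment (\<A> i \<union> N {j}) j))))" for i
  have F1: "integrable M f1" "expectation f1 \<le> t * ((b - a) / 2 + \<epsilon> / 2 + d2 w)"
  proof -
    have e: "f1 = (\<lambda>\<omega>. ((b - a) / 2 + \<epsilon> / 2) * (\<theta> \<omega> ^ 3 * \<bar>W S \<omega>\<bar>) + (\<Sum>m\<in>I. w m * (\<theta> \<omega> ^ 3 * \<bar>W S \<omega>\<bar> * \<bar>X m \<omega>\<bar>)))"
      by (rule ext) (simp add: f1_def blur_def algebra_simps sum_distrib_left)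
    have s: "integrable M (\<lambda>\<omega>. \<Sum>m\<in>I. w m * (\<theta> \<omega> ^ 3 * \<bar>W S \<omega>\<bar> * \<bar>X m \<omega>\<bar>))"
      by (intro Bochner_Integration.integrable_sum integrable_mult_right WH(3))
    show "integrable M f1" unfolding e using WH(1) s by simp
    have "expectation f1 = ((b - a) / 2 + \<epsilon> / 2) * expectation (\<lambda>\<omega>. \<theta> \<omega> ^ 3 * \<bar>W S \<omega>\<bar>)
        + (\<Sum>m\<in>I. w m * expectation (\<lambda>\<omega>. \<theta> \<omega> ^ 3 * \<bar>W S \<omega>\<bar> * \<bar>X m \<omega>\<bar>))"
    proof -
      have "expectation (\<lambda>\<omega>. \<Sum>m\<in>I. w m * (\<theta> \<omega> ^ 3 * \<bar>W S \<omega>\<bar> * \<bar>X m \<omega>\<bar>)) =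
        (\<Sum>m\<in>I. expectation (\<lambda>\<omega>. w m * (\<theta> \<omega> ^ 3 * \<bar>W S \<omega>\<bar> * \<bar>X m \<omega>\<bar>)))"
        by (intro Bochner_Integration.integral_sum integrable_mult_right WH(3))
      then show ?thesis unfolding e using WH(1) s by simp
    qed
    also have "\<dots> \<le> ((b - a) / 2 + \<epsilon> / 2) * t + (\<Sum>m\<in>I. w m * (t * x m))"
      using ab \<epsilon> v by (intro add_mono mult_left_mono sum_mono WH(2,4)) auto
    also have "\<dots> = t * ((b - a) / 2 + \<epsilon> / 2 + d2 w)"
      by (simp add: d2_def algebra_simps sum_distrib_left)
    finally show "expectation f1 \<le> t * ((b - a) / 2 + \<epsilon> / 2 + d2 w)" .
  qed
  have F2: "integrable M f2" "expectation f2 \<le> 2 * d4 S + sqrt (2 * d6a)"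
    unfolding f2_def[abs_def] by (rule weight_fluctuation[OF w])+
  have G: "integrable M (g i)" "expectation (g i) \<le> (\<Sum>m\<in>\<A> i. w m * (x i * x m))" if i: "i \<in> ?T" for i
  proof -
    have mI: "m \<in> I" if "m \<in> \<A> i" for m using A_sub i that by auto
    have e: "g i = (\<lambda>\<omega>. \<Sum>m\<in>\<A> i. w m * (\<theta> \<omega> ^ 3 * \<bar>X i \<omega>\<bar> * \<bar>X m \<omega>\<bar>))"
      by (rule ext) (simp add: g_def sum_distrib_left mult_ac)
    show "integrable M (g i)" unfolding e
      by (intro Bochner_Integration.integrable_sum integrable_mult_right weight_cube_X[OF w i] mI)
    have "expectation (g i) = (\<Sum>m\<in>\<A> i. expectation (\<lambda>\<omega>. w m * (\<theta> \<omega> ^ 3 * \<bar>X i \<omega>\<bar> * \<bar>X m \<omega>\<bar>)))"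
      unfolding e by (intro Bochner_Integration.integral_sum integrable_mult_right weight_cube_X[OF w i] mI)
    also have "\<dots> = (\<Sum>m\<in>\<A> i. w m * expectation (\<lambda>\<omega>. \<theta> \<omega> ^ 3 * \<bar>X i \<omega>\<bar> * \<bar>X m \<omega>\<bar>))" by simp
    also have "\<dots> \<le> (\<Sum>m\<in>\<A> i. w m * (x i * x m))"
      by (intro sum_mono mult_left_mono weight_cube_X[OF w i] mI v)
    finally show "expectation (g i) \<le> (\<Sum>m\<in>\<A> i. w m * (x i * x m))" .
  qed
  have R: "integrable M (r i)" "expectation (r i) \<le> K i" if i: "i \<in> ?T" for i
    unfolding r_def[abs_def] K_def using remainder_bound[where w = w, OF \<kappa> w i v \<epsilon>] by auto
  have Fo: "integrable M (f i)" "expectation (f i) = 0" if i: "i \<in> ?T" for i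
    unfolding f_def[abs_def] using decoupled_orthogonal[where w = w, OF w i v ab \<epsilon>] by auto
  have S: "integrable M (\<lambda>\<omega>. \<Sum>i\<in>?T. r i \<omega> + g i \<omega> - f i \<omega>)"
    by (intro Bochner_Integration.integrable_sum Bochner_Integration.integrable_diff Bochner_Integration.integrable_add G R Fo)
  have "expectation (\<lambda>\<omega>. (W S \<omega>)\<^sup>2) * expectation (\<lambda>\<omega>. \<theta> \<omega> ^ 3 * of_bool (concentrated S w a b \<omega>))
     = expectation (\<lambda>\<omega>. expectation (\<lambda>\<omega>. (W S \<omega>)\<^sup>2) * (\<theta> \<omega> ^ 3 * of_bool (concentrated S w a b \<omega>)))" by simp
  also have "\<dots> \<le> expectation (\<lambda>\<omega>. f1 \<omega> + f2 \<omega> + (\<Sum>i\<in>?T. r i \<omega> + g i \<omega> - f i \<omega>))"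
    unfolding f1_def f2_def r_def g_def f_def
    by (intro integral_mono integrable_mult_right concentrated_integrable[OF w] Bochner_Integration.integrable_add
        S[unfolded r_def g_def f_def] F1(1)[unfolded f1_def[abs_def]] F2(1)[unfolded f2_def[abs_def]]
        stein_pointwise wD(3) v ab \<epsilon>)
  also have "\<dots> = expectation f1 + expectation f2 + (\<Sum>i\<in>?T. expectation (\<lambda>\<omega>. r i \<omega> + g i \<omega> - f i \<omega>))"
  proof -
    have "expectation (\<lambda>\<omega>. \<Sum>i\<in>?T. r i \<omega> + g i \<omega> - f i \<omega>) = (\<Sum>i\<in>?T. expectation (\<lambda>\<omega>. r i \<omega> + g i \<omega> - f i \<omega>))"
      by (intro Bochner_Integration.integral_sum Bochner_Integration.integrable_diff Bochner_Integration.integrable_add G R Fo)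
    then show ?thesis using F1(1) F2(1) S by simp
  qed
  also have "(\<Sum>i\<in>?T. expectation (\<lambda>\<omega>. r i \<omega> + g i \<omega> - f i \<omega>)) \<le> (\<Sum>i\<in>?T. K i + (\<Sum>m\<in>\<A> i. w m * (x i * x m)))"
  proof (rule sum_mono)
    fix i assume i: "i \<in> ?T"
    have "expectation (\<lambda>\<omega>. r i \<omega> + g i \<omega> - f i \<omega>) = expectation (r i) + expectation (g i)"
      using G(1)[OF i] R(1)[OF i] Fo[OF i] by simp
    then show "expectation (\<lambda>\<omega>. r i \<omega> + g i \<omega> - f i \<omega>) \<le> K i + (\<Sum>m\<in>\<A> i. w m * (x i * x m))"
      using G(2)[OF i] R(2)[OF i] by simp
  qed
  also have "\<dots> = (\<Sum>i\<in>?T. K i) + (\<Sum>i\<in>?T. \<Sum>m\<in>\<A> i. w m * (x i * x m))" by (rule sum.distrib)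
  also have "(\<Sum>i\<in>?T. K i) \<le> (\<Sum>i\<in>I. K i)"
  proof (rule sum_mono2[OF finite_I])
    fix i
    show "0 \<le> K i" unfolding K_def using \<kappa> \<epsilon> rest_nonneg[of w S] v
      by (intro mult_nonneg_nonneg add_nonneg_nonneg sum_nonneg increment_nonneg) auto
  qed auto
  also have "(\<Sum>i\<in>I. K i) \<le> \<kappa> / \<epsilon> * ((\<epsilon> / 100 + rest S w) * d5 + 2 * d6bc + d7sq)"
    unfolding K_def sum_distrib_left[of "\<kappa> / \<epsilon>", symmetric] using \<kappa> \<epsilon> sum_increment_le[of "\<epsilon> / 100 + rest S w"]
    by (intro mult_left_mono) auto
  finally show ?thesis using F1(2) F2(2) sum_neighbours_d3[where w = w and S = S, OF v] by linarith
qed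

section \<open>Self-improvement of the constant\<close>

text \<open>
  If \<open>d5 = 0\<close>, then each \<open>X i\<close> has \<open>x i = 0\<close> or an empty set \<open>\<A> i\<close>. In the latter case \<open>X i\<close> is
  independent of itself. Either way it vanishes almost surely, against the unit variance.
\<close>

lemma d5_pos: "0 < d5"
proof (rule ccontr)
  assume "\<not> 0 < d5"
  then have d5: "d5 = 0" using d2_d7_nonneg(3) by simp
  have nn: "0 \<le> (\<Sum>i\<in>I. (card (\<A> i))\<^sup>2 * x i ^ 3)" "0 \<le> (\<Sum>i\<in>I. \<Sum>j\<in>\<A> i. card (\<A> i) * x j ^ 3)"
    by (auto intro!: sum_nonneg)
  with d5 have "(\<Sum>i\<in>I. (card (\<A> i))\<^sup>2 * x i ^ 3) = 0" unfolding d5_def by linarith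
  then have 0: "(card (\<A> i))\<^sup>2 * x i ^ 3 = 0" if "i \<in> I" for i
    using that finite_I by (subst (asm) sum_nonneg_eq_0_iff) auto
  have "AE \<omega> in M. X i \<omega> = 0" if i: "i \<in> I" for i
  proof -
    have "expectation (\<lambda>\<omega>. (X i \<omega>)\<^sup>2) = 0"
    proof (cases "x i = 0")
      case True
      have "0 \<le> expectation (\<lambda>\<omega>. (X i \<omega>)\<^sup>2)" by (rule integral_nonneg_AE) auto
      with X_square(2)[OF i] True show ?thesis by simp
    next
      case False
      then have "\<A> i = {}" using 0[OF i] finite_A[OF i] by simp
      with X_uncorrelated[of i i] i show ?thesis by (simp add: power2_eq_square)
    qed
    then show ?thesis
      using integral_nonneg_eq_0_iff_AE[OF X_square(1)[OF i]] by simp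
  qed
  then have "AE \<omega> in M. \<forall>i\<in>I. X i \<omega> = 0" using finite_I by (simp add: AE_finite_all)
  then have "AE \<omega> in M. (\<Sum>i\<in>I. X i \<omega>)\<^sup>2 = 0" by eventually_elim simp
  then have "expectation (\<lambda>\<omega>. (\<Sum>i\<in>I. X i \<omega>)\<^sup>2) = expectation (\<lambda>_. 0)"
    by (intro integral_cong_AE) auto
  then show False using unit_variance by simp
qed

lemma concentrated_le_1:
  assumes w: "weight S \<theta>"
  shows "expectation (\<lambda>\<omega>. \<theta> \<omega> ^ 3 * of_bool (concentrated S v a b \<omega>)) \<le> 1"
proof -
  have "expectation (\<lambda>\<omega>. \<theta> \<omega> ^ 3 * of_bool (concentrated S v a b \<omega>)) \<le> expectation (\<lambda>\<omega>. \<theta> \<omega> ^ 3)"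
    by (rule integral_mono[OF concentrated_integrable[OF w] weight_cube(1)[OF w]]) (use weightD(3)[OF w] in \<open>simp add: of_bool_def\<close>)
  with weight_cube(2)[OF w] show ?thesis by simp
qed

lemma concentration_bound_trivial: "concentration_bound (1 / d5)"
  unfolding concentration_bound_def
proof (intro allI impI)
  fix S \<theta> and w :: "'i \<Rightarrow> real" and a b :: real
  assume w: "weight S \<theta>" and v: "\<forall>m. 0 \<le> w m" and ab: "a \<le> b"
  have "d5 \<le> (b - a) / 100 + rest S w"
    unfolding rest_def using ab d1_d4_d6a_nonneg(1,2)[of S] d2_d7_nonneg(1,2)[of w] d2_d7_nonneg(3-) v by simp
  then have "1 \<le> 1 / d5 * ((b - a) / 100 + rest S w)" using d5_pos by (simp add: field_simps)
  with concentrated_le_1[OF w] show "expectation (\<lambda>\<omega>. \<theta> \<omega> ^ 3 * of_bool (concentrated S w a b \<omega>)) \<le> 1 / d5 * ((b - a) / 100 + rest S w)"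
    by (rule order_trans)
qed

lemma concentration_bound_mono:
  assumes "concentration_bound \<kappa>" "\<kappa> \<le> \<kappa>'"
  shows "concentration_bound \<kappa>'"
  unfolding concentration_bound_def
proof (intro allI impI)
  fix S \<theta> and w :: "'i \<Rightarrow> real" and a b :: real
  assume w: "weight S \<theta>" and v: "\<forall>m. 0 \<le> w m" and ab: "a \<le> b"
  have "\<kappa> * ((b - a) / 100 + rest S w) \<le> \<kappa>' * ((b - a) / 100 + rest S w)"
    using ab rest_nonneg[of w S] v assms(2) by (intro mult_right_mono) auto
  moreover have "expectation (\<lambda>\<omega>. \<theta> \<omega> ^ 3 * of_bool (concentrated S w a b \<omega>)) \<le> \<kappa> * ((b - a) / 100 + rest S w)"
    using assms(1) w v ab unfolding concentration_bound_def by blast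
  ultimately show "expectation (\<lambda>\<omega>. \<theta> \<omega> ^ 3 * of_bool (concentrated S w a b \<omega>)) \<le> \<kappa>' * ((b - a) / 100 + rest S w)"
    by linarith
qed

text \<open>
  The claim is trivial unless the right-hand side is below 1, so all terms may be assumed to be less
  than \<open>1 / 156\<close>; then \<open>E W\<^sup>2 \<ge> 98/100\<close>, and \<open>t = 11/10\<close> is admissible in the Stein inequality. With
  \<open>\<epsilon> = 20 p\<close> for \<open>p = d5 + d6 + d7\<close> that inequality reads \<open>98/100 E \<le> (55 + 11/100 \<kappa>) \<Delta>\<close>, where \<open>E\<close> is
  the left-hand side and \<open>\<Delta>\<close> the total bound. As \<open>55 \<le> 55/156 \<kappa>\<close>, this gives \<open>E \<le> 3/5 \<kappa> \<Delta>\<close>.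
\<close>

lemma concentration_bound_improve:
  assumes \<kappa>: "concentration_bound \<kappa>" "156 \<le> \<kappa>"
  shows "concentration_bound (max 156 (3 / 5 * \<kappa>))"
  unfolding concentration_bound_def
proof (intro allI impI)
  fix S \<theta> and w :: "'i \<Rightarrow> real" and a b :: real
  assume w: "weight S \<theta>" and v: "\<forall>m. 0 \<le> w m" and ab: "a \<le> b"
  let ?E = "expectation (\<lambda>\<omega>. \<theta> \<omega> ^ 3 * of_bool (concentrated S w a b \<omega>))"
  let ?v = "expectation (\<lambda>\<omega>. (W S \<omega>)\<^sup>2)"
  define \<Delta> where "\<Delta> = (b - a) / 100 + rest S w"
  have nn: "0 \<le> d1 S" "0 \<le> d2 w" "0 \<le> d3 w" "0 \<le> d4 S" "0 \<le> d6" "0 \<le> d7"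
    using d1_d4_d6a_nonneg d2_d7_nonneg v by auto
  have \<Delta>0: "0 \<le> \<Delta>" using ab rest_nonneg[of w S] v by (simp add: \<Delta>_def)
  have E0: "0 \<le> ?E" by (rule integral_nonneg_AE) (use weightD(3)[OF w] in auto)
  have "?E \<le> max 156 (3 / 5 * \<kappa>) * \<Delta>"
  proof (cases "1 / 156 \<le> \<Delta>")
    case True
    then have "1 \<le> 156 * \<Delta>" by simp
    also have "\<dots> \<le> max 156 (3 / 5 * \<kappa>) * \<Delta>" using \<Delta>0 by (intro mult_right_mono) auto
    finally show ?thesis using concentrated_le_1[OF w, of w a b] by linarith
  next
    case False
    define p where "p = d5 + d6 + d7"
    have p: "0 < p" using d5_pos nn by (simp add: p_def)
    define q where "q = d1 S + d2 w + d3 w + d4 S"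
    have q: "0 \<le> q" using nn by (simp add: q_def)
    have R: "rest S w = q + p" by (simp add: rest_def p_def q_def)
    have small: "d1 S \<le> 1 / 156" "d4 S \<le> 1 / 156"
    proof -
      have "\<Delta> < 1 / 156" using False by simp
      moreover have "q \<le> \<Delta>" using ab p by (simp add: \<Delta>_def R)
      moreover have "d1 S \<le> q" "d4 S \<le> q" using nn by (simp_all add: q_def)
      ultimately show "d1 S \<le> 1 / 156" "d4 S \<le> 1 / 156" by linarith+
    qed
    have v_low: "98 / 100 \<le> ?v" using W_variance(1)[of S] small by linarith
    have "(1 + d1 S)\<^sup>2 \<le> (1 + 1 / 156)\<^sup>2" using nn small by (intro power_mono) auto
    with W_variance(2)[of S] small have t: "?v + 2 * d4 S \<le> (11 / 10)\<^sup>2"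
      by (simp add: power2_eq_square)
    have "98 / 100 * ?E \<le> ?v * ?E" using v_low E0 by (rule mult_right_mono)
    also have "\<dots> \<le> 11 / 10 * ((b - a) / 2 + 20 * p / 2 + d2 w) + (2 * d4 S + sqrt (2 * d6a))
      + (\<kappa> / (20 * p) * ((20 * p / 100 + rest S w) * d5 + 2 * d6bc + d7sq) + d3 w)"
      by (rule stein_inequality[where w = w, OF \<kappa>(1) _ w _ ab _ t]) (use \<kappa>(2) p v in auto)
    also have "sqrt (2 * d6a) \<le> 2 * d6"
    proof -
      have "sqrt (2 * d6a) \<le> sqrt (4 * (d6a + d6bc))" using d1_d4_d6a_nonneg d2_d7_nonneg by (intro real_sqrt_le_mono) simp
      also have "\<dots> = 2 * d6" unfolding d6_def real_sqrt_mult[of 4] by simp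
      finally show ?thesis .
    qed
    also have "\<kappa> / (20 * p) * ((20 * p / 100 + rest S w) * d5 + 2 * d6bc + d7sq) \<le> \<kappa> * (11 / 100 * p + q / 20)"
    proof -
      have sq: "d6bc \<le> d6\<^sup>2" "d7sq = d7\<^sup>2" using d1_d4_d6a_nonneg d2_d7_nonneg by (auto simp: d6_def d7_def)
      \<comment> \<open>the contribution of the part p of the total bound, including the increments\<close>
      have "p * d5 + 2 * d6\<^sup>2 + d7\<^sup>2 \<le> 2 * p\<^sup>2"
        using nn d5_pos by (auto simp: p_def power2_eq_square algebra_simps intro!: add_nonneg_nonneg mult_nonneg_nonneg)
      moreover have "20 * p / 100 * d5 \<le> 20 * p / 100 * p" "q * d5 \<le> q * p"
        using nn p q by (auto intro!: mult_left_mono simp: p_def)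
      ultimately have "(20 * p / 100 + rest S w) * d5 + 2 * d6bc + d7sq \<le> 11 / 5 * p\<^sup>2 + q * p"
        using sq unfolding R by (simp add: power2_eq_square algebra_simps)
      then have "\<kappa> / (20 * p) * ((20 * p / 100 + rest S w) * d5 + 2 * d6bc + d7sq) \<le> \<kappa> / (20 * p) * (11 / 5 * p\<^sup>2 + q * p)"
        using \<kappa> p by (intro mult_left_mono) auto
      also have "\<dots> = \<kappa> * (11 / 100 * p + q / 20)" using p by (simp add: power2_eq_square field_simps)
      finally show ?thesis .
    qed
    finally have main: "98 / 100 * ?E \<le> 11 / 10 * ((b - a) / 2 + 20 * p / 2 + d2 w) + (2 * d4 S + 2 * d6) + (\<kappa> * (11 / 100 * p + q / 20) + d3 w)"
      by simp
    have "11 / 10 * ((b - a) / 2 + 20 * p / 2 + d2 w) + (2 * d4 S + 2 * d6) + d3 w \<le> 55 * \<Delta>"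
      using nn d5_pos unfolding \<Delta>_def R q_def p_def by (simp add: field_simps)
    moreover have "\<kappa> * (11 / 100 * p + q / 20) \<le> \<kappa> * (11 / 100 * \<Delta>)"
      using \<kappa> q p ab by (intro mult_left_mono) (auto simp: \<Delta>_def R)
    moreover have "55 * \<Delta> \<le> 55 / 156 * \<kappa> * \<Delta>" using \<kappa> \<Delta>0 by (intro mult_right_mono) auto
    moreover have "0 \<le> \<kappa> * \<Delta>" using \<kappa> \<Delta>0 by simp
    ultimately have "?E \<le> 3 / 5 * (\<kappa> * \<Delta>)" using main by (simp add: field_simps)
    also have "\<dots> \<le> max 156 (3 / 5 * \<kappa>) * \<Delta>"
      unfolding mult.assoc[symmetric] by (rule mult_right_mono[OF max.cobounded2 \<Delta>0])
    finally show ?thesis .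
  qed
  then show "?E \<le> max 156 (3 / 5 * \<kappa>) * ((b - a) / 100 + rest S w)" by (simp add: \<Delta>_def)
qed

text \<open>
  The factor \<open>3/5\<close> brings every initial constant below 156 after finitely many steps.
\<close>

lemma concentration_bound_156: "concentration_bound 156"
proof -
  define \<kappa>\<^sub>0 where "\<kappa>\<^sub>0 = max 156 (1 / d5)"
  have "concentration_bound (max 156 ((3 / 5) ^ k * \<kappa>\<^sub>0))" for k
  proof (induction k)
    case 0
    show ?case by (rule concentration_bound_mono[OF concentration_bound_trivial]) (simp add: \<kappa>\<^sub>0_def)
  next
    case (Suc k)
    have "concentration_bound (max 156 (3 / 5 * max 156 ((3 / 5) ^ k * \<kappa>\<^sub>0)))"
      by (rule concentration_bound_improve[OF Suc]) simp
    moreover have "max 156 (3 / 5 * max 156 ((3 / 5) ^ k * \<kappa>\<^sub>0)) = max 156 ((3 / 5) ^ Suc k * \<kappa>\<^sub>0)"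
      by (auto simp: max_def mult_ac)
    ultimately show ?case by simp
  qed
  moreover have pos: "0 < \<kappa>\<^sub>0" by (simp add: \<kappa>\<^sub>0_def less_max_iff_disj)
  then obtain k where "(3 / 5 :: real) ^ k < 156 / \<kappa>\<^sub>0"
    using real_arch_pow_inv[of "156 / \<kappa>\<^sub>0" "3 / 5"] by auto
  then have "max 156 ((3 / 5) ^ k * \<kappa>\<^sub>0) = 156" using pos by (simp add: max_def field_simps)
  ultimately show ?thesis by metis
qed

end

section \<open>Comparison with the unnormalized terms\<close>

lemma ennreal_le_scaled:
  fixes Z :: ennreal
  assumes "0 < \<sigma>" "1 \<le> c" "ennreal \<sigma> ^ k * Z \<le> Y"
  shows "Z \<le> ennreal (c / \<sigma> ^ k) * Y"
proof -
  have "ennreal (c / \<sigma> ^ k) * ennreal \<sigma> ^ k = ennreal c"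
    using assms(1,2) by (simp add: ennreal_power flip: ennreal_mult)
  moreover have "1 \<le> ennreal c" using assms(2) by simp
  then have "1 * Z \<le> ennreal c * Z" by (rule mult_right_mono) simp
  ultimately have "Z \<le> ennreal (c / \<sigma> ^ k) * (ennreal \<sigma> ^ k * Z)" by (simp add: mult.assoc[symmetric])
  also have "\<dots> \<le> ennreal (c / \<sigma> ^ k) * Y" using assms(3) by (rule mult_left_mono) simp
  finally show ?thesis .
qed

lemma ennreal_sqrt_le:
  assumes "0 \<le> d" "ennreal d \<le> \<delta>\<^sup>2"
  shows "ennreal (sqrt d) \<le> \<delta>"
proof (cases \<delta>)
  case (real r)
  then have "d \<le> r\<^sup>2" using assms by (simp add: ennreal_power)
  then have "sqrt d \<le> r" using real by (simp add: real_le_lsqrt)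
  then show ?thesis using real by (simp add: ennreal_leI)
qed simp

context locally_dependent begin

text \<open>
  Here \<open>y i\<close> stands for the norm of the original variable \<open>\<sigma> X i\<close>, possibly infinite. An inequality in
  place of an equality lets \<open>y\<close> be arbitrary outside \<open>I\<close>. Each term is homogeneous in \<open>\<sigma>\<close>, so the
  powers of \<open>\<sigma>\<close> cancel, and the factor \<open>c \<ge> 1\<close> may be discarded.
\<close>

context
  fixes \<sigma> c :: real and y :: "'i \<Rightarrow> ennreal"
  assumes \<sigma>: "0 < \<sigma>" and c: "1 \<le> c" and y: "\<And>i. ennreal \<sigma> * ennreal (x i) \<le> y i"
begin

lemma d1_le: "ennreal (d1 S) \<le> ennreal (c / \<sigma>) * (\<Sum>i\<in>N S. y i)"
proof -
  have "ennreal \<sigma> ^ 1 * (\<Sum>i\<in>N S. ennreal (x i)) \<le> (\<Sum>i\<in>N S. y i)"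
    unfolding sum_distrib_left power_one_right by (intro sum_mono y)
  from ennreal_le_scaled[OF \<sigma> c this] show ?thesis by (simp add: d1_def)
qed

lemma d2_le:
  assumes B: "B \<subseteq> I"
  shows "ennreal (d2 (\<lambda>m. c * of_bool (m \<in> B))) \<le> ennreal (c / \<sigma>) * (\<Sum>m\<in>B. y m)"
proof -
  have "d2 (\<lambda>m. c * of_bool (m \<in> B)) = c * (\<Sum>m\<in>B. x m)"
    using sum_add_of_bool[OF B, of "\<lambda>_. 0" x] by (simp add: d2_def mult.assoc flip: sum_distrib_left)
  also have "ennreal \<dots> = ennreal (c / \<sigma>) * (ennreal \<sigma> * (\<Sum>m\<in>B. ennreal (x m)))"
    using \<sigma> c by (simp add: sum_nonneg flip: ennreal_mult mult.assoc)
  also have "\<dots> \<le> ennreal (c / \<sigma>) * (\<Sum>m\<in>B. y m)"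
    unfolding sum_distrib_left[of "ennreal \<sigma>"] by (intro mult_left_mono sum_mono y) simp
  finally show ?thesis .
qed

lemma scaled_xx: "ennreal \<sigma> ^ 2 * (ennreal (x i) * ennreal (x j)) \<le> y i * y j"
proof -
  have "ennreal \<sigma> ^ 2 * (ennreal (x i) * ennreal (x j)) = (ennreal \<sigma> * ennreal (x i)) * (ennreal \<sigma> * ennreal (x j))"
    by (simp add: power2_eq_square mult_ac)
  also have "\<dots> \<le> y i * y j" by (intro mult_mono y) auto
  finally show ?thesis .
qed

lemma scaled_x3: "ennreal \<sigma> ^ 3 * ennreal (x i) ^ 3 \<le> y i ^ 3"
  unfolding power_mult_distrib[symmetric] by (intro power_mono y) auto

lemma d3_le:
  assumes B: "B \<subseteq> I"
  shows "ennreal (d3 (\<lambda>m. c * of_bool (m \<in> B))) \<le> ennreal (c / \<sigma> ^ 2) * (\<Sum>m\<in>B. \<Sum>k\<in>N {m}. y k * y m)"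
proof -
  have "d3 (\<lambda>m. c * of_bool (m \<in> B)) = c * (\<Sum>m\<in>B. \<Sum>k\<in>N {m}. x k * x m)"
    using sum_add_of_bool[OF B, of "\<lambda>_. 0" "\<lambda>m. \<Sum>k\<in>N {m}. x k * x m"]
    by (simp add: d3_def mult.assoc flip: sum_distrib_left)
  also have "ennreal \<dots> = ennreal (c / \<sigma> ^ 2) * (ennreal \<sigma> ^ 2 * (\<Sum>m\<in>B. \<Sum>k\<in>N {m}. ennreal (x k) * ennreal (x m)))"
    using \<sigma> c by (simp add: sum_nonneg ennreal_power flip: ennreal_mult mult.assoc)
  also have "\<dots> \<le> ennreal (c / \<sigma> ^ 2) * (\<Sum>m\<in>B. \<Sum>k\<in>N {m}. y k * y m)"
    unfolding sum_distrib_left[of "ennreal \<sigma> ^ 2"] by (intro mult_left_mono sum_mono scaled_xx) simp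
  finally show ?thesis .
qed

lemma d4_le: "ennreal (d4 S) \<le> ennreal (c / \<sigma> ^ 2) * (\<Sum>(i, j)\<in>D S. y i * y j)"
proof -
  have "ennreal \<sigma> ^ 2 * (\<Sum>(i, j)\<in>D S. ennreal (x i) * ennreal (x j)) \<le> (\<Sum>(i, j)\<in>D S. y i * y j)"
    unfolding sum_distrib_left split_beta by (intro sum_mono scaled_xx)
  from ennreal_le_scaled[OF \<sigma> c this] show ?thesis
    by (simp add: d4_def split_beta ennreal_mult flip: sum_ennreal)
qed

lemma of_nat_ennreal: "(of_nat k :: ennreal)\<^sup>2 = ennreal ((real k)\<^sup>2)" "(of_nat k :: ennreal) = ennreal (real k)"
  by (simp_all add: ennreal_of_nat_eq_real_of_nat ennreal_power)

lemma d5_le: "ennreal d5 \<le> ennreal (c / \<sigma> ^ 3) * (\<Sum>i\<in>I. of_nat (card (\<A> i))^2 * y i^3)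
            + ennreal (c / \<sigma> ^ 3) * (\<Sum>i\<in>I. \<Sum>j\<in>\<A> i. of_nat (card (\<A> i)) * y j^3)"
proof -
  have a: "ennreal \<sigma> ^ 3 * (\<Sum>i\<in>I. of_nat (card (\<A> i))^2 * ennreal (x i)^3) \<le> (\<Sum>i\<in>I. of_nat (card (\<A> i))^2 * y i^3)"
    unfolding sum_distrib_left mult.left_commute[of "ennreal \<sigma> ^ 3"] by (intro sum_mono mult_left_mono scaled_x3) auto
  have b: "ennreal \<sigma> ^ 3 * (\<Sum>i\<in>I. \<Sum>j\<in>\<A> i. of_nat (card (\<A> i)) * ennreal (x j)^3) \<le> (\<Sum>i\<in>I. \<Sum>j\<in>\<A> i. of_nat (card (\<A> i)) * y j^3)"
    unfolding sum_distrib_left mult.left_commute[of "ennreal \<sigma> ^ 3"] by (intro sum_mono mult_left_mono scaled_x3) auto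
  have "ennreal d5 = (\<Sum>i\<in>I. of_nat (card (\<A> i))^2 * ennreal (x i)^3) + (\<Sum>i\<in>I. \<Sum>j\<in>\<A> i. of_nat (card (\<A> i)) * ennreal (x j)^3)"
    unfolding d5_def of_nat_ennreal by (simp add: ennreal_power sum_nonneg flip: ennreal_mult ennreal_plus)
  also have "\<dots> \<le> ennreal (c / \<sigma> ^ 3) * (\<Sum>i\<in>I. of_nat (card (\<A> i))^2 * y i^3)
            + ennreal (c / \<sigma> ^ 3) * (\<Sum>i\<in>I. \<Sum>j\<in>\<A> i. of_nat (card (\<A> i)) * y j^3)"
    by (intro add_mono ennreal_le_scaled[OF \<sigma> c] a b)
  finally show ?thesis .
qed

lemma scaled_x3x: "ennreal \<sigma> ^ 4 * (ennreal (x i) ^ 3 * ennreal (x j)) \<le> y i ^ 3 * y j"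
proof -
  have "ennreal \<sigma> ^ 4 * (ennreal (x i) ^ 3 * ennreal (x j)) = (ennreal \<sigma> ^ 3 * ennreal (x i) ^ 3) * (ennreal \<sigma> * ennreal (x j))"
    by (simp add: power4_eq_xxxx power3_eq_cube mult_ac)
  also have "\<dots> \<le> y i ^ 3 * y j" by (intro mult_mono scaled_x3 y) auto
  finally show ?thesis .
qed

lemma scaled_x3xx: "ennreal \<sigma> ^ 5 * (ennreal (x i) ^ 3 * ennreal (x j) * ennreal (x k)) \<le> y i ^ 3 * y j * y k"
proof -
  have "ennreal \<sigma> ^ 5 * (ennreal (x i) ^ 3 * ennreal (x j) * ennreal (x k)) =
     (ennreal \<sigma> ^ 4 * (ennreal (x i) ^ 3 * ennreal (x j))) * (ennreal \<sigma> * ennreal (x k))"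
    using power_Suc[of "ennreal \<sigma>" 4] by (simp add: mult_ac)
  also have "\<dots> \<le> y i ^ 3 * y j * y k" by (intro mult_mono scaled_x3x y) auto
  finally show ?thesis .
qed

lemma scaled_xxxx: "ennreal \<sigma> ^ 4 * (ennreal (x i) * ennreal (x j) * ennreal (x k) * ennreal (x l)) \<le> y i * y j * y k * y l"
proof -
  have "ennreal \<sigma> ^ 4 * (ennreal (x i) * ennreal (x j) * ennreal (x k) * ennreal (x l)) =
     (ennreal \<sigma> * ennreal (x i)) * (ennreal \<sigma> * ennreal (x j)) * (ennreal \<sigma> * ennreal (x k)) * (ennreal \<sigma> * ennreal (x l))"
    by (simp add: power4_eq_xxxx mult_ac)
  also have "\<dots> \<le> y i * y j * y k * y l" by (intro mult_mono y) auto
  finally show ?thesis .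
qed

lemma one_le_c_square: "1 \<le> c\<^sup>2" using c by simp

lemma d6_le: "ennreal (d6a + d6bc) \<le> ennreal (c^2 / \<sigma>^4) *
              (\<Sum>i\<in>I. \<Sum>j\<in>\<A> i. \<Sum>k\<in>\<A>\<^sub>2 i j. \<Sum>l\<in>\<A> k \<union> N {k}. y i * y j * y k * y l)
          + ennreal (c^2 / \<sigma>^4) *
              (\<Sum>i\<in>I. \<Sum>j\<in>\<A> i \<union> N {i}. of_nat (card (\<A> i))^2 * y i^3 * y j)
          + ennreal (c^2 / \<sigma>^4) *
              (\<Sum>i\<in>I. \<Sum>j\<in>\<A> i. \<Sum>k\<in>\<A> i \<union> N {j}. of_nat (card (\<A> i)) * y j^3 * y k)"
  (is "_ \<le> ?R")
proof -
  let ?z = "\<lambda>i. ennreal (x i)"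
  have a: "ennreal \<sigma> ^ 4 * (\<Sum>i\<in>I. \<Sum>j\<in>\<A> i. \<Sum>k\<in>\<A>\<^sub>2 i j. \<Sum>l\<in>\<A> k \<union> N {k}. ?z i * ?z j * ?z k * ?z l)
     \<le> (\<Sum>i\<in>I. \<Sum>j\<in>\<A> i. \<Sum>k\<in>\<A>\<^sub>2 i j. \<Sum>l\<in>\<A> k \<union> N {k}. y i * y j * y k * y l)"
    unfolding sum_distrib_left by (intro sum_mono scaled_xxxx)
  have b: "ennreal \<sigma> ^ 4 * (\<Sum>i\<in>I. \<Sum>j\<in>\<A> i \<union> N {i}. of_nat (card (\<A> i))^2 * (?z i^3 * ?z j))
     \<le> (\<Sum>i\<in>I. \<Sum>j\<in>\<A> i \<union> N {i}. of_nat (card (\<A> i))^2 * (y i^3 * y j))"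
    unfolding sum_distrib_left mult.left_commute[of "ennreal \<sigma> ^ 4" "(of_nat _)\<^sup>2"] by (intro sum_mono mult_left_mono scaled_x3x) auto
  have d: "ennreal \<sigma> ^ 4 * (\<Sum>i\<in>I. \<Sum>j\<in>\<A> i. \<Sum>k\<in>\<A> i \<union> N {j}. of_nat (card (\<A> i)) * (?z j^3 * ?z k))
     \<le> (\<Sum>i\<in>I. \<Sum>j\<in>\<A> i. \<Sum>k\<in>\<A> i \<union> N {j}. of_nat (card (\<A> i)) * (y j^3 * y k))"
    unfolding sum_distrib_left mult.left_commute[of "ennreal \<sigma> ^ 4" "of_nat _"] by (intro sum_mono mult_left_mono scaled_x3x) auto
  have "ennreal (d6a + d6bc) = (\<Sum>i\<in>I. \<Sum>j\<in>\<A> i. \<Sum>k\<in>\<A>\<^sub>2 i j. \<Sum>l\<in>\<A> k \<union> N {k}. ?z i * ?z j * ?z k * ?z l)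
     + (\<Sum>i\<in>I. \<Sum>j\<in>\<A> i \<union> N {i}. of_nat (card (\<A> i))^2 * (?z i^3 * ?z j))
     + (\<Sum>i\<in>I. \<Sum>j\<in>\<A> i. \<Sum>k\<in>\<A> i \<union> N {j}. of_nat (card (\<A> i)) * (?z j^3 * ?z k))"
    unfolding d6a_def d6bc_def of_nat_ennreal
    by (simp add: ennreal_power sum_nonneg mult.assoc flip: ennreal_mult ennreal_plus)
  also have "\<dots> \<le> ?R" unfolding mult.assoc[of "of_nat _"] mult.assoc[of "(of_nat _)\<^sup>2"]
    by (intro add_mono ennreal_le_scaled[OF \<sigma> one_le_c_square] a b d)
  finally show ?thesis .
qed

lemma d7_le: "ennreal d7sq \<le> ennreal (c^2 / \<sigma>^5) *
              (\<Sum>i\<in>I. of_nat (card (\<A> i))^2 *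
                (\<Sum>j\<in>\<A> i \<union> N {i}. \<Sum>k\<in>N {j}. y i^3 * y j * y k))
          + ennreal (c^2 / \<sigma>^5) *
              (\<Sum>i\<in>I. \<Sum>j\<in>\<A> i. \<Sum>k\<in>\<A> i \<union> N {j}. \<Sum>l\<in>N {k}.
                of_nat (card (\<A> i)) * y j^3 * y k * y l)
          + ennreal (c^2 / \<sigma>^5) *
              (\<Sum>i\<in>I. \<Sum>(j, k)\<in>D {i}. of_nat (card (\<A> i))^2 * y i^3 * y j * y k)
          + ennreal (c^2 / \<sigma>^5) *
              (\<Sum>i\<in>I. \<Sum>j\<in>\<A> i. \<Sum>(k, l)\<in>D {j}.
                of_nat (card (\<A> i)) * y j^3 * y k * y l)"
  (is "_ \<le> ?R")
proof -
  let ?z = "\<lambda>i. ennreal (x i)"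
  have a: "ennreal \<sigma> ^ 5 * (\<Sum>i\<in>I. of_nat (card (\<A> i))^2 *
                (\<Sum>j\<in>\<A> i \<union> N {i}. \<Sum>k\<in>N {j}. ?z i^3 * ?z j * ?z k))
    \<le> (\<Sum>i\<in>I. of_nat (card (\<A> i))^2 *
                (\<Sum>j\<in>\<A> i \<union> N {i}. \<Sum>k\<in>N {j}. y i^3 * y j * y k))"
    unfolding sum_distrib_left[of "ennreal \<sigma> ^ 5"] mult.left_commute[of "ennreal \<sigma> ^ 5" "(of_nat _)\<^sup>2"]
    by (intro sum_mono mult_left_mono scaled_x3xx) auto
  have b: "ennreal \<sigma> ^ 5 * (\<Sum>i\<in>I. \<Sum>j\<in>\<A> i. \<Sum>k\<in>\<A> i \<union> N {j}. \<Sum>l\<in>N {k}. of_nat (card (\<A> i)) * (?z j^3 * ?z k * ?z l))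
    \<le> (\<Sum>i\<in>I. \<Sum>j\<in>\<A> i. \<Sum>k\<in>\<A> i \<union> N {j}. \<Sum>l\<in>N {k}. of_nat (card (\<A> i)) * (y j^3 * y k * y l))"
    unfolding sum_distrib_left mult.left_commute[of "ennreal \<sigma> ^ 5" "of_nat _"]
    by (intro sum_mono mult_left_mono scaled_x3xx) auto
  have d: "ennreal \<sigma> ^ 5 * (\<Sum>i\<in>I. \<Sum>(j, k)\<in>D {i}. of_nat (card (\<A> i))^2 * (?z i^3 * ?z j * ?z k))
    \<le> (\<Sum>i\<in>I. \<Sum>(j, k)\<in>D {i}. of_nat (card (\<A> i))^2 * (y i^3 * y j * y k))"
    unfolding sum_distrib_left split_beta mult.left_commute[of "ennreal \<sigma> ^ 5" "(of_nat _)\<^sup>2"]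
    by (intro sum_mono mult_left_mono scaled_x3xx) auto
  have e: "ennreal \<sigma> ^ 5 * (\<Sum>i\<in>I. \<Sum>j\<in>\<A> i. \<Sum>(k, l)\<in>D {j}. of_nat (card (\<A> i)) * (?z j^3 * ?z k * ?z l))
    \<le> (\<Sum>i\<in>I. \<Sum>j\<in>\<A> i. \<Sum>(k, l)\<in>D {j}. of_nat (card (\<A> i)) * (y j^3 * y k * y l))"
    unfolding sum_distrib_left split_beta mult.left_commute[of "ennreal \<sigma> ^ 5" "of_nat _"]
    by (intro sum_mono mult_left_mono scaled_x3xx) auto
  have "ennreal d7sq = (\<Sum>i\<in>I. of_nat (card (\<A> i))^2 *
                (\<Sum>j\<in>\<A> i \<union> N {i}. \<Sum>k\<in>N {j}. ?z i^3 * ?z j * ?z k))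
    + (\<Sum>i\<in>I. \<Sum>j\<in>\<A> i. \<Sum>k\<in>\<A> i \<union> N {j}. \<Sum>l\<in>N {k}. of_nat (card (\<A> i)) * (?z j^3 * ?z k * ?z l))
    + (\<Sum>i\<in>I. \<Sum>(j, k)\<in>D {i}. of_nat (card (\<A> i))^2 * (?z i^3 * ?z j * ?z k))
    + (\<Sum>i\<in>I. \<Sum>j\<in>\<A> i. \<Sum>(k, l)\<in>D {j}. of_nat (card (\<A> i)) * (?z j^3 * ?z k * ?z l))"
    unfolding d7sq_def of_nat_ennreal
    by (simp add: ennreal_power sum_nonneg mult.assoc split_beta flip: ennreal_mult ennreal_plus)
  also have "\<dots> \<le> ?R" unfolding mult.assoc[of "of_nat _ * _"] mult.assoc[of "of_nat _"] mult.assoc[of "(of_nat _)\<^sup>2 * _"] mult.assoc[of "(of_nat _)\<^sup>2"]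
      mult.assoc[of "_ ^ 3", symmetric]
    by (intro add_mono ennreal_le_scaled[OF \<sigma> one_le_c_square] a b d e)
  finally show ?thesis .
qed

end

end

section \<open>The concentration inequality\<close>

definition generated_algebra :: "'a measure \<Rightarrow> ('i \<Rightarrow> 'a \<Rightarrow> real) \<Rightarrow> 'i set \<Rightarrow> 'a measure" where
  "generated_algebra M X S = vimage_algebra (space M) (subfamily X S) (Pi\<^sub>M S (\<lambda>_. borel))"

lemma space_generated_algebra [simp]: "space (generated_algebra M X S) = space M"
  by (simp add: generated_algebra_def)

lemma subfamily_generated_algebra:
  "subfamily X S \<in> measurable (generated_algebra M X S) (Pi\<^sub>M S (\<lambda>_. borel))"
  unfolding generated_algebra_def
  by (rule measurable_vimage_algebra1) (auto simp: space_PiM subfamily_def)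

lemma component_generated_algebra:
  assumes "i \<in> S"
  shows "X i \<in> borel_measurable (generated_algebra M X S)"
proof -
  have "(\<lambda>\<omega>. subfamily X S \<omega> i) \<in> borel_measurable (generated_algebra M X S)"
    by (rule measurable_compose[OF subfamily_generated_algebra measurable_component_singleton[OF assms]])
  then show ?thesis using assms by (simp add: subfamily_def)
qed

lemma generated_algebra_least:
  assumes "space N = space M" "\<And>i. i \<in> S \<Longrightarrow> X i \<in> borel_measurable N"
  shows "sets (generated_algebra M X S) \<subseteq> sets N"
  unfolding generated_algebra_def
proof (rule sets_image_in_sets[OF assms(1)])
  show "subfamily X S \<in> measurable N (Pi\<^sub>M S (\<lambda>_. borel))"
    unfolding subfamily_def[abs_def] by (rule measurable_restrict) (rule assms(2))
qed

lemma (in prob_space) indep_generated_algebra: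
  "indep_subfamilies M X S T \<Longrightarrow> indep_set (sets (generated_algebra M X S)) (sets (generated_algebra M X T))"
  by (simp add: indep_subfamilies_def indep_var_eq generated_algebra_def sets_vimage_algebra)

text \<open>
  Absolute powers with real exponents are replaced by a function \<open>g\<close>, which will be a polynomial
  expression in the variable or in a root of it.
\<close>

lemma lp_norm_eq:
  assumes g: "g \<in> borel_measurable M" and e: "\<And>\<omega>. \<bar>f \<omega>\<bar> powr p = g \<omega>"
  shows "lp_norm M p f = (if integrable M g then ennreal ((\<integral>\<omega>. g \<omega> \<partial>M) powr (1 / p)) else \<infinity>)"
proof -
  have nn: "0 \<le> g \<omega>" for \<omega> using e[of \<omega>] by (metis powr_ge_zero)
  show ?thesis
  proof (cases "integrable M g")
    case True
    have "(\<integral>\<^sup>+ \<omega>. ennreal (\<bar>f \<omega>\<bar> powr p) \<partial>M) = ennreal (\<integral>\<omega>. g \<omega> \<partial>M)"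
      unfolding e using True nn by (simp add: nn_integral_eq_integral)
    then show ?thesis using True nn by (simp add: lp_norm_def Let_def integral_nonneg_AE)
  next
    case False
    then have "(\<integral>\<^sup>+ \<omega>. ennreal (\<bar>f \<omega>\<bar> powr p) \<partial>M) = \<infinity>"
      unfolding e using g nn by (auto simp: integrable_iff_bounded less_top[symmetric])
    then show ?thesis using False by (simp add: lp_norm_def)
  qed
qed

lemma powr_quarter: "0 \<le> m \<Longrightarrow> m powr (1 / 4) = root 4 m"
  by (cases "m = 0") (simp_all add: root_powr_inverse)

lemma powr_three_quarters: "0 \<le> m \<Longrightarrow> m powr (3 / 4) = root 4 m ^ 3"
proof (cases "m = 0")
  case False
  assume "0 \<le> m"
  with False have "root 4 m ^ 3 = (m powr (1 / 4)) powr 3"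
    by (simp add: powr_quarter)
  then show ?thesis by (simp add: powr_powr)
qed simp

lemma lp_norm_4:
  assumes "f \<in> borel_measurable M"
  shows "lp_norm M 4 f = (if integrable M (\<lambda>\<omega>. f \<omega> ^ 4) then ennreal (root 4 (\<integral>\<omega>. f \<omega> ^ 4 \<partial>M)) else \<infinity>)"
proof -
  have "\<bar>f \<omega>\<bar> powr 4 = f \<omega> ^ 4" for \<omega> by (cases "f \<omega> = 0") simp_all
  then show ?thesis using assms
    by (subst lp_norm_eq[where g = "\<lambda>\<omega>. f \<omega> ^ 4"]) (simp_all add: powr_quarter integral_nonneg_AE)
qed

lemma lp_norm_4_3:
  assumes [measurable]: "f \<in> borel_measurable M"
  shows "lp_norm M (4 / 3) f = (if integrable M (\<lambda>\<omega>. root 3 \<bar>f \<omega>\<bar> ^ 4)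
     then ennreal (root 4 (\<integral>\<omega>. root 3 \<bar>f \<omega>\<bar> ^ 4 \<partial>M) ^ 3) else \<infinity>)"
proof -
  have "\<bar>f \<omega>\<bar> powr (4 / 3) = root 3 \<bar>f \<omega>\<bar> ^ 4" for \<omega>
  proof (cases "f \<omega> = 0")
    case False
    then have "root 3 \<bar>f \<omega>\<bar> ^ 4 = (\<bar>f \<omega>\<bar> powr (1 / 3)) powr 4"
      by (simp add: root_powr_inverse)
    then show ?thesis by (simp add: powr_powr)
  qed simp
  then show ?thesis
    by (subst lp_norm_eq[where g = "\<lambda>\<omega>. root 3 \<bar>f \<omega>\<bar> ^ 4"]) (simp_all add: powr_three_quarters integral_nonneg_AE)
qed

theorem proposition4p5:
  fixes M :: "'a measure"
    and n :: nat
    and X :: "nat \<Rightarrow> 'a \<Rightarrow> real"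
    and \<A> :: "nat \<Rightarrow> nat set"
    and \<A>\<^sub>2 :: "nat \<Rightarrow> nat \<Rightarrow> nat set"
    and \<sigma> a b c :: real
    and A B :: "nat set"
    and h :: "(nat \<Rightarrow> real) \<Rightarrow> real"
    and \<xi> \<eta> \<zeta> S\<^sub>A :: "'a \<Rightarrow> real"
    and N :: "nat set \<Rightarrow> nat set"
    and D :: "nat set \<Rightarrow> (nat \<times> nat) set"
    and x :: "nat \<Rightarrow> ennreal"
    and \<delta> :: "nat \<Rightarrow> ennreal"
  assumes "prob_space M"
    and "\<And>i. i \<in> {1..n} \<Longrightarrow> integrable M (X i)"
    and "\<And>i. i \<in> {1..n} \<Longrightarrow> prob_space.expectation M (X i) = 0"
    and "\<And>i. i \<in> {1..n} \<Longrightarrow> \<A> i \<subseteq> {1..n}"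
    and "\<And>i. i \<in> {1..n} \<Longrightarrow> indep_subfamilies M X {i} ({1..n} - \<A> i)"
    and "\<And>i j. i \<in> {1..n} \<Longrightarrow> j \<in> \<A> i \<Longrightarrow> \<A> i \<subseteq> \<A>\<^sub>2 i j \<and> \<A>\<^sub>2 i j \<subseteq> {1..n}"
    and "\<And>i j. i \<in> {1..n} \<Longrightarrow> j \<in> \<A> i \<Longrightarrow>
           indep_subfamilies M X {i, j} ({1..n} - \<A>\<^sub>2 i j)"
    and "integrable M (\<lambda>\<omega>. (\<Sum>i\<in>{1..n}. X i \<omega>)\<^sup>2)"
    and "\<sigma> > 0"
    and "\<sigma>\<^sup>2 = prob_space.variance M (\<lambda>\<omega>. \<Sum>i\<in>{1..n}. X i \<omega>)"
    and "A \<subseteq> {1..n}" and "A \<noteq> {}"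
    and "B \<subseteq> {1..n}" and "B \<noteq> {}"
    and "a \<le> b" and "c \<ge> 1"
    and "h \<in> borel_measurable (Pi\<^sub>M A (\<lambda>_. borel))"
    and "\<xi> = (\<lambda>\<omega>. h (subfamily X A \<omega>))"
    and "\<And>\<omega>. \<omega> \<in> space M \<Longrightarrow> \<xi> \<omega> \<ge> 0"
    and "\<eta> = (\<lambda>\<omega>. a - c * (\<Sum>m\<in>B. \<bar>X m \<omega>\<bar>) / \<sigma>)"
    and "\<zeta> = (\<lambda>\<omega>. b + c * (\<Sum>m\<in>B. \<bar>X m \<omega>\<bar>) / \<sigma>)"
    and "N = nbh n \<A>"
    and "D = pair_nbh n \<A> \<A>\<^sub>2"
    and "S\<^sub>A = (\<lambda>\<omega>. \<Sum>i\<in>{1..n} - N A. X i \<omega>)"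
    and "x = (\<lambda>i. lp_norm M 4 (X i))"
    and "\<delta> 0 = ennreal ((b - a) / 100)"
    and "\<delta> 1 = ennreal (c / \<sigma>) * (\<Sum>i\<in>N A. x i)"
    and "\<delta> 2 = ennreal (c / \<sigma>) * (\<Sum>m\<in>B. x m)"
    and "\<delta> 3 = ennreal (c / \<sigma>^2) * (\<Sum>m\<in>B. \<Sum>k\<in>N {m}. x k * x m)"
    and "\<delta> 4 = ennreal (c / \<sigma>^2) * (\<Sum>(i, j)\<in>D A. x i * x j)"
    and "\<delta> 5 = ennreal (c / \<sigma>^3) * (\<Sum>i\<in>{1..n}. of_nat (card (\<A> i))^2 * x i^3)
            + ennreal (c / \<sigma>^3) * (\<Sum>i\<in>{1..n}. \<Sum>j\<in>\<A> i. of_nat (card (\<A> i)) * x j^3)"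
    and "(\<delta> 6)^2 =
            ennreal (c^2 / \<sigma>^4) *
              (\<Sum>i\<in>{1..n}. \<Sum>j\<in>\<A> i. \<Sum>k\<in>\<A>\<^sub>2 i j. \<Sum>l\<in>\<A> k \<union> N {k}. x i * x j * x k * x l)
          + ennreal (c^2 / \<sigma>^4) *
              (\<Sum>i\<in>{1..n}. \<Sum>j\<in>\<A> i \<union> N {i}. of_nat (card (\<A> i))^2 * x i^3 * x j)
          + ennreal (c^2 / \<sigma>^4) *
              (\<Sum>i\<in>{1..n}. \<Sum>j\<in>\<A> i. \<Sum>k\<in>\<A> i \<union> N {j}. of_nat (card (\<A> i)) * x j^3 * x k)"
    and "(\<delta> 7)^2 =
            ennreal (c^2 / \<sigma>^5) *
              (\<Sum>i\<in>{1..n}. of_nat (card (\<A> i))^2 *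
                (\<Sum>j\<in>\<A> i \<union> N {i}. \<Sum>k\<in>N {j}. x i^3 * x j * x k))
          + ennreal (c^2 / \<sigma>^5) *
              (\<Sum>i\<in>{1..n}. \<Sum>j\<in>\<A> i. \<Sum>k\<in>\<A> i \<union> N {j}. \<Sum>l\<in>N {k}.
                of_nat (card (\<A> i)) * x j^3 * x k * x l)
          + ennreal (c^2 / \<sigma>^5) *
              (\<Sum>i\<in>{1..n}. \<Sum>(j, k)\<in>D {i}. of_nat (card (\<A> i))^2 * x i^3 * x j * x k)
          + ennreal (c^2 / \<sigma>^5) *
              (\<Sum>i\<in>{1..n}. \<Sum>j\<in>\<A> i. \<Sum>(k, l)\<in>D {j}.
                of_nat (card (\<A> i)) * x j^3 * x k * x l)"
  shows "(\<integral>\<^sup>+ \<omega>. ennreal (\<xi> \<omega>) *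
            indicator {\<omega>. \<eta> \<omega> \<le> S\<^sub>A \<omega> / \<sigma> \<and> S\<^sub>A \<omega> / \<sigma> \<le> \<zeta> \<omega>} \<omega> \<partial>M)
         \<le> 156 * lp_norm M (4 / 3) \<xi> * (\<Sum>i = 0..7. \<delta> i)"
proof -
  define I where "I = {1..n}"
  note P = assms(1) and X1 = assms(2) and X0 = assms(3) and A_sub = assms(4) and ind1 = assms(5)
    and A2_sub = assms(6) and ind2 = assms(7) and S2 = assms(8) and \<sigma> = assms(9) and var = assms(10)
    and A = assms(11) and B = assms(13) and ab = assms(15) and c = assms(16) and h = assms(17)
    and \<xi> = assms(18) and \<xi>0 = assms(19) and \<eta> = assms(20) and \<zeta> = assms(21) and N = assms(22)
    and D = assms(23) and S = assms(24) and x = assms(25)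
  interpret prob_space M by (rule P)
  let ?G = "generated_algebra M X"
  have X_M: "X i \<in> borel_measurable M" if "i \<in> I" for i using X1[of i] that by (auto simp: I_def)
  have sub: "subalgebra M (?G T)" if "T \<subseteq> I" for T
    unfolding subalgebra_def using generated_algebra_least[of M M T X] that X_M by auto
  have \<xi>G: "\<xi> \<in> borel_measurable (?G A)"
    unfolding \<xi> by (rule measurable_compose[OF subfamily_generated_algebra h])
  have \<xi>M [measurable]: "\<xi> \<in> borel_measurable M"
    using measurable_from_subalg[OF sub \<xi>G] A by (simp add: I_def)
  \<comment> \<open>the unnormalized cube root of \<open>\<xi>\<close>, with fourth moment \<open>m = \<parallel>\<xi>\<parallel>\<^bsub>4/3\<^esub> powr (4/3)\<close>\<close>
  define \<theta>\<^sub>0 where "\<theta>\<^sub>0 \<omega> = root 3 \<bar>\<xi> \<omega>\<bar>" for \<omega>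
  have \<theta>3: "\<theta>\<^sub>0 \<omega> ^ 3 = \<bar>\<xi> \<omega>\<bar>" for \<omega> by (simp add: \<theta>\<^sub>0_def)
  have \<theta>0: "0 \<le> \<theta>\<^sub>0 \<omega>" for \<omega> by (simp add: \<theta>\<^sub>0_def)
  have \<theta>G: "\<theta>\<^sub>0 \<in> borel_measurable (?G A)"
    unfolding \<theta>\<^sub>0_def[abs_def] using \<xi>G by measurable
  define m where "m = expectation (\<lambda>\<omega>. \<theta>\<^sub>0 \<omega> ^ 4)"
  have m0: "0 \<le> m" unfolding m_def by (rule integral_nonneg_AE) simp
  have norm_\<xi>: "lp_norm M (4 / 3) \<xi> = (if integrable M (\<lambda>\<omega>. \<theta>\<^sub>0 \<omega> ^ 4) then ennreal (root 4 m ^ 3) else \<infinity>)"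
    unfolding m_def \<theta>\<^sub>0_def by (rule lp_norm_4_3) measurable
  let ?ev = "\<lambda>\<omega>. \<eta> \<omega> \<le> S\<^sub>A \<omega> / \<sigma> \<and> S\<^sub>A \<omega> / \<sigma> \<le> \<zeta> \<omega>"
  let ?L = "\<integral>\<^sup>+ \<omega>. ennreal (\<xi> \<omega>) * indicator {\<omega>. ?ev \<omega>} \<omega> \<partial>M"
  have \<delta>_le: "\<delta> k \<le> (\<Sum>i = 0..7. \<delta> i)" if "k \<le> 7" for k
    by (rule member_le_sum) (use that in auto)
  \<comment> \<open>In the products of extended reals, zero times infinity is zero: if \<open>\<parallel>\<xi>\<parallel> = 0\<close>, the left-hand side has to vanish.\<close>
  have zero: "?L = 0" if int: "integrable M (\<lambda>\<omega>. \<theta>\<^sub>0 \<omega> ^ 4)" and "m = 0"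
  proof -
    have "AE \<omega> in M. \<theta>\<^sub>0 \<omega> ^ 4 = 0"
      using integral_nonneg_eq_0_iff_AE[OF int] \<open>m = 0\<close> by (simp add: m_def)
    then have "AE \<omega> in M. ennreal (\<xi> \<omega>) * indicator {\<omega>. ?ev \<omega>} \<omega> = 0"
      by eventually_elim (simp add: \<theta>\<^sub>0_def)
    then have "?L = (\<integral>\<^sup>+ \<omega>. 0 \<partial>M)" by (rule nn_integral_cong_AE)
    then show ?thesis by simp
  qed
  have infinite: ?thesis if "\<delta> 5 = \<infinity>"
  proof -
    have top: "(\<Sum>i = 0..7. \<delta> i) = \<infinity>" using \<delta>_le[of 5] that by (simp add: top_unique)
    show ?thesis
    proof (cases "integrable M (\<lambda>\<omega>. \<theta>\<^sub>0 \<omega> ^ 4) \<and> m = 0")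
      case True
      with zero show ?thesis by simp
    next
      case False
      then have "lp_norm M (4 / 3) \<xi> \<noteq> 0" using m0 by (auto simp: norm_\<xi>)
      then show ?thesis unfolding top by (simp add: ennreal_mult_eq_top_iff ennreal_mult_top)
    qed
  qed
  show ?thesis
  proof (cases "\<forall>i\<in>I. integrable M (\<lambda>\<omega>. X i \<omega> ^ 4)")
    case False
    then obtain i where i: "i \<in> I" and ni: "\<not> integrable M (\<lambda>\<omega>. X i \<omega> ^ 4)" by auto
    have iX: "integrable M (X i)" using X1 i by (simp add: I_def)
    \<comment> \<open>otherwise \<open>X i\<close> is independent of itself, hence almost surely zero\<close>
    have "\<A> i \<noteq> {}"
    proof
      assume e: "\<A> i = {}"
      have "indep_set (sets (?G {i})) (sets (?G I))"
        using indep_generated_algebra[OF ind1[of i]] i e by (simp add: I_def)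
      note sq = indep_set_mult[OF this sub sub component_generated_algebra component_generated_algebra iX iX]
      have "integrable M (\<lambda>\<omega>. X i \<omega> * X i \<omega>)" "expectation (\<lambda>\<omega>. X i \<omega> * X i \<omega>) = 0"
        using sq i X0[of i] by (auto simp: I_def)
      then have "AE \<omega> in M. X i \<omega> * X i \<omega> = 0"
        using integral_nonneg_eq_0_iff_AE[of M "\<lambda>\<omega>. X i \<omega> * X i \<omega>"] by simp
      then have "AE \<omega> in M. X i \<omega> ^ 4 = 0" by eventually_elim simp
      then have "integrable M (\<lambda>\<omega>. X i \<omega> ^ 4) = integrable M (\<lambda>_. 0 :: real)"
        using X_M[OF i] by (intro integrable_cong_AE) auto
      with ni show False by simp
    qed
    moreover have "finite (\<A> i)" using A_sub[of i] i finite_subset by (auto simp: I_def)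
    ultimately have card: "card (\<A> i) \<noteq> 0" by simp
    have "x i = \<infinity>" using lp_norm_4[OF X_M[OF i]] ni by (simp add: x)
    with card have "of_nat (card (\<A> i))^2 * x i^3 = \<infinity>" by (simp add: ennreal_mult_top power_eq_0_iff)
    moreover have "of_nat (card (\<A> i))^2 * x i^3 \<le> (\<Sum>i\<in>{1..n}. of_nat (card (\<A> i))^2 * x i^3)"
      by (rule member_le_sum) (use i in \<open>auto simp: I_def\<close>)
    ultimately have top: "(\<Sum>i\<in>{1..n}. of_nat (card (\<A> i))^2 * x i^3) = \<infinity>" by (simp add: top_unique)
    have "ennreal (c / \<sigma> ^ 3) \<noteq> 0" using \<sigma> c by simp
    then have "\<delta> 5 = \<infinity>" unfolding assms(31) top by (simp add: ennreal_mult_top)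
    then show ?thesis by (rule infinite)
  next
    case True
    then have X4: "integrable M (\<lambda>\<omega>. X i \<omega> ^ 4)" if "i \<in> I" for i using that by blast
    \<comment> \<open>The variables are redefined as zero outside \<open>I\<close>, so that the comparison of norms below holds for every index.\<close>
    define Y where "Y i \<omega> = (if i \<in> I then X i \<omega> / \<sigma> else 0)" for i \<omega>
    interpret L: locally_dependent M I Y ?G \<A> \<A>\<^sub>2
    proof unfold_locales
      show "finite I" by (simp add: I_def)
      show "subalgebra M (?G T)" if "T \<subseteq> I" for T by (rule sub[OF that])
      show "sets (?G T) \<subseteq> sets (?G U)" if "T \<subseteq> U" "U \<subseteq> I" for T U
        by (rule generated_algebra_least) (use that in \<open>auto intro: component_generated_algebra\<close>)
      show "Y i \<in> borel_measurable (?G {i})" if "i \<in> I" for i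
        using component_generated_algebra[of i "{i}" X M] that by (simp add: Y_def[abs_def])
      show "\<A> i \<subseteq> I" if "i \<in> I" for i using A_sub that by (simp add: I_def)
      show "\<A>\<^sub>2 i j \<subseteq> I" if "i \<in> I" "j \<in> \<A> i" for i j using A2_sub that by (simp add: I_def)
      show "indep_set (sets (?G {i})) (sets (?G (I - \<A> i)))" if "i \<in> I" for i
        by (rule indep_generated_algebra) (use ind1 that in \<open>simp add: I_def\<close>)
      show "indep_set (sets (?G {i, j})) (sets (?G (I - \<A>\<^sub>2 i j)))" if "i \<in> I" "j \<in> \<A> i" for i j
        by (rule indep_generated_algebra) (use ind2 that in \<open>simp add: I_def\<close>)
      show "integrable M (\<lambda>\<omega>. Y i \<omega> ^ 4)" if "i \<in> I" for i
        using X4[OF that] that by (simp add: Y_def power_divide)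
      show "expectation (Y i) = 0" if "i \<in> I" for i
        using X0[of i] that by (simp add: Y_def[abs_def] I_def)
      have "expectation (\<lambda>\<omega>. \<Sum>i\<in>I. X i \<omega>) = 0"
        using X1 X0 by (simp add: I_def)
      then have "expectation (\<lambda>\<omega>. (\<Sum>i\<in>I. X i \<omega>)\<^sup>2) = \<sigma>\<^sup>2" using var by (simp add: I_def)
      moreover have "(\<Sum>i\<in>I. Y i \<omega>)\<^sup>2 = (\<Sum>i\<in>I. X i \<omega>)\<^sup>2 / \<sigma>\<^sup>2" for \<omega>
        by (simp add: Y_def sum_divide_distrib[symmetric] power_divide)
      ultimately show "expectation (\<lambda>\<omega>. (\<Sum>i\<in>I. Y i \<omega>)\<^sup>2) = 1" using \<sigma> by simp
    qed
    have NL: "N = L.N" by (rule ext) (simp add: N nbh_def L.N_def, simp add: I_def)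
    have DL: "D = L.D" by (rule ext) (simp add: D pair_nbh_def L.D_def, simp add: I_def)
    have y: "ennreal \<sigma> * ennreal (L.x i) \<le> x i" for i
    proof (cases "i \<in> I")
      case True
      have "L.x i = root 4 (expectation (\<lambda>\<omega>. X i \<omega> ^ 4)) / \<sigma>"
        using True \<sigma> by (simp add: L.x_def Y_def power_divide real_root_divide real_root_power_cancel)
      then show ?thesis using \<sigma> True X4
        by (simp add: x lp_norm_4[OF X_M] integral_nonneg_AE flip: ennreal_mult)
    next
      case False
      then show ?thesis by (simp add: L.x_def Y_def)
    qed
    define w where "w m = c * of_bool (m \<in> B)" for m
    have w0: "0 \<le> w m" for m using c by (simp add: w_def)
    have BI: "B \<subseteq> I" using B by (simp add: I_def)
    have d: "ennreal ((b - a) / 100) \<le> \<delta> 0" "ennreal (L.d1 A) \<le> \<delta> 1" "ennreal (L.d2 w) \<le> \<delta> 2"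
      "ennreal (L.d3 w) \<le> \<delta> 3" "ennreal (L.d4 A) \<le> \<delta> 4" "ennreal L.d5 \<le> \<delta> 5"
      unfolding assms(26-31) NL DL I_def[symmetric] w_def[abs_def]
      by (rule order_refl L.d1_le[OF \<sigma> c y] L.d2_le[OF \<sigma> c y BI] L.d3_le[OF \<sigma> c y BI] L.d4_le[OF \<sigma> c y] L.d5_le[OF \<sigma> c y])+
    have d67: "ennreal L.d6 \<le> \<delta> 6" "ennreal L.d7 \<le> \<delta> 7"
    proof -
      have "ennreal (L.d6a + L.d6bc) \<le> (\<delta> 6)\<^sup>2"
        unfolding assms(32) NL I_def[symmetric] by (rule L.d6_le[OF \<sigma> c y])
      then show "ennreal L.d6 \<le> \<delta> 6"
        unfolding L.d6_def by (rule ennreal_sqrt_le[rotated]) (simp add: L.d1_d4_d6a_nonneg L.d2_d7_nonneg)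
      have "ennreal L.d7sq \<le> (\<delta> 7)\<^sup>2"
        unfolding assms(33) NL DL I_def[symmetric] by (rule L.d7_le[OF \<sigma> c y])
      then show "ennreal L.d7 \<le> \<delta> 7"
        unfolding L.d7_def by (rule ennreal_sqrt_le[rotated]) (rule L.d2_d7_nonneg)
    qed
    define \<Delta> where "\<Delta> = (b - a) / 100 + L.rest A w"
    have \<Delta>0: "0 \<le> \<Delta>" using ab L.rest_nonneg[of w A] w0 by (simp add: \<Delta>_def)
    have "ennreal \<Delta> = ennreal ((b - a) / 100) + ennreal (L.d1 A) + ennreal (L.d2 w) + ennreal (L.d3 w) + ennreal (L.d4 A)
        + ennreal L.d5 + ennreal L.d6 + ennreal L.d7"
      using ab L.d1_d4_d6a_nonneg L.d2_d7_nonneg(1,2)[of w, OF w0] L.d2_d7_nonneg(3-)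
      by (simp add: \<Delta>_def L.rest_def add.assoc flip: ennreal_plus)
    also have "\<dots> \<le> \<delta> 0 + \<delta> 1 + \<delta> 2 + \<delta> 3 + \<delta> 4 + \<delta> 5 + \<delta> 6 + \<delta> 7"
      by (intro add_mono d d67)
    also have "\<dots> = (\<Sum>i = 0..7. \<delta> i)" by (simp add: numeral_eq_Suc add_ac)
    finally have \<Delta>_le: "ennreal \<Delta> \<le> (\<Sum>i = 0..7. \<delta> i)" .
    show ?thesis
    proof (cases "integrable M (\<lambda>\<omega>. \<theta>\<^sub>0 \<omega> ^ 4)")
      case False
      then have "lp_norm M (4 / 3) \<xi> = \<infinity>" by (simp add: norm_\<xi>)
      \<comment> \<open>an infinite norm of \<open>\<xi>\<close> makes the right-hand side infinite only if the other factor is not zero\<close>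
      moreover have "(\<Sum>i = 0..7. \<delta> i) \<noteq> 0"
      proof -
        have "0 < ennreal L.d5" using L.d5_pos by simp
        also have "\<dots> \<le> \<delta> 5" by (rule d(6))
        also have "\<dots> \<le> (\<Sum>i = 0..7. \<delta> i)" by (rule \<delta>_le) simp
        finally show ?thesis by (rule less_imp_neq[THEN not_sym])
      qed
      ultimately show ?thesis by (auto simp: ennreal_mult_top ennreal_top_mult)
    next
      case int: True
      show ?thesis
      proof (cases "m = 0")
        case True
        with zero int show ?thesis by simp
      next
        case False
        with m0 have m: "0 < m" by simp
        define \<theta> where "\<theta> \<omega> = \<theta>\<^sub>0 \<omega> / root 4 m" for \<omega>
        have r: "0 < root 4 m" "root 4 m ^ 4 = m" using m by simp_all
        have weight: "L.weight A \<theta>"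
          unfolding L.weight_def
        proof (intro conjI allI)
          show "A \<subseteq> I" using A by (simp add: I_def)
          show "\<theta> \<in> borel_measurable (?G A)" unfolding \<theta>_def[abs_def] using \<theta>G by measurable
          show "0 \<le> \<theta> \<omega>" for \<omega> using \<theta>0 r by (simp add: \<theta>_def)
          have e: "\<theta> \<omega> ^ 4 = \<theta>\<^sub>0 \<omega> ^ 4 / m" for \<omega> using r by (simp add: \<theta>_def power_divide)
          show "integrable M (\<lambda>\<omega>. \<theta> \<omega> ^ 4)" unfolding e using int by simp
          show "expectation (\<lambda>\<omega>. \<theta> \<omega> ^ 4) \<le> 1" unfolding e using m by (simp add: m_def[symmetric])
        qed
        have W: "L.W A \<omega> = S\<^sub>A \<omega> / \<sigma>" for \<omega>
          unfolding L.W_def S NL I_def[symmetric] sum_divide_distrib by (rule sum.cong) (auto simp: Y_def)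
        have blur: "L.blur w \<omega> = c * (\<Sum>m\<in>B. \<bar>X m \<omega>\<bar>) / \<sigma>" for \<omega>
        proof -
          have "L.blur w \<omega> = (\<Sum>m\<in>B. c * \<bar>X m \<omega>\<bar> / \<sigma>)"
            unfolding L.blur_def by (rule sum.mono_neutral_cong_right) (use BI \<sigma> L.finite_I in \<open>auto simp: w_def Y_def\<close>)
          then show ?thesis by (simp add: sum_distrib_left sum_divide_distrib)
        qed
        have ev: "?ev \<omega> \<longleftrightarrow> L.concentrated A w a b \<omega>" for \<omega>
          by (simp add: L.concentrated_def W blur \<eta> \<zeta>)
        have bound: "expectation (\<lambda>\<omega>. \<theta> \<omega> ^ 3 * of_bool (L.concentrated A w a b \<omega>)) \<le> 156 * \<Delta>"
          using L.concentration_bound_156 weight w0 ab unfolding L.concentration_bound_def \<Delta>_def by blast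
        have "?L = (\<integral>\<^sup>+ \<omega>. ennreal (root 4 m ^ 3 * (\<theta> \<omega> ^ 3 * of_bool (L.concentrated A w a b \<omega>))) \<partial>M)"
        proof (rule nn_integral_cong)
          fix \<omega> assume "\<omega> \<in> space M"
          then have "\<xi> \<omega> = root 4 m ^ 3 * \<theta> \<omega> ^ 3"
            using \<xi>0[of \<omega>] \<theta>3[of \<omega>] r by (simp add: \<theta>_def power_divide)
          then show "ennreal (\<xi> \<omega>) * indicator {\<omega>. ?ev \<omega>} \<omega> = ennreal (root 4 m ^ 3 * (\<theta> \<omega> ^ 3 * of_bool (L.concentrated A w a b \<omega>)))"
            unfolding ev by (simp add: indicator_def)
        qed
        also have "\<dots> = ennreal (expectation (\<lambda>\<omega>. root 4 m ^ 3 * (\<theta> \<omega> ^ 3 * of_bool (L.concentrated A w a b \<omega>))))"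
          by (rule nn_integral_eq_integral) (use L.concentrated_integrable[OF weight] L.weightD(3)[OF weight] r in auto)
        also have "\<dots> = ennreal (root 4 m ^ 3 * expectation (\<lambda>\<omega>. \<theta> \<omega> ^ 3 * of_bool (L.concentrated A w a b \<omega>)))"
          by simp
        also have "\<dots> \<le> ennreal (root 4 m ^ 3 * (156 * \<Delta>))"
          using r by (intro ennreal_leI mult_left_mono bound) auto
        also have "\<dots> = 156 * lp_norm M (4 / 3) \<xi> * ennreal \<Delta>"
          using int r \<Delta>0 by (simp add: norm_\<xi> ennreal_mult mult_ac)
        also have "\<dots> \<le> 156 * lp_norm M (4 / 3) \<xi> * (\<Sum>i = 0..7. \<delta> i)"
          by (rule mult_left_mono[OF \<Delta>_le]) simp
        finally show ?thesis .
      qed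
    qed
  qed
qed

end
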